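(* Let $\varepsilon\in(0,1]$, $\delta\in(0,1]$ and let $w_0\in Y$ satisfy $\hat K^\delta(w_0)\in L^1(\Omega)$. Let $u^*=[u_1^*,\dots,u_n^*]\in\mathbb{X}$ be an optimal control of $(\mathrm{OP})^{(\varepsilon,\delta)}$, and let $w^*=[w_1^*,\dots,w_n^*]\in\mathbb{X}$ be the solution to $(\mathrm{AC})^{(\varepsilon,\delta)}$ for the forcing term $u^*$ and initial data $w_0$. Then $$M_u(p_i^*+u_i^* )=0 \ \text{ in } X,\quad \text{for every } i=1,\dots,n,$$ where $p^*=[p_1^*,\dots,p_n^*]\in\mathbb{X}$ (with $p_i^*\in Y$ for all $i$) is the unique solution to the variational system $$\frac1\tau(p_i^*-p_{i+1}^*,\varphi)_X+\big((f^\varepsilon)''(\partial_xw_i^* )\partial_xp_i^*,\partial_x\varphi\big)_X+\nu^2(\partial_xp_i^*,\partial_x\varphi)_X+\big(g'(w_i^* )p_i^*,\varphi\big)_X+\big((K^\delta)'(w_i^* )p_i^*,\varphi\big)_X=\big(M_w(w_i^*-w_i^{\mathrm{ad}}),\varphi\big)_X$$ for all $\varphi\in Y$ and $i=n,\dots,3,2,1$, subject to the terminal condition $p_{n+1}^*=0$ in $X$.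
   Context: Let $0<L,T<\infty$, $\Omega := (-L,L)$, $X := L^2(\Omega)$, $Y := H^1(\Omega)\ (\subset C(\overline\Omega))$, $n\in\mathbb{N}$, $\mathbb{X} := [X]^n$; $\partial_x$ is the distributional derivative. $\nu>0$, $M_u\ge 0$, $M_w\ge 0$ are fixed constants, and $w^{\mathrm{ad}}=[w_1^{\mathrm{ad}},\dots,w_n^{\mathrm{ad}}]\in\mathbb{X}$ is a fixed target profile. Mosco convergence: for proper l.s.c. convex functions $\psi_n,\psi$ on a Hilbert space $H$, $\psi_n \to \psi$ in the sense of Mosco iff (M1) $\liminf_n \psi_n(w_n) \ge \psi(w)$ whenever $w_n \to w$ weakly in $H$; (M2) for every $w \in D(\psi)$ there are $w_n \to w$ in $H$ with $\psi_n(w_n) \to \psi(w)$. For a family with a continuous parameter, convergence is meant along every sequence of parameters converging to the given limit. Assumption on $f^\varepsilon$: $f^0(r) := |r|$; $\{f^\varepsilon\}_{\varepsilon\in(0,1]} \subset C^2(\mathbb{R})$ are convex functions with $f^\varepsilon(0)=0$, $f^\varepsilon \ge 0$ on $\mathbb{R}$; for every $\varepsilon_0 \in [0,1]$, as $\varepsilon \to \varepsilon_0$, $f^\varepsilon(r) \to f^{\varepsilon_0}(r)$ for every $r\in\mathbb{R}$ and $f^\varepsilon \to f^{\varepsilon_0}$ on $\mathbb{R}$ in the sense of Mosco; there is $C_0>0$ independent of $\varepsilon$ with $|(f^\varepsilon)'(r)| \le C_0(1+|r|)$ for all $r \in \mathbb{R}$, $\varepsilon\in(0,1]$; and for every $\lambda>0$,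 $(f^\varepsilon)'' \to 0$ uniformly on $\{|r| \ge \lambda\}$ as $\varepsilon \to 0$. Assumption on $g$: $g\in C^1(\mathbb{R})$, there is $C_g>0$ such that $r\mapsto g(r)+C_g r$ is monotone (nondecreasing), and $g$ has a nonnegative primitive $0\le G\in C^2(\mathbb{R})$, $G'=g$. Assumption on $K^\delta$: $\hat K^0 := I_{[-1,1]}$ (equal to $0$ on $[-1,1]$ and $+\infty$ elsewhere) and $K^0 := \partial I_{[-1,1]}$ (set-valued subdifferential). $\{\hat K^\delta\}_{\delta\in(0,1]} \subset C^2(\mathbb{R})$ and $\{K^\delta\}_{\delta\in(0,1]} \subset C^1(\mathbb{R})$ satisfy: $K^\delta = (\hat K^\delta)'$ and $\hat K^\delta \equiv 0$ on $[-1,1]$ for all $\delta\in(0,1]$; for each $\delta\in(0,1]$ there is $C_K^\delta>0$ with $0 \le (K^\delta)' \le C_K^\delta$ on $\mathbb{R}$; for every $\delta_0\in[0,1]$, $\hat K^\delta \to \hat K^{\delta_0}$ on $\mathbb{R}$ in the sense of Mosco as $\delta\to\delta_0$, and if $\delta_0 \in (0,1]$ also $\hat K^\delta \to \hat K^{\delta_0}$ in $C_{\mathrm{loc}}(\mathbb{R})$. Time step: $\tau := T/n$ with $0<\tau<\tau^* := \frac{1}{8(C_g+1)}$. Functional: $\Psi^{(\varepsilon,\delta)}(z) := \int_\Omega f^\varepsilon(\partial_x z)\,dx + \frac{\nu^2}{2}\int_\Omega |\partial_x z|^2\,dx + \int_\Omega \hat K^\delta(z)\,dx$ if $z\in Y$,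 and $:=\infty$ if $z\in X\setminus Y$; $D(\Psi^{(\varepsilon,\delta)})$ is its effective domain. State-system $(\mathrm{AC})^{(\varepsilon,\delta)}$ ($\varepsilon,\delta\in(0,1]$) for forcing $u\in\mathbb{X}$ and initial value $w_0\in Y$ with $\hat K^\delta(w_0)\in L^1(\Omega)$: find $w=[w_1,\dots,w_n]$ with $$\frac1\tau(w_i-w_{i-1}) - \partial_x\big((f^\varepsilon)'(\partial_x w_i)+\nu^2\partial_x w_i\big) + K^\delta(w_i) + g(w_i) = M_u u_i \text{ in } \Omega,\quad \partial_x w_i(\pm L)=0,\quad i=1,\dots,n.$$ Being a solution means: $w_i\in D(\Psi^{(\varepsilon,\delta)})$ and, for all $z\in D(\Psi^{(\varepsilon,\delta)})$ and $i=1,\dots,n$, $$\frac1\tau(w_i-w_{i-1},w_i-z)_X+(g(w_i)-M_uu_i,w_i-z)_X+\Psi^{(\varepsilon,\delta)}(w_i)-\Psi^{(\varepsilon,\delta)}(z)\le 0.$$ A unique solution exists, and it belongs to $[H^2(\Omega)]^n$ (so $w_i\in C^1(\overline\Omega)$). Optimal control problem $(\mathrm{OP})^{(\varepsilon,\delta)}$: find $u^*\in\mathbb{X}$ (an optimal control) minimizing over $\mathbb{X}$ the cost $$\mathcal{J}^{(\varepsilon,\delta)}(u) := \frac{M_w}{2}|w-w^{\mathrm{ad}}|_{\mathbb{X}}^2+\frac{M_u}{2}|u|_{\mathbb{X}}^2,$$ where $w$ is the solution to $(\mathrm{AC})^{(\varepsilon,\delta)}$ for the forcing term $u$ and initial data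 $w_0$. *)

theory Defs
  imports "HOL-Analysis.Analysis"
begin

definition Ck :: "nat \<Rightarrow> (real \<Rightarrow> real) \<Rightarrow> bool" where
  "Ck k f \<longleftrightarrow> (\<forall>j<k. \<forall>x. (deriv ^^ j) f field_differentiable (at x))
      \<and> continuous_on UNIV ((deriv ^^ k) f)"


text \<open>Elements of \<open>L\<^sup>2(\<Omega>)\<close> and \<open>H\<^sup>1(\<Omega>)\<close> are represented by functions \<open>real \<Rightarrow> real\<close>, whose values
  outside \<open>\<Omega>\<close> are irrelevant; equality in \<open>L\<^sup>2(\<Omega>)\<close> is equality almost everywhere in \<open>\<Omega>\<close>.\<close>

definition L2 :: "real set \<Rightarrow> (real \<Rightarrow> real) set" where
  "L2 \<Omega> = {z \<in> borel_measurable (lebesgue_on \<Omega>). integrable (lebesgue_on \<Omega>) (\<lambda>x. (z x)\<^sup>2)}"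

definition L2_eq :: "real set \<Rightarrow> (real \<Rightarrow> real) \<Rightarrow> (real \<Rightarrow> real) \<Rightarrow> bool" where
  "L2_eq \<Omega> y z \<longleftrightarrow> (AE x in lebesgue_on \<Omega>. y x = z x)"

definition L2_inner :: "real set \<Rightarrow> (real \<Rightarrow> real) \<Rightarrow> (real \<Rightarrow> real) \<Rightarrow> real" where
  "L2_inner \<Omega> y z = (\<integral>x. y x * z x \<partial>lebesgue_on \<Omega>)"

definition L2_norm :: "real set \<Rightarrow> (real \<Rightarrow> real) \<Rightarrow> real" where
  "L2_norm \<Omega> z = sqrt (L2_inner \<Omega> z z)"

definition test_function :: "real set \<Rightarrow> (real \<Rightarrow> real) \<Rightarrow> bool" where
  "test_function \<Omega> \<phi> \<longleftrightarrow> (\<forall>k. Ck k \<phi>) \<and> (\<exists>S. compact S \<and> S \<subseteq> \<Omega> \<and> (\<forall>x. x \<notin> S \<longrightarrow> \<phi> x = 0))"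

definition has_weak_deriv :: "real set \<Rightarrow> (real \<Rightarrow> real) \<Rightarrow> (real \<Rightarrow> real) \<Rightarrow> bool" where
  "has_weak_deriv \<Omega> z v \<longleftrightarrow>
     (\<forall>\<phi>. test_function \<Omega> \<phi> \<longrightarrow> L2_inner \<Omega> z (deriv \<phi>) = - L2_inner \<Omega> v \<phi>)"

definition H1 :: "real set \<Rightarrow> (real \<Rightarrow> real) set" where
  "H1 \<Omega> = {z \<in> L2 \<Omega>. \<exists>v \<in> L2 \<Omega>. has_weak_deriv \<Omega> z v}"

text \<open>The distributional derivative of \<open>z \<in> H1 \<Omega>\<close> is determined only up to null sets; \<open>dx \<Omega> z\<close> is
  one of its representatives.\<close>

definition dx :: "real set \<Rightarrow> (real \<Rightarrow> real) \<Rightarrow> real \<Rightarrow> real" where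
  "dx \<Omega> z = (SOME v. v \<in> L2 \<Omega> \<and> has_weak_deriv \<Omega> z v)"


definition eff_dom :: "('a \<Rightarrow> ereal) \<Rightarrow> 'a set" where
  "eff_dom \<psi> = {z. \<psi> z < \<infinity>}"

definition weakly_tendsto :: "(nat \<Rightarrow> 'a::{real_inner,complete_space}) \<Rightarrow> 'a \<Rightarrow> bool" where
  "weakly_tendsto z l \<longleftrightarrow> (\<forall>y. (\<lambda>k. z k \<bullet> y) \<longlonglongrightarrow> l \<bullet> y)"

definition mosco_tendsto ::
  "(nat \<Rightarrow> 'a::{real_inner,complete_space} \<Rightarrow> ereal) \<Rightarrow> ('a \<Rightarrow> ereal) \<Rightarrow> bool" where
  "mosco_tendsto \<psi>s \<psi> \<longleftrightarrow>
     (\<forall>z l. weakly_tendsto z l \<longrightarrow> \<psi> l \<le> liminf (\<lambda>k. \<psi>s k (z k))) \<and>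
     (\<forall>l \<in> eff_dom \<psi>. \<exists>z. z \<longlonglongrightarrow> l \<and> (\<lambda>k. \<psi>s k (z k)) \<longlonglongrightarrow> \<psi> l)"

text \<open>Mosco convergence of a family indexed by \<open>(0,1]\<close>, as the index tends to \<open>a\<close>.\<close>

definition mosco_family ::
  "(real \<Rightarrow> 'a::{real_inner,complete_space} \<Rightarrow> ereal) \<Rightarrow> real \<Rightarrow> bool" where
  "mosco_family \<psi> a \<longleftrightarrow>
     (\<forall>s. (\<forall>k. s k \<in> {0<..1}) \<and> s \<longlonglongrightarrow> a \<longrightarrow> mosco_tendsto (\<lambda>k. \<psi> (s k)) (\<psi> a))"


definition assumption_f :: "(real \<Rightarrow> real \<Rightarrow> real) \<Rightarrow> bool" where
  "assumption_f f \<longleftrightarrow>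
     (\<forall>r. f 0 r = \<bar>r\<bar>) \<and>
     (\<forall>\<epsilon>\<in>{0<..1}. Ck 2 (f \<epsilon>) \<and> convex_on UNIV (f \<epsilon>) \<and> f \<epsilon> 0 = 0 \<and> (\<forall>r. 0 \<le> f \<epsilon> r)) \<and>
     (\<forall>\<epsilon>\<^sub>0\<in>{0..1}.
        (\<forall>r. ((\<lambda>\<epsilon>. f \<epsilon> r) \<longlongrightarrow> f \<epsilon>\<^sub>0 r) (at \<epsilon>\<^sub>0 within {0<..1})) \<and>
        mosco_family (\<lambda>\<epsilon> r. ereal (f \<epsilon> r)) \<epsilon>\<^sub>0) \<and>
     (\<exists>C\<^sub>0>0. \<forall>\<epsilon>\<in>{0<..1}. \<forall>r. \<bar>deriv (f \<epsilon>) r\<bar> \<le> C\<^sub>0 * (1 + \<bar>r\<bar>)) \<and>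
     (\<forall>l>0. uniform_limit {r. l \<le> \<bar>r\<bar>} (\<lambda>\<epsilon>. deriv (deriv (f \<epsilon>))) (\<lambda>_. 0) (at 0 within {0<..1}))"

definition assumption_g :: "(real \<Rightarrow> real) \<Rightarrow> real \<Rightarrow> bool" where
  "assumption_g g C\<^sub>g \<longleftrightarrow>
     Ck 1 g \<and> C\<^sub>g > 0 \<and> mono (\<lambda>r. g r + C\<^sub>g * r) \<and>
     (\<exists>G. Ck 2 G \<and> (\<forall>r. 0 \<le> G r) \<and> (\<forall>r. (G has_real_derivative g r) (at r)))"

text \<open>The potential at parameter \<open>0\<close> is the indicator function of \<open>[-1,1]\<close>, which is not real-valued.
  The real-valued family \<open>Kh\<close> carries the potentials for positive parameters only, and \<open>Kpot Kh\<close> is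
  the full family.\<close>

definition Kpot :: "(real \<Rightarrow> real \<Rightarrow> real) \<Rightarrow> real \<Rightarrow> real \<Rightarrow> ereal" where
  "Kpot Kh \<delta> r = (if \<delta> = 0 then (if r \<in> {-1..1} then 0 else \<infinity>) else ereal (Kh \<delta> r))"

definition assumption_K :: "(real \<Rightarrow> real \<Rightarrow> real) \<Rightarrow> (real \<Rightarrow> real \<Rightarrow> real) \<Rightarrow> bool" where
  "assumption_K Kh K \<longleftrightarrow>
     (\<forall>\<delta>\<in>{0<..1}. Ck 2 (Kh \<delta>) \<and> Ck 1 (K \<delta>) \<and>
        (\<forall>r. (Kh \<delta> has_real_derivative K \<delta> r) (at r)) \<and>
        (\<forall>r\<in>{-1..1}. Kh \<delta> r = 0) \<and>
        (\<exists>C>0. \<forall>r. 0 \<le> deriv (K \<delta>) r \<and> deriv (K \<delta>) r \<le> C)) \<and>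
     (\<forall>\<delta>\<^sub>0\<in>{0..1}. mosco_family (Kpot Kh) \<delta>\<^sub>0) \<and>
     (\<forall>\<delta>\<^sub>0\<in>{0<..1}. \<forall>S. compact S \<longrightarrow> uniform_limit S Kh (Kh \<delta>\<^sub>0) (at \<delta>\<^sub>0 within {0<..1}))"


text \<open>\<open>\<Psi>\<close> for a single pair \<open>f\<close>, \<open>k\<close> of nonnegative potentials. The integrals over \<open>f\<close> and \<open>k\<close> may be
  infinite, hence the nonnegative Lebesgue integral.\<close>

definition Psi ::
  "real set \<Rightarrow> real \<Rightarrow> (real \<Rightarrow> real) \<Rightarrow> (real \<Rightarrow> ereal) \<Rightarrow> (real \<Rightarrow> real) \<Rightarrow> ereal" where
  "Psi \<Omega> \<nu> f k z =
     (if z \<in> H1 \<Omega> then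
        enn2ereal (\<integral>\<^sup>+x. ennreal (f (dx \<Omega> z x)) \<partial>lebesgue_on \<Omega>)
        + ereal (\<nu>\<^sup>2 / 2 * (\<integral>x. \<bar>dx \<Omega> z x\<bar>\<^sup>2 \<partial>lebesgue_on \<Omega>))
        + enn2ereal (\<integral>\<^sup>+x. e2ennreal (k (z x)) \<partial>lebesgue_on \<Omega>)
      else \<infinity>)"

text \<open>An \<open>n\<close>-tuple \<open>[z\<^sub>1, \<dots>, z\<^sub>n]\<close> of functions is a map on \<open>nat\<close> of which only the values at
  \<open>1, \<dots>, n\<close> matter.\<close>

definition L2_tuples :: "real set \<Rightarrow> nat \<Rightarrow> (nat \<Rightarrow> real \<Rightarrow> real) set" where
  "L2_tuples \<Omega> n = {z. \<forall>i\<in>{1..n}. z i \<in> L2 \<Omega>}"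

definition state_solution ::
  "real set \<Rightarrow> nat \<Rightarrow> real \<Rightarrow> real \<Rightarrow> real \<Rightarrow> (real \<Rightarrow> real) \<Rightarrow> (real \<Rightarrow> ereal) \<Rightarrow> (real \<Rightarrow> real)
    \<Rightarrow> (real \<Rightarrow> real) \<Rightarrow> (nat \<Rightarrow> real \<Rightarrow> real) \<Rightarrow> (nat \<Rightarrow> real \<Rightarrow> real) \<Rightarrow> bool" where
  "state_solution \<Omega> n \<tau> \<nu> M\<^sub>u f k g w\<^sub>0 u w \<longleftrightarrow>
     (\<forall>i\<in>{1..n}. w i \<in> eff_dom (Psi \<Omega> \<nu> f k) \<and>
       (\<forall>z \<in> eff_dom (Psi \<Omega> \<nu> f k).
          ereal (1 / \<tau> * L2_inner \<Omega> (\<lambda>x. w i x - (w(0 := w\<^sub>0)) (i - 1) x) (\<lambda>x. w i x - z x)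
            + L2_inner \<Omega> (\<lambda>x. g (w i x) - M\<^sub>u * u i x) (\<lambda>x. w i x - z x))
          + Psi \<Omega> \<nu> f k (w i) - Psi \<Omega> \<nu> f k z \<le> 0))"

text \<open>The state is unique up to null sets, so the choice of representative does not affect the cost.\<close>

definition state ::
  "real set \<Rightarrow> nat \<Rightarrow> real \<Rightarrow> real \<Rightarrow> real \<Rightarrow> (real \<Rightarrow> real) \<Rightarrow> (real \<Rightarrow> ereal) \<Rightarrow> (real \<Rightarrow> real)
    \<Rightarrow> (real \<Rightarrow> real) \<Rightarrow> (nat \<Rightarrow> real \<Rightarrow> real) \<Rightarrow> nat \<Rightarrow> real \<Rightarrow> real" where
  "state \<Omega> n \<tau> \<nu> M\<^sub>u f k g w\<^sub>0 u = (SOME w. state_solution \<Omega> n \<tau> \<nu> M\<^sub>u f k g w\<^sub>0 u w)"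

definition cost ::
  "real set \<Rightarrow> nat \<Rightarrow> real \<Rightarrow> real \<Rightarrow> real \<Rightarrow> real \<Rightarrow> (real \<Rightarrow> real) \<Rightarrow> (real \<Rightarrow> ereal) \<Rightarrow> (real \<Rightarrow> real)
    \<Rightarrow> (real \<Rightarrow> real) \<Rightarrow> (nat \<Rightarrow> real \<Rightarrow> real) \<Rightarrow> (nat \<Rightarrow> real \<Rightarrow> real) \<Rightarrow> real" where
  "cost \<Omega> n \<tau> \<nu> M\<^sub>u M\<^sub>w f k g w\<^sub>0 wad u =
     (let w = state \<Omega> n \<tau> \<nu> M\<^sub>u f k g w\<^sub>0 u in
        M\<^sub>w / 2 * (\<Sum>i=1..n. (L2_norm \<Omega> (\<lambda>x. w i x - wad i x))\<^sup>2)
        + M\<^sub>u / 2 * (\<Sum>i=1..n. (L2_norm \<Omega> (u i))\<^sup>2))"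

definition optimal_control ::
  "real set \<Rightarrow> nat \<Rightarrow> real \<Rightarrow> real \<Rightarrow> real \<Rightarrow> real \<Rightarrow> (real \<Rightarrow> real) \<Rightarrow> (real \<Rightarrow> ereal) \<Rightarrow> (real \<Rightarrow> real)
    \<Rightarrow> (real \<Rightarrow> real) \<Rightarrow> (nat \<Rightarrow> real \<Rightarrow> real) \<Rightarrow> (nat \<Rightarrow> real \<Rightarrow> real) \<Rightarrow> bool" where
  "optimal_control \<Omega> n \<tau> \<nu> M\<^sub>u M\<^sub>w f k g w\<^sub>0 wad u \<longleftrightarrow>
     u \<in> L2_tuples \<Omega> n \<and>
     (\<forall>v \<in> L2_tuples \<Omega> n.
        cost \<Omega> n \<tau> \<nu> M\<^sub>u M\<^sub>w f k g w\<^sub>0 wad u \<le> cost \<Omega> n \<tau> \<nu> M\<^sub>u M\<^sub>w f k g w\<^sub>0 wad v)"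

text \<open>Here \<open>K\<close> is the derivative of the potential; the update of \<open>p\<close> at \<open>n + 1\<close> is the terminal
  condition.\<close>

definition adjoint_solution ::
  "real set \<Rightarrow> nat \<Rightarrow> real \<Rightarrow> real \<Rightarrow> real \<Rightarrow> (real \<Rightarrow> real) \<Rightarrow> (real \<Rightarrow> real) \<Rightarrow> (real \<Rightarrow> real)
    \<Rightarrow> (nat \<Rightarrow> real \<Rightarrow> real) \<Rightarrow> (nat \<Rightarrow> real \<Rightarrow> real) \<Rightarrow> (nat \<Rightarrow> real \<Rightarrow> real) \<Rightarrow> bool" where
  "adjoint_solution \<Omega> n \<tau> \<nu> M\<^sub>w f K g wad w p \<longleftrightarrow>
     (\<forall>i\<in>{1..n}. p i \<in> H1 \<Omega> \<and>
       (\<forall>\<phi> \<in> H1 \<Omega>.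
          1 / \<tau> * L2_inner \<Omega> (\<lambda>x. p i x - (p(n + 1 := (\<lambda>_. 0))) (i + 1) x) \<phi>
          + L2_inner \<Omega> (\<lambda>x. deriv (deriv f) (dx \<Omega> (w i) x) * dx \<Omega> (p i) x) (dx \<Omega> \<phi>)
          + \<nu>\<^sup>2 * L2_inner \<Omega> (dx \<Omega> (p i)) (dx \<Omega> \<phi>)
          + L2_inner \<Omega> (\<lambda>x. deriv g (w i x) * p i x) \<phi>
          + L2_inner \<Omega> (\<lambda>x. deriv K (w i x) * p i x) \<phi>
          = L2_inner \<Omega> (\<lambda>x. M\<^sub>w * (w i x - wad i x)) \<phi>))"

end

theory Submission
  imports Defs
begin

text \<open>
The domain is one-dimensional, so every time step is a two-point boundary value problem for an
  ordinary differential equation, and the whole proof rests on that. Put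
  \<open>A r = f' r + \<nu>\<^sup>2 * r\<close> and \<open>h r = r / \<tau> + K r + g r\<close>. The \<open>i\<close>-th state equation is
  \<open>- (A w')' + h w = F\<close> with \<open>F = w\<^bsub>i-1\<^esub> / \<tau> + M\<^sub>u u\<^sub>i\<close> and with vanishing flux \<open>A w'\<close> at both ends, where
  \<open>A' \<ge> \<nu>\<^sup>2\<close> and \<open>h' \<ge> 1 / \<tau> - C\<^sub>g > 0\<close>. If \<open>\<Phi>\<close> is the primitive of \<open>F\<close> and \<open>q\<close> the flux plus \<open>\<Phi>\<close>,
  this is the system \<open>w' = A\<^sup>-\<^sup>1 (q - \<Phi>)\<close>, \<open>q' = h w\<close>, whose right-hand side is continuous although \<open>F\<close>
  is only square integrable. Shooting in the initial value of \<open>w\<close> solves it (\<open>flow_shooting\<close>,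
  \<open>neumann_exists\<close>), and a maximum principle for \<open>q\<close> bounds the differences of two solutions and of
  their derivatives uniformly by the \<open>L\<^sup>1\<close> distance of the right-hand sides (\<open>flow_flux_le\<close>,
  \<open>flow_stability\<close>). The adjoint equation has the same shape with linear coefficients, so that the
  same lemmas produce the adjoint state.

  The link with the variational formulation is that a function in \<open>H\<^sup>1\<close> is almost everywhere a constant
  plus the primitive of its weak derivative (\<open>du_Bois_Reymond\<close>, \<open>has_weak_derivD\<close>). Integration by parts
  (\<open>integration_by_parts_H1\<close>) turns the differential equation into its weak form, convexity turns the
  weak form into the variational inequality (\<open>step_variational\<close>), and strict monotonicity shows that
  every solution of the variational inequality equals the classical one almost everywhere
  (\<open>variational_unique\<close>, \<open>solution_unique\<close>). Hence both the given state and the state that the cost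
  selects by choice may be replaced by the classical one.

  For the optimality condition, let \<open>y\<close> be the difference of the states for the controls \<open>u + s v\<close> and
  \<open>u\<close>. Test the adjoint equation with \<open>y\<close>, test the difference of the state equations with \<open>p\<close>, and
  subtract (\<open>first_variation\<close>). The terms that couple neighbouring time steps telescope, and what is
  left are first-order Taylor remainders of \<open>A\<close> and \<open>h\<close>. They are \<open>o(s)\<close> because \<open>y\<close> and its derivative are
  \<open>O(s)\<close> uniformly (\<open>steps_stability\<close>). Therefore the cost changes by
  \<open>s * M\<^sub>u * (\<Sum>i. \<langle>p\<^sub>i + u\<^sub>i, v\<^sub>i\<rangle>) + o(s)\<close>, and optimality of \<open>u\<close> with \<open>v = p + u\<close> and \<open>s < 0\<close> forces
  \<open>M\<^sub>u * (\<Sum>i. \<parallel>p\<^sub>i + u\<^sub>i\<parallel>\<^sup>2) \<le> 0\<close> (\<open>optimality\<close>).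
\<close>

section \<open>Smooth functions with compact support\<close>

text \<open>For \<open>p = 1\<close> this is the classical function that is smooth, flat at \<open>0\<close> and positive on the right half
  line. The polynomial factor makes the family closed under differentiation.\<close>

definition flat :: "real poly \<Rightarrow> real \<Rightarrow> real" where
  "flat p x = (if x \<le> 0 then 0 else poly p (1/x) * exp (-(1/x)))"

lemma poly_div_exp_tendsto_0: "((\<lambda>y::real. poly p y / exp y) \<longlongrightarrow> 0) at_top"
proof (induction p)
  case 0
  then show ?case by simp
next
  case (pCons c p)
  have *: "((\<lambda>y::real. poly p y * (y ^ k / exp y)) \<longlongrightarrow> 0) at_top" for p k
  proof (induction p arbitrary: k)
    case 0
    then show ?case by simp
  next
    case (pCons c p)
    have "((\<lambda>y::real. c * (y ^ k / exp y) + poly p y * (y ^ Suc k / exp y)) \<longlongrightarrow> c * 0 + 0) at_top"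
      by (intro tendsto_intros pCons.IH tendsto_power_div_exp_0)
    then show ?case by (simp add: algebra_simps)
  qed
  show ?case using *[of "pCons c p" 0] by simp
qed

text \<open>At \<open>0\<close> the derivative exists because the exponential beats every polynomial in \<open>1 / x\<close>.\<close>

lemma flat_has_derivative:
  "(flat p has_real_derivative flat (monom 1 2 * (p - pderiv p)) x) (at x)"
proof -
  consider "x > 0" | "x < 0" | "x = 0" by linarith
  then show ?thesis
  proof cases
    case 1
    have "((\<lambda>x. poly p (1/x) * exp (-(1/x))) has_real_derivative
        flat (monom 1 2 * (p - pderiv p)) x) (at x)"
      using 1 by (auto intro!: derivative_eq_intros
          simp: flat_def poly_monom field_simps power2_eq_square)
    moreover have "eventually (\<lambda>y. y \<in> {0<..}) (nhds x)"
      using 1 by (intro eventually_nhds_in_open) auto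
    then have "eventually (\<lambda>y. flat p y = poly p (1/y) * exp (-(1/y))) (nhds x)"
      by eventually_elim (simp add: flat_def)
    ultimately show ?thesis by (subst DERIV_cong_ev[OF refl _ refl])
  next
    case 2
    have "((\<lambda>x. 0) has_real_derivative flat (monom 1 2 * (p - pderiv p)) x) (at x)"
      using 2 by (simp add: flat_def)
    moreover have "eventually (\<lambda>y. y \<in> {..<0}) (nhds x)"
      using 2 by (intro eventually_nhds_in_open) auto
    then have "eventually (\<lambda>y. flat p y = 0) (nhds x)"
      by eventually_elim (simp add: flat_def)
    ultimately show ?thesis by (subst DERIV_cong_ev[OF refl _ refl])
  next
    case 3
    have lim: "((\<lambda>h. flat p h / h) \<longlongrightarrow> 0) (at_right 0)"
    proof -
      have "((\<lambda>h. poly (pCons 0 p) (inverse h) / exp (inverse h)) \<longlongrightarrow> 0) (at_right (0::real))"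
        by (rule filterlim_compose[OF poly_div_exp_tendsto_0 filterlim_inverse_at_top_right])
      then show ?thesis
      proof (rule Lim_transform_eventually)
        show "\<forall>\<^sub>F h in at_right 0. poly (pCons 0 p) (inverse h) / exp (inverse h) = flat p h / h"
          using eventually_at_right_less
          by (rule eventually_mono) (auto simp: flat_def exp_minus divide_simps)
      qed
    qed
    have "((\<lambda>h. flat p h / h) \<longlongrightarrow> 0) (at_left 0)"
      by (rule Lim_transform_eventually[OF tendsto_const])
         (auto simp: eventually_at_filter flat_def)
    with lim have "((\<lambda>h. flat p h / h) \<longlongrightarrow> 0) (at 0)"
      by (simp add: filterlim_split_at)
    then show ?thesis using 3
      by (simp add: DERIV_def flat_def)
  qed
qed

text \<open>Higher derivatives never have to be computed: every member of this algebra is differentiable with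
  a derivative that is again a member, so all members are smooth.\<close>

inductive_set flat_alg :: "(real \<Rightarrow> real) set" where
  base: "(\<lambda>x. flat p (c * x + d)) \<in> flat_alg"
| add: "f \<in> flat_alg \<Longrightarrow> g \<in> flat_alg \<Longrightarrow> (\<lambda>x. f x + g x) \<in> flat_alg"
| scale: "f \<in> flat_alg \<Longrightarrow> (\<lambda>x. c * f x) \<in> flat_alg"
| mult: "f \<in> flat_alg \<Longrightarrow> g \<in> flat_alg \<Longrightarrow> (\<lambda>x. f x * g x) \<in> flat_alg"

lemma flat_alg_has_derivative:
  "f \<in> flat_alg \<Longrightarrow> \<exists>f'\<in>flat_alg. \<forall>x. (f has_real_derivative f' x) (at x)"
proof (induction rule: flat_alg.induct)
  case (base p c d)
  let ?p = "monom 1 2 * (p - pderiv p)"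
  have "((\<lambda>x. flat p (c * x + d)) has_real_derivative c * flat ?p (c * x + d)) (at x)" for x
  proof -
    have "((\<lambda>x. c * x + d) has_real_derivative c) (at x)"
      by (auto intro!: derivative_eq_intros)
    from DERIV_chain2[OF flat_has_derivative this] show ?thesis by (simp add: mult.commute)
  qed
  then show ?case
    by (intro bexI[of _ "\<lambda>x. c * flat ?p (c * x + d)"] flat_alg.intros) auto
next
  case (add f g)
  then obtain f' g' where "f' \<in> flat_alg" "g' \<in> flat_alg"
      "\<forall>x. (f has_real_derivative f' x) (at x)" "\<forall>x. (g has_real_derivative g' x) (at x)" by blast
  then show ?case
    by (intro bexI[of _ "\<lambda>x. f' x + g' x"] flat_alg.intros) (auto intro!: derivative_eq_intros)
next
  case (scale f c)
  then obtain f' where "f' \<in> flat_alg"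
      "\<forall>x. (f has_real_derivative f' x) (at x)" by blast
  then show ?case
    by (intro bexI[of _ "\<lambda>x. c * f' x"] flat_alg.intros) (auto intro!: DERIV_cmult)
next
  case (mult f g)
  then obtain f' g' where "f' \<in> flat_alg" "g' \<in> flat_alg"
      "\<forall>x. (f has_real_derivative f' x) (at x)" "\<forall>x. (g has_real_derivative g' x) (at x)" by blast
  then show ?case using mult.hyps
    by (intro bexI[of _ "\<lambda>x. f' x * g x + f x * g' x"] flat_alg.intros)
       (auto intro!: derivative_eq_intros)
qed

lemma flat_alg_deriv:
  assumes "f \<in> flat_alg" shows "deriv f \<in> flat_alg" "(f has_real_derivative deriv f x) (at x)"
proof -
  obtain f' where f': "f' \<in> flat_alg" "\<forall>x. (f has_real_derivative f' x) (at x)"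
    using flat_alg_has_derivative[OF assms] by blast
  then have "deriv f = f'" by (auto intro!: DERIV_imp_deriv)
  with f' show "deriv f \<in> flat_alg" "(f has_real_derivative deriv f x) (at x)" by auto
qed

lemma flat_alg_funpow_deriv: "f \<in> flat_alg \<Longrightarrow> (deriv ^^ j) f \<in> flat_alg"
  by (induction j) (auto intro: flat_alg_deriv)

lemma flat_alg_isCont: "f \<in> flat_alg \<Longrightarrow> isCont f x"
  using flat_alg_deriv(2) DERIV_isCont by blast

lemma flat_alg_Ck: "f \<in> flat_alg \<Longrightarrow> Ck k f"
  unfolding Ck_def field_differentiable_def
  by (auto intro!: exI flat_alg_deriv(2)[OF flat_alg_funpow_deriv]
      flat_alg_isCont[OF flat_alg_funpow_deriv] continuous_at_imp_continuous_on)

lemma Ck_if_deriv_flat_alg: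
  assumes "\<And>x. (f has_real_derivative f' x) (at x)" "f' \<in> flat_alg"
  shows "Ck k f"
proof -
  have d: "deriv f = f'" using assms(1) by (auto intro!: DERIV_imp_deriv)
  have *: "(deriv ^^ Suc j) f = (deriv ^^ j) f'" for j
    by (simp add: funpow_Suc_right d del: funpow.simps)
  have ex: "\<exists>f'. ((deriv ^^ j) f has_real_derivative f') (at x)" for j x
  proof (cases j)
    case 0 then show ?thesis using assms(1) by auto
  next
    case (Suc i) then show ?thesis
      unfolding Suc * using flat_alg_deriv(2)[OF flat_alg_funpow_deriv[OF assms(2)]] by blast
  qed
  then have "isCont ((deriv ^^ j) f) x" for j x using DERIV_isCont by blast
  with ex show ?thesis unfolding Ck_def field_differentiable_def
    by (auto intro!: continuous_at_imp_continuous_on)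
qed

text \<open>As \<open>k\<close> grows, these functions increase to the indicator of \<open>{s<..<t}\<close>, while their supports stay at
  distance \<open>1 / k\<close> from the end points. They are therefore admissible even if \<open>s\<close> or \<open>t\<close> lies on the
  boundary of the domain.\<close>

definition bump :: "real \<Rightarrow> real \<Rightarrow> nat \<Rightarrow> real \<Rightarrow> real" where
  "bump s t k x = flat 1 (real k * x + (- real k * s - 1)) * flat 1 (- real k * x + (real k * t - 1))"

lemma bump_flat_alg: "bump s t k \<in> flat_alg"
  unfolding bump_def[abs_def] by (intro flat_alg.intros)

lemma bump_bounds: "0 \<le> bump s t k x" "bump s t k x \<le> 1"
proof -
  have "0 \<le> flat 1 y" "flat 1 y \<le> 1" for y by (auto simp: flat_def)
  then show "0 \<le> bump s t k x" "bump s t k x \<le> 1"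
    by (auto simp: bump_def intro!: mult_le_one)
qed

lemma bump_support: "k > 0 \<Longrightarrow> x \<notin> {s + 1 / k .. t - 1 / k} \<Longrightarrow> bump s t k x = 0"
  by (auto simp: bump_def flat_def field_simps)

lemma bump_tendsto: "(\<lambda>k. bump s t k x) \<longlonglongrightarrow> indicat_real {s<..<t} x"
proof (cases "s < x \<and> x < t")
  case True
  have *: "(\<lambda>k. flat 1 (c * real k - 1)) \<longlonglongrightarrow> 1" if "c > 0" for c :: real
  proof -
    have "filterlim (\<lambda>k. - 1 + c * real k) at_top sequentially"
      by (intro filterlim_tendsto_add_at_top[OF tendsto_const]
          filterlim_tendsto_pos_mult_at_top[OF tendsto_const that] filterlim_real_sequentially)
    then have lim: "filterlim (\<lambda>k. c * real k - 1) at_top sequentially" by simp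
    from lim have "(\<lambda>k. exp (-(inverse (c * real k - 1)))) \<longlonglongrightarrow> exp (- 0)"
      by (intro tendsto_intros tendsto_inverse_0_at_top)
    moreover have "eventually (\<lambda>k. c * real k - 1 > 0) sequentially"
      using lim unfolding filterlim_at_top_dense by blast
    then have "eventually (\<lambda>k. exp (-(inverse (c * real k - 1))) = flat 1 (c * real k - 1)) sequentially"
      by eventually_elim (auto simp: flat_def inverse_eq_divide)
    ultimately show ?thesis by (simp add: Lim_transform_eventually)
  qed
  have "(\<lambda>k. flat 1 ((x - s) * real k - 1) * flat 1 ((t - x) * real k - 1)) \<longlonglongrightarrow> 1 * 1"
    using True by (intro tendsto_mult *) auto
  moreover have "(x - s) * real k - 1 = real k * x + (- real k * s - 1)"
    "(t - x) * real k - 1 = - real k * x + (real k * t - 1)" for k by (simp_all add: algebra_simps)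
  ultimately show ?thesis using True by (simp add: bump_def)
next
  case False
  then have "eventually (\<lambda>k. bump s t k x = 0) sequentially"
  proof (intro eventually_mono[OF eventually_gt_at_top[of 0]] bump_support)
    fix k :: nat assume "k > 0"
    then have "s < s + 1 / k" "t - 1 / k < t" by auto
    with False show "x \<notin> {s + 1 / k..t - 1 / k}" unfolding atLeastAtMost_iff by linarith
  qed
  then have "(\<lambda>k. bump s t k x) \<longlonglongrightarrow> 0" by (rule tendsto_eventually)
  then show ?thesis using False by simp
qed

section \<open>The fundamental lemma of the calculus of variations\<close>

lemma lebesgue_on_interval_finite: "finite_measure (lebesgue_on {a<..<b::real})"
  by (rule finite_measure_lebesgue_on) auto

lemma borel_measurable_lebesgue_on_bump: "bump s t k \<in> borel_measurable (lebesgue_on S)"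
proof -
  have "continuous_on UNIV (bump s t k)"
    by (intro continuous_at_imp_continuous_on ballI flat_alg_isCont bump_flat_alg)
  then have "bump s t k \<in> borel_measurable borel" by (rule borel_measurable_continuous_onI)
  then show ?thesis
    by (intro measurable_restrict_space1) (simp add: measurable_completion)
qed

text \<open>The sets over which the integral vanishes form a Dynkin system containing the intervals, hence they
  include all Borel sets; Lebesgue measurable sets differ from Borel sets by null sets.\<close>

lemma AE_eq_0_if_intervals:
  fixes m :: "real \<Rightarrow> real"
  assumes m: "integrable (lebesgue_on {a<..<b}) m"
    and ab: "a < b"
    and 0: "\<And>s t. a \<le> s \<Longrightarrow> s < t \<Longrightarrow> t \<le> b \<Longrightarrow> (\<integral>x\<in>{s<..<t}. m x \<partial>lebesgue_on {a<..<b}) = 0"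
  shows "AE x in lebesgue_on {a<..<b}. m x = 0"
proof -
  let ?M = "lebesgue_on {a<..<b}"
  interpret finite_measure ?M by (rule lebesgue_on_interval_finite)
  have meas: "A \<inter> {a<..<b} \<in> sets ?M" if "A \<in> sets lebesgue" for A
    using that by (auto simp: sets_restrict_space)
  have si: "set_integrable ?M A m" if "A \<in> sets ?M" for A
    unfolding set_integrable_def by (rule integrable_mult_indicator[OF that m])
  have cong: "(\<integral>x\<in>A. m x \<partial>?M) = (\<integral>x\<in>A \<inter> {a<..<b}. m x \<partial>?M)" for A
    unfolding set_lebesgue_integral_def
    by (rule Bochner_Integration.integral_cong) (auto simp: indicator_def)
  have I: "(\<integral>x\<in>{s<..<t}. m x \<partial>?M) = 0" for s t
  proof (cases "max s a < min t b")
    case True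
    have "{s<..<t} \<inter> {a<..<b} = {max s a<..<min t b} \<inter> {a<..<b}" by auto
    then show ?thesis using 0[of "max s a" "min t b"] True
      by (metis cong max.cobounded2 min.cobounded2)
  next
    case False
    then have "{s<..<t} \<inter> {a<..<b} = {}" by auto
    then show ?thesis by (subst cong) (simp add: set_lebesgue_integral_def)
  qed
  have space: "(\<integral>x. m x \<partial>?M) = 0"
    using I[of a b] set_integral_space[OF m] by (simp add: space_restrict_space)
  have AE_notin: "AE x in ?M. x \<notin> N" if "N \<in> null_sets lborel" for N
    by (subst AE_restrict_space_iff)
       (use AE_not_in[OF null_sets_completionI[OF that]] in auto)
  have meas_m: "m \<in> borel_measurable ?M" using m by auto
  have bor: "(\<integral>x\<in>A. m x \<partial>?M) = 0" if "A \<in> sets borel" for A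
    using that
  proof (induction rule: borel_set_induct)
    case empty
    then show ?case by (simp add: set_lebesgue_integral_def)
  next
    case (interval s t)
    have "{s, t} \<in> null_sets lborel" by (rule finite_imp_null_set_lborel) simp
    from AE_notin[OF this] have "(\<integral>x\<in>{s..t} \<inter> {a<..<b}. m x \<partial>?M) = (\<integral>x\<in>{s<..<t} \<inter> {a<..<b}. m x \<partial>?M)"
      unfolding set_lebesgue_integral_def using meas_m
      by (intro integral_cong_AE borel_measurable_scaleR borel_measurable_indicator meas)
         (auto simp: indicator_def)
    then show ?case using I[of s t] by (simp only: cong[symmetric])
  next
    case (compl A)
    then have A: "A \<inter> {a<..<b} \<in> sets ?M" "- A \<inter> {a<..<b} \<in> sets ?M"
      by (auto intro!: meas)
    have "(\<integral>x\<in>A \<inter> {a<..<b} \<union> - A \<inter> {a<..<b}. m x \<partial>?M)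
        = (\<integral>x\<in>A \<inter> {a<..<b}. m x \<partial>?M) + (\<integral>x\<in>- A \<inter> {a<..<b}. m x \<partial>?M)"
      by (rule set_integral_Un) (use A si in auto)
    moreover have "A \<inter> {a<..<b} \<union> - A \<inter> {a<..<b} = space ?M"
      by (auto simp: space_restrict_space)
    ultimately show ?case using compl(2) space set_integral_space[OF m] by (simp only: cong[symmetric])
  next
    case (union A)
    then have A: "A i \<inter> {a<..<b} \<in> sets ?M" for i by (auto intro!: meas)
    have "(\<integral>x\<in>(\<Union>i. A i \<inter> {a<..<b}). m x \<partial>?M) = (\<Sum>i. (\<integral>x\<in>A i \<inter> {a<..<b}. m x \<partial>?M))"
    proof (rule lebesgue_integral_countable_add)
      show "set_integrable ?M (\<Union>i. A i \<inter> {a<..<b}) m" using A by (intro si sets.countable_UN) auto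
    qed (use A union(1) in \<open>auto simp: disjoint_family_on_def\<close>)
    also have "\<dots> = 0" using union(3) by (simp add: cong[symmetric])
    also have "(\<Union>i. A i \<inter> {a<..<b}) = (\<Union>i. A i) \<inter> {a<..<b}" by auto
    finally show ?case by (simp only: cong[symmetric])
  qed
  show ?thesis
  proof (rule density_zero[OF m])
    fix A assume "A \<in> sets ?M"
    then have "A \<in> sets lebesgue" "A \<subseteq> {a<..<b}"
      by (auto simp: sets_restrict_space_iff)
    then obtain S N N' where SN: "A = S \<union> N" "N \<subseteq> N'" "N' \<in> null_sets lborel" "S \<in> sets lborel"
      by (auto elim: sets_completionE)
    have "AE x in ?M. x \<notin> N'"
      using SN(3) by (rule AE_notin)
    moreover note meas_m
    moreover have "S \<inter> {a<..<b} \<in> sets ?M" using SN by (auto intro!: meas)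
    moreover have "indicat_real A \<in> borel_measurable ?M" using \<open>A \<in> sets ?M\<close> by simp
    ultimately have "(\<integral>x\<in>A. m x \<partial>?M) = (\<integral>x\<in>S \<inter> {a<..<b}. m x \<partial>?M)"
      unfolding set_lebesgue_integral_def
      by (intro integral_cong_AE borel_measurable_scaleR borel_measurable_indicator)
         (use SN \<open>A \<in> sets ?M\<close> in \<open>auto simp: indicator_def\<close>)
    then show "(\<integral>x\<in>A. m x \<partial>?M) = 0" using bor[of S] SN by (simp add: cong[symmetric])
  qed
qed

text \<open>These are test functions on \<open>{a<..<b}\<close>, but with membership in \<open>flat_alg\<close> in place of mere smoothness,
  so that smoothness of their antiderivatives is immediate.\<close>

definition tests :: "real \<Rightarrow> real \<Rightarrow> (real \<Rightarrow> real) set" where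
  "tests a b = {\<theta> \<in> flat_alg. \<exists>c d. a < c \<and> d < b \<and> (\<forall>x. x \<notin> {c..d} \<longrightarrow> \<theta> x = 0)}"

lemma bump_tests:
  assumes "k > 0" "a \<le> s" "t \<le> b" shows "bump s t k \<in> tests a b"
proof -
  have "s < s + 1 / k" "t - 1 / k < t" using assms by auto
  then have "a < s + 1 / k" "t - 1 / k < b" using assms(2,3) by linarith+
  then show ?thesis unfolding tests_def
    using bump_flat_alg bump_support[OF assms(1)] by blast
qed

lemma tests_test_function:
  assumes "\<theta> \<in> tests a b" shows "test_function {a<..<b} \<theta>"
proof -
  obtain c d where *: "a < c" "d < b" "\<forall>x. x \<notin> {c..d} \<longrightarrow> \<theta> x = 0" and \<theta>: "\<theta> \<in> flat_alg"
    using assms unfolding tests_def by blast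
  have "{c..d} \<subseteq> {a<..<b}" using * by auto
  with * show ?thesis unfolding test_function_def
    using flat_alg_Ck[OF \<theta>] compact_Icc by blast
qed

lemma tests_diff_scale:
  assumes "\<theta> \<in> tests a b" "\<eta> \<in> tests a b" shows "(\<lambda>x. \<theta> x - c * \<eta> x) \<in> tests a b"
proof -
  obtain c1 d1 c2 d2 where *: "a < c1" "d1 < b" "a < c2" "d2 < b"
     "\<forall>x. x \<notin> {c1..d1} \<longrightarrow> \<theta> x = 0" "\<forall>x. x \<notin> {c2..d2} \<longrightarrow> \<eta> x = 0"
    using assms unfolding tests_def by blast
  have "(\<lambda>x. \<theta> x + (- c) * \<eta> x) \<in> flat_alg"
    by (rule flat_alg.add) (use assms in \<open>auto simp only: tests_def intro!: flat_alg.scale\<close>)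
  then have "(\<lambda>x. \<theta> x - c * \<eta> x) \<in> flat_alg" by simp
  moreover have "\<theta> x = 0 \<and> \<eta> x = 0" if "x \<notin> {min c1 c2..max d1 d2}" for x
  proof -
    have "x \<notin> {c1..d1}" "x \<notin> {c2..d2}" using that by (simp_all, linarith+)
    then show ?thesis using *(5,6) by blast
  qed
  then have "a < min c1 c2" "max d1 d2 < b"
    "\<forall>x. x \<notin> {min c1 c2..max d1 d2} \<longrightarrow> \<theta> x - c * \<eta> x = 0" using * by auto
  ultimately show ?thesis unfolding tests_def by blast
qed

lemma integrable_mult_bounded:
  fixes m :: "'a \<Rightarrow> real"
  assumes "integrable M m" "\<theta> \<in> borel_measurable M" "AE x in M. \<bar>\<theta> x\<bar> \<le> B"
  shows "integrable M (\<lambda>x. m x * \<theta> x)" "integrable M (\<lambda>x. \<theta> x * m x)"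
proof -
  show "integrable M (\<lambda>x. m x * \<theta> x)"
  proof (rule Bochner_Integration.integrable_bound)
    show "integrable M (\<lambda>x. B * m x)" using assms(1) by simp
    show "(\<lambda>x. m x * \<theta> x) \<in> borel_measurable M" using assms by simp
    show "AE x in M. norm (m x * \<theta> x) \<le> norm (B * m x)"
      using assms(3) by eventually_elim
        (metis abs_ge_zero abs_mult abs_of_nonneg mult.commute mult_right_mono order_trans real_norm_def)
  qed
  then show "integrable M (\<lambda>x. \<theta> x * m x)" by (simp add: mult.commute)
qed

lemma AE_eq_0_if_tests:
  fixes m :: "real \<Rightarrow> real"
  assumes m: "integrable (lebesgue_on {a<..<b}) m"
    and ab: "a < b"
    and 0: "\<And>\<theta>. \<theta> \<in> tests a b \<Longrightarrow> (\<integral>x. m x * \<theta> x \<partial>lebesgue_on {a<..<b}) = 0"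
  shows "AE x in lebesgue_on {a<..<b}. m x = 0"
proof (rule AE_eq_0_if_intervals[OF m ab])
  let ?M = "lebesgue_on {a<..<b}"
  fix s t assume st: "a \<le> s" "s < t" "t \<le> b"
  have "(\<lambda>k. (\<integral>x. m x * bump s t k x \<partial>?M)) \<longlonglongrightarrow> (\<integral>x. m x * indicat_real {s<..<t} x \<partial>?M)"
  proof (rule integral_dominated_convergence[where w = "\<lambda>x. \<bar>m x\<bar>"])
    show "(\<lambda>x. m x * indicat_real {s<..<t} x) \<in> borel_measurable ?M"
      using m
      by (intro borel_measurable_times borel_measurable_indicator)
         (use st in \<open>auto simp: sets_restrict_space_iff\<close>)
    show "(\<lambda>x. m x * bump s t k x) \<in> borel_measurable ?M" for k
      using m borel_measurable_lebesgue_on_bump by (auto intro!: borel_measurable_times)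
    show "integrable ?M (\<lambda>x. \<bar>m x\<bar>)" using m by simp
    show "AE x in ?M. (\<lambda>k. m x * bump s t k x) \<longlonglongrightarrow> m x * indicat_real {s<..<t} x"
      by (intro AE_I2 tendsto_intros bump_tendsto)
    show "AE x in ?M. norm (m x * bump s t k x) \<le> \<bar>m x\<bar>" for k
      using bump_bounds[of s t k] by (auto simp: abs_mult mult_left_le)
  qed
  moreover have "eventually (\<lambda>k. (\<integral>x. m x * bump s t k x \<partial>?M) = 0) sequentially"
    by (intro eventually_mono[OF eventually_gt_at_top[of 0]] 0 bump_tests) (use st in auto)
  then have "(\<lambda>k. (\<integral>x. m x * bump s t k x \<partial>?M)) \<longlonglongrightarrow> 0" by (rule tendsto_eventually)
  ultimately have "(\<integral>x. m x * indicat_real {s<..<t} x \<partial>?M) = 0" by (rule LIMSEQ_unique)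
  then show "(\<integral>x\<in>{s<..<t}. m x \<partial>?M) = 0"
    by (simp add: set_lebesgue_integral_def mult.commute)
qed

section \<open>Integration by parts for primitives of integrable functions\<close>

text \<open>Primitives are written as gauge integrals, for which the library has continuity and the fundamental
  theorem; this lemma moves them to the Lebesgue integral over the open interval, to which Fubini's
  theorem applies.\<close>

lemma integral_eq_lebesgue_on:
  fixes v :: "real \<Rightarrow> real"
  assumes v: "integrable (lebesgue_on {a<..<b}) v" and x: "x \<in> {a..b}"
  shows "v integrable_on {a..x}"
    "integral {a..x} v = (\<integral>y. indicat_real {..<x} y * v y \<partial>lebesgue_on {a<..<b})"
proof -
  have "set_integrable lebesgue {a<..<b} v"
    using v by (simp add: integrable_restrict_space set_integrable_def)
  then have ai: "v absolutely_integrable_on {a<..<x}"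
    by (rule set_integrable_subset) (use x in auto)
  then have "v integrable_on {a<..<x}" by (rule set_lebesgue_integral_eq_integral)
  then show "v integrable_on {a..x}"
    by (simp add: integrable_on_open_interval_real)
  have "integral {a..x} v = integral {a<..<x} v" by (simp add: integral_open_interval_real)
  also have "\<dots> = (LINT y:{a<..<x}|lebesgue. v y)"
    using set_lebesgue_integral_eq_integral(2)[OF ai] by simp
  also have "\<dots> = (\<integral>y. indicat_real {..<x} y * v y \<partial>lebesgue_on {a<..<b})"
    unfolding set_lebesgue_integral_def using x
    by (subst integral_restrict_space)
       (auto intro!: Bochner_Integration.integral_cong simp: indicator_def)
  finally show "integral {a..x} v = (\<integral>y. indicat_real {..<x} y * v y \<partial>lebesgue_on {a<..<b})" .
qed

lemma integral_eq_lebesgue_on_total: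
  fixes v :: "real \<Rightarrow> real"
  assumes "integrable (lebesgue_on {a<..<b}) v" "a < b"
  shows "integral {a..b} v = (\<integral>y. v y \<partial>lebesgue_on {a<..<b})"
  using integral_eq_lebesgue_on(2)[OF assms(1), of b] assms(2)
  by (auto intro!: Bochner_Integration.integral_cong simp: space_restrict_space)

lemma continuous_on_primitive:
  fixes v :: "real \<Rightarrow> real"
  assumes "integrable (lebesgue_on {a<..<b}) v" "a < b"
  shows "continuous_on {a..b} (\<lambda>x. integral {a..x} v)"
  using integral_eq_lebesgue_on(1)[OF assms(1), of b] assms(2)
  by (intro indefinite_integral_continuous_1) auto

lemma continuous_on_imp_lebesgue_on:
  fixes w :: "real \<Rightarrow> real"
  assumes "continuous_on {a..b} w"
  shows "w \<in> borel_measurable (lebesgue_on {a<..<b})"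
    "\<exists>B. \<forall>x\<in>{a..b}. \<bar>w x\<bar> \<le> B"
    "integrable (lebesgue_on {a<..<b}) w"
proof -
  have "continuous_on {a<..<b} w" by (rule continuous_on_subset[OF assms]) auto
  then show m: "w \<in> borel_measurable (lebesgue_on {a<..<b})"
    by (intro continuous_imp_measurable_on_sets_lebesgue) auto
  have "compact (w ` {a..b})" by (rule compact_continuous_image[OF assms]) simp
  then obtain B where B: "\<forall>x\<in>{a..b}. \<bar>w x\<bar> \<le> B"
    by (auto dest!: compact_imp_bounded simp: bounded_iff)
  then show "\<exists>B. \<forall>x\<in>{a..b}. \<bar>w x\<bar> \<le> B" by blast
  interpret finite_measure "lebesgue_on {a<..<b}" by (rule lebesgue_on_interval_finite)
  show "integrable (lebesgue_on {a<..<b}) w"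
    by (rule integrable_const_bound[of _ B]) (use m B in \<open>auto intro!: AE_I2 simp: space_restrict_space\<close>)
qed

text \<open>The two integrals are the integrals of \<open>f y * g x\<close> over the triangles \<open>y < x\<close> and \<open>x \<le> y\<close>, which together
  make up the square.\<close>

lemma integration_by_parts_primitives:
  fixes f g :: "real \<Rightarrow> real"
  assumes f: "integrable (lebesgue_on {a<..<b}) f" and g: "integrable (lebesgue_on {a<..<b}) g"
    and ab: "a < b"
  shows "(\<integral>x. integral {a..x} f * g x \<partial>lebesgue_on {a<..<b})
       + (\<integral>x. f x * integral {a..x} g \<partial>lebesgue_on {a<..<b})
       = (\<integral>x. f x \<partial>lebesgue_on {a<..<b}) * (\<integral>x. g x \<partial>lebesgue_on {a<..<b})"
proof -
  let ?M = "lebesgue_on {a<..<b}"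
  interpret finite_measure ?M by (rule lebesgue_on_interval_finite)
  interpret P: pair_sigma_finite ?M ?M ..
  have [measurable]: "f \<in> borel_measurable ?M" "g \<in> borel_measurable ?M" using f g by auto
  have id[measurable]: "(\<lambda>x. x) \<in> borel_measurable ?M"
    by (intro continuous_imp_measurable_on_sets_lebesgue continuous_intros) auto
  have 1: "integrable (?M \<Otimes>\<^sub>M ?M) (\<lambda>(x, y). g x * f y)"
  proof (rule P.Fubini_integrable)
    show "(\<lambda>(x, y). g x * f y) \<in> borel_measurable (?M \<Otimes>\<^sub>M ?M)" by measurable
    show "integrable ?M (\<lambda>x. LINT y|?M. norm (case (x, y) of (x, y) \<Rightarrow> g x * f y))"
      using g by (simp add: abs_mult)
    show "AE x in ?M. integrable ?M (\<lambda>y. case (x, y) of (x, y) \<Rightarrow> g x * f y)"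
      using f by simp
  qed
  have 2: "integrable (?M \<Otimes>\<^sub>M ?M) (\<lambda>(x, y). indicat_real {..<x} y * (g x * f y))"
  proof (rule Bochner_Integration.integrable_bound[OF 1])
    have "(\<lambda>p. indicat_real {p. snd p < fst p} p * (g (fst p) * f (snd p)))
        \<in> borel_measurable (?M \<Otimes>\<^sub>M ?M)"
    proof (intro borel_measurable_times)
      have "{p \<in> space (?M \<Otimes>\<^sub>M ?M). snd p < fst p} \<in> sets (?M \<Otimes>\<^sub>M ?M)"
        by measurable
      moreover have "{p \<in> space (?M \<Otimes>\<^sub>M ?M). snd p < fst p}
          = {p. snd p < fst p} \<inter> space (?M \<Otimes>\<^sub>M ?M)" by blast
      ultimately show "indicat_real {p. snd p < fst p} \<in> borel_measurable (?M \<Otimes>\<^sub>M ?M)"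
        unfolding borel_measurable_indicator_iff by simp
    qed measurable
    then show "(\<lambda>(x, y). indicat_real {..<x} y * (g x * f y)) \<in> borel_measurable (?M \<Otimes>\<^sub>M ?M)"
      by (simp add: case_prod_beta indicator_def)
  qed (auto simp: indicator_def)
  have F: "(\<integral>x. integral {a..x} f * g x \<partial>?M) = (\<integral>x. (\<integral>y. indicat_real {..<x} y * (g x * f y) \<partial>?M) \<partial>?M)"
  proof (rule Bochner_Integration.integral_cong[OF refl])
    fix x assume "x \<in> space ?M"
    then have "integral {a..x} f = (\<integral>y. indicat_real {..<x} y * f y \<partial>?M)"
      by (intro integral_eq_lebesgue_on f) (auto simp: space_restrict_space)
    then have "integral {a..x} f * g x = (\<integral>y. g x * (indicat_real {..<x} y * f y) \<partial>?M)"
      by simp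
    then show "integral {a..x} f * g x = (\<integral>y. indicat_real {..<x} y * (g x * f y) \<partial>?M)"
      by (simp only: mult.left_commute)
  qed
  have G: "f y * integral {a..y} g = f y * (\<integral>x. g x \<partial>?M) - (\<integral>x. indicat_real {..<x} y * (g x * f y) \<partial>?M)"
    if "y \<in> space ?M" for y
  proof -
    have y: "integral {a..y} g = (\<integral>x. indicat_real {..<y} x * g x \<partial>?M)"
      using that by (intro integral_eq_lebesgue_on g) (auto simp: space_restrict_space)
    have ind: "(\<lambda>x. indicat_real {..<x} y) \<in> borel_measurable ?M"
      "indicat_real {..<y} \<in> borel_measurable ?M"
      by (auto simp: indicator_def)
    have int: "integrable ?M (\<lambda>x. indicat_real {..<x} y * g x)"
      by (rule integrable_mult_bounded(2)[OF g ind(1), of 1]) auto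
    \<comment> \<open>this lets \<open>x < y\<close> be traded for \<open>x \<le> y\<close>\<close>
    have "AE x in lebesgue. x \<noteq> y"
      using AE_not_in[OF null_sets_completionI[OF finite_imp_null_set_lborel[of "{y}"]]] by simp
    then have "AE x in ?M. x \<noteq> y" by (subst AE_restrict_space_iff) auto
    then have "(\<integral>x. indicat_real {..<y} x * g x \<partial>?M) = (\<integral>x. g x - indicat_real {..<x} y * g x \<partial>?M)"
      using ind by (intro integral_cong_AE) (auto simp: indicator_def)
    also have "\<dots> = (\<integral>x. g x \<partial>?M) - (\<integral>x. indicat_real {..<x} y * g x \<partial>?M)"
      by (rule Bochner_Integration.integral_diff[OF g int])
    finally have "f y * integral {a..y} g = f y * (\<integral>x. g x \<partial>?M) - f y * (\<integral>x. indicat_real {..<x} y * g x \<partial>?M)"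
      using y by (simp add: right_diff_distrib)
    also have "f y * (\<integral>x. indicat_real {..<x} y * g x \<partial>?M) = (\<integral>x. f y * (indicat_real {..<x} y * g x) \<partial>?M)"
      by (rule integral_mult_right_zero[symmetric])
    also have "(\<lambda>x. f y * (indicat_real {..<x} y * g x)) = (\<lambda>x. indicat_real {..<x} y * (g x * f y))"
      by (simp add: fun_eq_iff)
    finally show ?thesis .
  qed
  have "(\<integral>y. f y * integral {a..y} g \<partial>?M)
      = (\<integral>y. f y * (\<integral>x. g x \<partial>?M) - (\<integral>x. indicat_real {..<x} y * (g x * f y) \<partial>?M) \<partial>?M)"
    by (rule Bochner_Integration.integral_cong[OF refl G])
  also have "\<dots> = (\<integral>y. f y * (\<integral>x. g x \<partial>?M) \<partial>?M)
      - (\<integral>y. (\<integral>x. indicat_real {..<x} y * (g x * f y) \<partial>?M) \<partial>?M)"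
    by (rule Bochner_Integration.integral_diff) (use f P.integrable_snd[OF 2] in auto)
  also have "(\<integral>y. (\<integral>x. indicat_real {..<x} y * (g x * f y) \<partial>?M) \<partial>?M)
      = (\<integral>x. (\<integral>y. indicat_real {..<x} y * (g x * f y) \<partial>?M) \<partial>?M)"
    by (rule P.Fubini_integral[OF 2])
  finally show ?thesis using F by simp
qed

text \<open>The mean value of \<open>\<eta>\<close> has to vanish for its antiderivative to return to \<open>0\<close> beyond the support.\<close>

lemma tests_antiderivative:
  assumes \<eta>: "\<eta> \<in> tests a b" and 0: "(\<integral>x. \<eta> x \<partial>lebesgue_on {a<..<b}) = 0" and ab: "a < b"
  obtains \<phi> where "test_function {a<..<b} \<phi>" "deriv \<phi> = \<eta>"
proof -
  obtain c d where cd: "a < c" "d < b" "\<And>x. x \<notin> {c..d} \<Longrightarrow> \<eta> x = 0" and alg: "\<eta> \<in> flat_alg"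
    using \<eta> unfolding tests_def by blast
  define \<phi> where "\<phi> x = integral {a..x} \<eta>" for x
  have cont: "continuous_on S \<eta>" for S
    by (intro continuous_at_imp_continuous_on ballI flat_alg_isCont alg)
  have "(\<eta> has_integral 0) {a..b}"
    using 0 integral_eq_lebesgue_on_total[OF continuous_on_imp_lebesgue_on(3)[OF cont] ab]
      integrable_integral[OF integrable_continuous_real[OF cont[of "{a..b}"]]] by simp
  then have "((\<lambda>x. if x \<in> {c..d} then \<eta> x else 0) has_integral 0) {a..b}"
    by (rule has_integral_eq[rotated]) (use cd(3) in auto)
  then have hi: "(\<eta> has_integral 0) ({a..b} \<inter> {c..d})"
    unfolding has_integral_restrict_Int by (subst (asm) Int_commute)
  have out: "\<phi> x = 0" if "x \<notin> {c..d}" for x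
  proof (cases "x < c")
    case True
    then have "integral {a..x} \<eta> = integral {a..x} (\<lambda>_. 0)"
      by (intro Henstock_Kurzweil_Integration.integral_cong cd(3)) auto
    then show ?thesis by (simp add: \<phi>_def)
  next
    case False
    with that have "d < x" by auto
    then have "(\<eta> has_integral 0) {a..x}"
      by (intro has_integral_on_superset[OF hi]) (use cd in auto)
    then show ?thesis unfolding \<phi>_def by (rule integral_unique)
  qed
  have der: "(\<phi> has_real_derivative \<eta> x) (at x)" for x
  proof (cases "x \<in> {c..d}")
    case True
    then have x: "x \<in> {a<..<b}" using cd by auto
    then have "(\<phi> has_real_derivative \<eta> x) (at x within {a..b})"
      unfolding \<phi>_def[abs_def] by (intro integral_has_real_derivative[OF cont]) simp
    then have "(\<phi> has_real_derivative \<eta> x) (at x within {a<..<b})"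
      by (rule DERIV_subset) auto
    then show ?thesis using at_within_open[OF x] by simp
  next
    case False
    have "eventually (\<lambda>y. y \<in> - {c..d}) (nhds x)"
      using False by (intro eventually_nhds_in_open) auto
    then have "eventually (\<lambda>y. \<phi> y = 0) (nhds x)" by (rule eventually_mono) (simp add: out)
    moreover have "((\<lambda>_. 0) has_real_derivative \<eta> x) (at x)" using cd(3)[OF False] by simp
    ultimately show ?thesis by (subst DERIV_cong_ev[OF refl _ refl])
  qed
  have "test_function {a<..<b} \<phi>"
    unfolding test_function_def
  proof (intro conjI exI[of _ "{c..d}"] allI)
    show "Ck k \<phi>" for k by (rule Ck_if_deriv_flat_alg[OF der alg])
    show "{c..d} \<subseteq> {a<..<b}" using cd(1,2) by auto
    show "x \<notin> {c..d} \<longrightarrow> \<phi> x = 0" for x using out by blast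
  qed simp
  moreover have "deriv \<phi> = \<eta>" using DERIV_imp_deriv[OF der] by (rule ext)
  ultimately show ?thesis by (rule that)
qed

text \<open>Subtracting from a test function a multiple of a fixed one with positive integral gives mean value
  zero, that is, the derivative of a test function. So \<open>m - C\<close> annihilates all test functions for a
  suitable constant \<open>C\<close>.\<close>

lemma du_Bois_Reymond:
  assumes m: "integrable (lebesgue_on {a<..<b}) m" and ab: "a < b"
    and 0: "\<And>\<phi>. test_function {a<..<b} \<phi> \<Longrightarrow> (\<integral>x. m x * deriv \<phi> x \<partial>lebesgue_on {a<..<b}) = 0"
  shows "\<exists>C. AE x in lebesgue_on {a<..<b}. m x = C"
proof -
  let ?M = "lebesgue_on {a<..<b}"
  interpret finite_measure ?M by (rule lebesgue_on_interval_finite)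
  have cont: "continuous_on {a..b} \<theta>" if "\<theta> \<in> tests a b" for \<theta>
    using that unfolding tests_def
    by (intro continuous_at_imp_continuous_on ballI flat_alg_isCont) auto
  note int = continuous_on_imp_lebesgue_on(3)[OF cont]
  have mint: "integrable ?M (\<lambda>x. m x * \<theta> x)" if \<theta>: "\<theta> \<in> tests a b" for \<theta>
  proof -
    obtain B where B: "\<forall>x\<in>{a..b}. \<bar>\<theta> x\<bar> \<le> B" using continuous_on_imp_lebesgue_on(2)[OF cont[OF \<theta>]] by blast
    show ?thesis
      by (rule integrable_mult_bounded(1)[OF m continuous_on_imp_lebesgue_on(1)[OF cont[OF \<theta>]], of B])
         (use B in \<open>auto intro!: AE_I2 simp: space_restrict_space\<close>)
  qed
  have "(\<lambda>k. (\<integral>x. bump a b k x \<partial>?M)) \<longlonglongrightarrow> (\<integral>x. indicat_real {a<..<b} x \<partial>?M)"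
  proof (rule integral_dominated_convergence[where w = "\<lambda>x. 1"])
    show "AE x in ?M. (\<lambda>k. bump a b k x) \<longlonglongrightarrow> indicat_real {a<..<b} x"
      by (intro AE_I2 bump_tendsto)
    show "AE x in ?M. norm (bump a b k x) \<le> 1" for k using bump_bounds[of a b k] by auto
    show "indicat_real {a<..<b} \<in> borel_measurable ?M"
      by (rule borel_measurable_indicator) (simp add: sets_restrict_space_iff)
  qed (auto simp: borel_measurable_lebesgue_on_bump)
  moreover have "(\<integral>x. indicat_real {a<..<b} x \<partial>?M) = b - a"
  proof -
    have "(\<integral>x. indicat_real {a<..<b} x \<partial>?M) = (\<integral>x. 1 \<partial>?M)"
      by (rule Bochner_Integration.integral_cong) (auto simp: space_restrict_space)
    also have "\<dots> = b - a" using ab by (simp add: measure_restrict_space space_restrict_space)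
    finally show ?thesis .
  qed
  ultimately have "(\<lambda>k. (\<integral>x. bump a b k x \<partial>?M)) \<longlonglongrightarrow> b - a" by simp
  then have "eventually (\<lambda>k. (\<integral>x. bump a b k x \<partial>?M) > 0) sequentially"
    by (rule order_tendstoD(1)) (use ab in simp)
  with eventually_gt_at_top[of 0] have "eventually (\<lambda>k. k > 0 \<and> (\<integral>x. bump a b k x \<partial>?M) > 0) sequentially"
    by eventually_elim auto
  then obtain k where k: "k > 0" "(\<integral>x. bump a b k x \<partial>?M) > 0"
    using eventually_happens trivial_limit_sequentially by blast
  define \<theta>\<^sub>0 where "\<theta>\<^sub>0 = bump a b k"
  define I where "I = (\<integral>x. \<theta>\<^sub>0 x \<partial>?M)"
  define C where "C = (\<integral>x. m x * \<theta>\<^sub>0 x \<partial>?M) / I"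
  have I: "I > 0" and \<theta>\<^sub>0: "\<theta>\<^sub>0 \<in> tests a b"
    using k bump_tests[of k a a b b] by (auto simp: \<theta>\<^sub>0_def I_def)
  have "AE x in ?M. m x - C = 0"
  proof (rule AE_eq_0_if_tests[OF _ ab])
    show "integrable ?M (\<lambda>x. m x - C)" using m by simp
    fix \<theta> assume \<theta>: "\<theta> \<in> tests a b"
    define c where "c = (\<integral>x. \<theta> x \<partial>?M) / I"
    let ?\<eta> = "\<lambda>x. \<theta> x - c * \<theta>\<^sub>0 x"
    have \<eta>: "?\<eta> \<in> tests a b" by (rule tests_diff_scale[OF \<theta> \<theta>\<^sub>0])
    have "(\<integral>x. ?\<eta> x \<partial>?M) = (\<integral>x. \<theta> x \<partial>?M) - c * I"
      unfolding I_def by (subst Bochner_Integration.integral_diff) (use int \<theta> \<theta>\<^sub>0 in auto)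
    also have "\<dots> = 0" using I by (simp add: c_def)
    finally obtain \<phi> where "test_function {a<..<b} \<phi>" "deriv \<phi> = ?\<eta>"
      using tests_antiderivative[OF \<eta> _ ab] by blast
    with 0[of \<phi>] have "0 = (\<integral>x. m x * ?\<eta> x \<partial>?M)" by simp
    also have "\<dots> = (\<integral>x. m x * \<theta> x - c * (m x * \<theta>\<^sub>0 x) \<partial>?M)" by (simp add: algebra_simps)
    also have "\<dots> = (\<integral>x. m x * \<theta> x \<partial>?M) - c * (\<integral>x. m x * \<theta>\<^sub>0 x \<partial>?M)"
      by (subst Bochner_Integration.integral_diff) (use mint \<theta> \<theta>\<^sub>0 in auto)
    also have "\<dots> = (\<integral>x. m x * \<theta> x \<partial>?M) - C * (\<integral>x. \<theta> x \<partial>?M)" by (simp add: c_def C_def)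
    also have "\<dots> = (\<integral>x. m x * \<theta> x - C * \<theta> x \<partial>?M)"
      by (subst Bochner_Integration.integral_diff) (use mint int \<theta> in auto)
    finally show "(\<integral>x. (m x - C) * \<theta> x \<partial>?M) = 0" by (simp add: algebra_simps)
  qed
  then show ?thesis by (intro exI[of _ C]) auto
qed

section \<open>Square-integrable functions\<close>

lemma L2D:
  assumes "z \<in> L2 S" shows "z \<in> borel_measurable (lebesgue_on S)" "integrable (lebesgue_on S) (\<lambda>x. (z x)\<^sup>2)"
  using assms by (auto simp: L2_def)

lemma L2_mult_integrable:
  assumes "y \<in> L2 S" "z \<in> L2 S" shows "integrable (lebesgue_on S) (\<lambda>x. y x * z x)"
proof (rule Bochner_Integration.integrable_bound)
  show "integrable (lebesgue_on S) (\<lambda>x. (y x)\<^sup>2 + (z x)\<^sup>2)" using L2D[OF assms(1)] L2D[OF assms(2)] by auto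
  show "(\<lambda>x. y x * z x) \<in> borel_measurable (lebesgue_on S)" using L2D[OF assms(1)] L2D[OF assms(2)] by auto
  have "\<bar>p * q\<bar> \<le> \<bar>p\<^sup>2 + q\<^sup>2\<bar>" for p q :: real
  proof -
    have "2 * (\<bar>p\<bar> * \<bar>q\<bar>) \<le> p\<^sup>2 + q\<^sup>2"
      using sum_squares_bound[of "\<bar>p\<bar>" "\<bar>q\<bar>"] by simp
    moreover have "0 \<le> \<bar>p\<bar> * \<bar>q\<bar>" by simp
    ultimately have "\<bar>p\<bar> * \<bar>q\<bar> \<le> p\<^sup>2 + q\<^sup>2" by linarith
    then show ?thesis by (simp add: abs_mult)
  qed
  then show "AE x in lebesgue_on S. norm (y x * z x) \<le> norm ((y x)\<^sup>2 + (z x)\<^sup>2)" by simp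
qed

lemma L2_add:
  assumes "y \<in> L2 S" "z \<in> L2 S" shows "(\<lambda>x. y x + z x) \<in> L2 S"
proof -
  have "integrable (lebesgue_on S) (\<lambda>x. (y x)\<^sup>2 + 2 * (y x * z x) + (z x)\<^sup>2)"
    by (intro Bochner_Integration.integrable_add integrable_mult_right
        L2D[OF assms(1)] L2D[OF assms(2)] L2_mult_integrable[OF assms])
  moreover have "(\<lambda>x. (y x)\<^sup>2 + 2 * (y x * z x) + (z x)\<^sup>2) = (\<lambda>x. (y x + z x)\<^sup>2)"
    by (simp add: power2_sum fun_eq_iff)
  ultimately show ?thesis using L2D(1)[OF assms(1)] L2D(1)[OF assms(2)] by (simp add: L2_def)
qed

lemma L2_cmult: "z \<in> L2 S \<Longrightarrow> (\<lambda>x. c * z x) \<in> L2 S"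
  by (auto simp: L2_def power_mult_distrib)

lemma L2_diff: "y \<in> L2 S \<Longrightarrow> z \<in> L2 S \<Longrightarrow> (\<lambda>x. y x - z x) \<in> L2 S"
  using L2_add[of y S "\<lambda>x. (-1) * z x"] L2_cmult[of z S "-1"] by simp

lemma L2_bounded_mult:
  assumes "z \<in> L2 S" "c \<in> borel_measurable (lebesgue_on S)" "AE x in lebesgue_on S. \<bar>c x\<bar> \<le> B"
  shows "(\<lambda>x. c x * z x) \<in> L2 S"
proof -
  have "integrable (lebesgue_on S) (\<lambda>x. (c x)\<^sup>2 * (z x)\<^sup>2)"
  proof (rule integrable_mult_bounded(2)[of _ _ _ "B\<^sup>2"])
    show "AE x in lebesgue_on S. \<bar>(c x)\<^sup>2\<bar> \<le> B\<^sup>2"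
      using assms(3) by eventually_elim (use power_mono[of "\<bar>_\<bar>" B 2] in auto)
  qed (use assms in \<open>auto dest: L2D\<close>)
  then show ?thesis using assms by (auto simp: L2_def power_mult_distrib)
qed

lemma L2_bounded:
  assumes "c \<in> borel_measurable (lebesgue_on {a<..<b})" "AE x in lebesgue_on {a<..<b}. \<bar>c x\<bar> \<le> B"
  shows "c \<in> L2 {a<..<b}"
proof -
  interpret finite_measure "lebesgue_on {a<..<b}" by (rule lebesgue_on_interval_finite)
  have "(\<lambda>_. 1) \<in> L2 {a<..<b}" by (simp add: L2_def)
  from L2_bounded_mult[OF this assms] show ?thesis by simp
qed

lemma L2_continuous: "continuous_on {a..b} w \<Longrightarrow> w \<in> L2 {a<..<b}"
  using continuous_on_imp_lebesgue_on[of a b w] L2_bounded[of w a b]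
  by (metis (no_types, lifting) AE_I2 atLeastAtMost_iff greaterThanLessThan_iff less_imp_le space_lebesgue_on)

lemma L2_integrable: "z \<in> L2 {a<..<b} \<Longrightarrow> integrable (lebesgue_on {a<..<b}) z"
  using L2_mult_integrable[of z "{a<..<b}" "\<lambda>_. 1"] L2_continuous[of a b "\<lambda>_. 1"] by simp

lemma L2_inner_cong_AE:
  assumes "AE x in lebesgue_on S. y x = y' x" "AE x in lebesgue_on S. z x = z' x"
    "y \<in> borel_measurable (lebesgue_on S)" "y' \<in> borel_measurable (lebesgue_on S)"
    "z \<in> borel_measurable (lebesgue_on S)" "z' \<in> borel_measurable (lebesgue_on S)"
  shows "L2_inner S y z = L2_inner S y' z'"
  unfolding L2_inner_def using assms by (intro integral_cong_AE) auto

section \<open>Sobolev functions on an interval\<close>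

lemma test_functionD:
  assumes "test_function {a<..<b} \<phi>" and ab: "a < b"
  shows "(\<phi> has_real_derivative deriv \<phi> x) (at x)" "continuous_on S (deriv \<phi>)" "continuous_on S \<phi>"
    "\<phi> a = 0" "\<phi> b = 0" "x \<in> {a..b} \<Longrightarrow> integral {a..x} (deriv \<phi>) = \<phi> x"
    "(\<integral>x. deriv \<phi> x \<partial>lebesgue_on {a<..<b}) = 0"
proof -
  have Ck: "Ck 1 \<phi>" using assms by (auto simp: test_function_def)
  then show d: "(\<phi> has_real_derivative deriv \<phi> x) (at x)" for x
    unfolding Ck_def using field_differentiable_derivI by auto
  have "continuous_on UNIV (deriv \<phi>)" using Ck unfolding Ck_def by simp
  then show cd: "continuous_on S (deriv \<phi>)" for S by (rule continuous_on_subset) simp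
  show "continuous_on S \<phi>"
    using d DERIV_isCont by (intro continuous_at_imp_continuous_on) blast
  show a0: "\<phi> a = 0" and b0: "\<phi> b = 0" using assms(1) unfolding test_function_def
    by (metis greaterThanLessThan_iff less_irrefl subsetD)+
  show *: "integral {a..x} (deriv \<phi>) = \<phi> x" if "x \<in> {a..b}" for x
  proof (rule integral_unique)
    have "(deriv \<phi> has_integral \<phi> x - \<phi> a) {a..x}"
      using that d by (intro fundamental_theorem_of_calculus)
        (auto simp: has_real_derivative_iff_has_vector_derivative[symmetric] intro: DERIV_subset)
    then show "(deriv \<phi> has_integral \<phi> x) {a..x}" by (simp add: a0)
  qed
  show "(\<integral>x. deriv \<phi> x \<partial>lebesgue_on {a<..<b}) = 0"
    using *[of b] ab b0 integral_eq_lebesgue_on_total[OF continuous_on_imp_lebesgue_on(3)[OF cd] ab]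
    by simp
qed

text \<open>The difference of \<open>z\<close> and the primitive of \<open>v\<close> has weak derivative zero, so it is constant by the lemma of
  du Bois-Reymond.\<close>

lemma has_weak_derivD:
  assumes z: "z \<in> L2 {a<..<b}" and v: "v \<in> L2 {a<..<b}" and w: "has_weak_deriv {a<..<b} z v"
    and ab: "a < b"
  shows "\<exists>C. AE x in lebesgue_on {a<..<b}. z x = C + integral {a..x} v"
proof -
  let ?M = "lebesgue_on {a<..<b}"
  let ?V = "\<lambda>x. integral {a..x} v"
  note zi = L2_integrable[OF z] and vi = L2_integrable[OF v]
  note V = continuous_on_imp_lebesgue_on[OF continuous_on_primitive[OF vi ab]]
  have "\<exists>C. AE x in ?M. z x - ?V x = C"
  proof (rule du_Bois_Reymond[OF _ ab])
    show "integrable ?M (\<lambda>x. z x - ?V x)" using zi V(3) by simp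
    fix \<phi> assume t: "test_function {a<..<b} \<phi>"
    note \<phi> = test_functionD[OF t ab]
    have L2: "deriv \<phi> \<in> L2 {a<..<b}" "?V \<in> L2 {a<..<b}"
      by (auto intro!: L2_continuous \<phi> continuous_on_primitive[OF vi ab])
    have "(\<integral>x. ?V x * deriv \<phi> x \<partial>?M) + (\<integral>x. v x * integral {a..x} (deriv \<phi>) \<partial>?M) = 0"
      using integration_by_parts_primitives[OF vi L2_integrable[OF L2(1)] ab] \<phi>(7) by simp
    also have "(\<integral>x. v x * integral {a..x} (deriv \<phi>) \<partial>?M) = L2_inner {a<..<b} v \<phi>"
      unfolding L2_inner_def
      by (rule Bochner_Integration.integral_cong) (auto simp: space_restrict_space \<phi>(6))
    finally have "(\<integral>x. ?V x * deriv \<phi> x \<partial>?M) = (\<integral>x. z x * deriv \<phi> x \<partial>?M)"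
      using w t unfolding has_weak_deriv_def by (auto simp: L2_inner_def)
    then show "(\<integral>x. (z x - ?V x) * deriv \<phi> x \<partial>?M) = 0"
      using L2_mult_integrable[OF z L2(1)] L2_mult_integrable[OF L2(2) L2(1)]
      by (simp add: left_diff_distrib)
  qed
  then show ?thesis by (auto simp: diff_eq_eq)
qed

lemma has_weak_deriv_primitive:
  assumes v: "integrable (lebesgue_on {a<..<b}) v" and z: "z \<in> borel_measurable (lebesgue_on {a<..<b})"
    and eq: "AE x in lebesgue_on {a<..<b}. z x = C + integral {a..x} v" and ab: "a < b"
  shows "has_weak_deriv {a<..<b} z v"
  unfolding has_weak_deriv_def
proof (intro allI impI)
  let ?M = "lebesgue_on {a<..<b}"
  let ?V = "\<lambda>x. integral {a..x} v"
  note V = continuous_on_primitive[OF v ab]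
  fix \<phi> assume t: "test_function {a<..<b} \<phi>"
  note \<phi> = test_functionD[OF t ab]
  have L2: "deriv \<phi> \<in> L2 {a<..<b}" "?V \<in> L2 {a<..<b}"
    by (auto intro!: L2_continuous \<phi> V)
  have "L2_inner {a<..<b} z (deriv \<phi>) = (\<integral>x. C * deriv \<phi> x + ?V x * deriv \<phi> x \<partial>?M)"
    unfolding L2_inner_def using z eq L2D(1)[OF L2(1)] L2D(1)[OF L2(2)]
    by (intro integral_cong_AE) (auto simp: algebra_simps)
  also have "\<dots> = C * (\<integral>x. deriv \<phi> x \<partial>?M) + (\<integral>x. ?V x * deriv \<phi> x \<partial>?M)"
    using L2_integrable[OF L2(1)] L2_mult_integrable[OF L2(2) L2(1)] by simp
  also have "\<dots> = - (\<integral>x. v x * integral {a..x} (deriv \<phi>) \<partial>?M)"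
    using integration_by_parts_primitives[OF v L2_integrable[OF L2(1)] ab] \<phi>(7) by simp
  also have "(\<integral>x. v x * integral {a..x} (deriv \<phi>) \<partial>?M) = L2_inner {a<..<b} v \<phi>"
    unfolding L2_inner_def
    by (rule Bochner_Integration.integral_cong) (auto simp: space_restrict_space \<phi>(6))
  finally show "L2_inner {a<..<b} z (deriv \<phi>) = - L2_inner {a<..<b} v \<phi>" .
qed

text \<open>The difference of two weak derivatives annihilates all test functions. So the choice made by \<open>dx\<close>
  matters on null sets only.\<close>

lemma has_weak_deriv_unique:
  assumes v: "v \<in> L2 {a<..<b}" and v': "v' \<in> L2 {a<..<b}"
    and w: "has_weak_deriv {a<..<b} z v" "has_weak_deriv {a<..<b} z v'" and ab: "a < b"
  shows "AE x in lebesgue_on {a<..<b}. v x = v' x"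
proof -
  have "AE x in lebesgue_on {a<..<b}. v x - v' x = 0"
  proof (rule AE_eq_0_if_tests[OF _ ab])
    show "integrable (lebesgue_on {a<..<b}) (\<lambda>x. v x - v' x)"
      by (rule L2_integrable[OF L2_diff[OF v v']])
    fix \<theta> assume "\<theta> \<in> tests a b"
    then have t: "test_function {a<..<b} \<theta>" by (rule tests_test_function)
    have L2: "\<theta> \<in> L2 {a<..<b}" by (rule L2_continuous[OF test_functionD(3)[OF t ab]])
    have "L2_inner {a<..<b} v \<theta> = L2_inner {a<..<b} v' \<theta>"
      using w t unfolding has_weak_deriv_def by (metis neg_equal_iff_equal)
    then show "(\<integral>x. (v x - v' x) * \<theta> x \<partial>lebesgue_on {a<..<b}) = 0"
      using L2_mult_integrable[OF v L2] L2_mult_integrable[OF v' L2]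
      by (simp add: left_diff_distrib L2_inner_def)
  qed
  then show ?thesis by auto
qed

lemma H1_dx:
  assumes "z \<in> H1 S"
  shows "z \<in> L2 S" "dx S z \<in> L2 S" "has_weak_deriv S z (dx S z)"
proof -
  have "\<exists>v. v \<in> L2 S \<and> has_weak_deriv S z v" using assms by (auto simp: H1_def)
  then have "dx S z \<in> L2 S \<and> has_weak_deriv S z (dx S z)" unfolding dx_def by (rule someI_ex)
  then show "dx S z \<in> L2 S" "has_weak_deriv S z (dx S z)" by auto
  show "z \<in> L2 S" using assms by (auto simp: H1_def)
qed

lemma dx_eq_AE:
  assumes "z \<in> L2 {a<..<b}" "v \<in> L2 {a<..<b}" "has_weak_deriv {a<..<b} z v" "a < b"
  shows "z \<in> H1 {a<..<b}" "AE x in lebesgue_on {a<..<b}. dx {a<..<b} z x = v x"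
proof -
  show z: "z \<in> H1 {a<..<b}" using assms by (auto simp: H1_def)
  show "AE x in lebesgue_on {a<..<b}. dx {a<..<b} z x = v x"
    by (rule has_weak_deriv_unique[OF H1_dx(2)[OF z] assms(2) H1_dx(3)[OF z] assms(3,4)])
qed

text \<open>This is the embedding of \<open>H\<^sup>1\<close> into the bounded functions. It is what makes nonlinear terms such as
  \<open>g w\<close> square integrable.\<close>

lemma H1_bounded:
  assumes z: "z \<in> H1 {a<..<b}" and ab: "a < b"
  shows "\<exists>B. AE x in lebesgue_on {a<..<b}. \<bar>z x\<bar> \<le> B"
proof -
  obtain C where C: "AE x in lebesgue_on {a<..<b}. z x = C + integral {a..x} (dx {a<..<b} z)"
    using has_weak_derivD[OF H1_dx[OF z] ab] by blast
  obtain B where B: "\<forall>x\<in>{a..b}. \<bar>integral {a..x} (dx {a<..<b} z)\<bar> \<le> B"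
    using continuous_on_imp_lebesgue_on(2)[OF continuous_on_primitive[OF L2_integrable[OF H1_dx(2)[OF z]] ab]]
    by blast
  have "AE x in lebesgue_on {a<..<b}. x \<in> {a..b}" by (auto intro!: AE_I2 simp: space_restrict_space)
  with C have "AE x in lebesgue_on {a<..<b}. \<bar>z x\<bar> \<le> \<bar>C\<bar> + B"
  proof eventually_elim
    case (elim x) then show ?case using B[rule_format, of x] by linarith
  qed
  then show ?thesis by blast
qed

lemma H1_AE_cong:
  assumes z: "z \<in> H1 {a<..<b}" and y: "y \<in> borel_measurable (lebesgue_on {a<..<b})" and ab: "a < b"
    and eq: "AE x in lebesgue_on {a<..<b}. y x = z x"
  shows "y \<in> H1 {a<..<b}" "AE x in lebesgue_on {a<..<b}. dx {a<..<b} y x = dx {a<..<b} z x"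
proof -
  note dz = H1_dx[OF z]
  obtain C where C: "AE x in lebesgue_on {a<..<b}. z x = C + integral {a..x} (dx {a<..<b} z)"
    using has_weak_derivD[OF dz ab] by blast
  with eq have eq': "AE x in lebesgue_on {a<..<b}. y x = C + integral {a..x} (dx {a<..<b} z)"
    by eventually_elim simp
  have w: "has_weak_deriv {a<..<b} y (dx {a<..<b} z)"
    by (rule has_weak_deriv_primitive[OF L2_integrable[OF dz(2)] y eq' ab])
  obtain B where "AE x in lebesgue_on {a<..<b}. \<bar>z x\<bar> \<le> B" using H1_bounded[OF z ab] by blast
  with eq have "AE x in lebesgue_on {a<..<b}. \<bar>y x\<bar> \<le> B" by eventually_elim simp
  then have "y \<in> L2 {a<..<b}" by (rule L2_bounded[OF y])
  from dx_eq_AE[OF this dz(2) w ab]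
  show "y \<in> H1 {a<..<b}" "AE x in lebesgue_on {a<..<b}. dx {a<..<b} y x = dx {a<..<b} z x" .
qed

lemma H1_diff:
  assumes y: "y \<in> H1 {a<..<b}" and z: "z \<in> H1 {a<..<b}" and ab: "a < b"
  shows "(\<lambda>x. y x - z x) \<in> H1 {a<..<b}"
    "AE x in lebesgue_on {a<..<b}. dx {a<..<b} (\<lambda>x. y x - z x) x = dx {a<..<b} y x - dx {a<..<b} z x"
proof -
  note dy = H1_dx[OF y] and dz = H1_dx[OF z]
  have w: "has_weak_deriv {a<..<b} (\<lambda>x. y x - z x) (\<lambda>x. dx {a<..<b} y x - dx {a<..<b} z x)"
    unfolding has_weak_deriv_def
  proof (intro allI impI)
    fix \<phi> assume t: "test_function {a<..<b} \<phi>"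
    have L2: "\<phi> \<in> L2 {a<..<b}" "deriv \<phi> \<in> L2 {a<..<b}"
      using test_functionD[OF t ab] by (auto intro!: L2_continuous)
    show "L2_inner {a<..<b} (\<lambda>x. y x - z x) (deriv \<phi>) =
         - L2_inner {a<..<b} (\<lambda>x. dx {a<..<b} y x - dx {a<..<b} z x) \<phi>"
      using dy(3)[unfolded has_weak_deriv_def, rule_format, OF t]
        dz(3)[unfolded has_weak_deriv_def, rule_format, OF t]
        L2_mult_integrable[OF dy(1) L2(2)] L2_mult_integrable[OF dz(1) L2(2)]
        L2_mult_integrable[OF dy(2) L2(1)] L2_mult_integrable[OF dz(2) L2(1)]
      by (simp add: L2_inner_def left_diff_distrib)
  qed
  from dx_eq_AE[OF L2_diff[OF dy(1) dz(1)] L2_diff[OF dy(2) dz(2)] w ab]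
  show "(\<lambda>x. y x - z x) \<in> H1 {a<..<b}"
    "AE x in lebesgue_on {a<..<b}. dx {a<..<b} (\<lambda>x. y x - z x) x = dx {a<..<b} y x - dx {a<..<b} z x" .
qed

text \<open>Solutions of the differential equations enter the weak formulation through this lemma.\<close>

lemma C1_H1:
  assumes w: "\<And>x. x \<in> {a..b} \<Longrightarrow> (w has_real_derivative w' x) (at x within {a..b})"
    and w': "continuous_on {a..b} w'" and ab: "a < b"
  shows "w \<in> H1 {a<..<b}" "AE x in lebesgue_on {a<..<b}. dx {a<..<b} w x = w' x"
proof -
  have cw: "continuous_on {a..b} w" using w DERIV_continuous_on by blast
  have "AE x in lebesgue_on {a<..<b}. w x = w a + integral {a..x} w'"
  proof (rule AE_I2)
    fix x assume "x \<in> space (lebesgue_on {a<..<b})"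
    then have x: "x \<in> {a..b}" by (auto simp: space_restrict_space)
    have "(w' has_integral w x - w a) {a..x}"
      using x by (intro fundamental_theorem_of_calculus)
        (auto simp: has_real_derivative_iff_has_vector_derivative[symmetric] intro!: DERIV_subset[OF w])
    then show "w x = w a + integral {a..x} w'" by (simp add: integral_unique)
  qed
  from has_weak_deriv_primitive[OF continuous_on_imp_lebesgue_on(3)[OF w'] continuous_on_imp_lebesgue_on(1)[OF cw] this ab]
  have "has_weak_deriv {a<..<b} w w'" .
  from dx_eq_AE[OF L2_continuous[OF cw] L2_continuous[OF w'] this ab]
  show "w \<in> H1 {a<..<b}" "AE x in lebesgue_on {a<..<b}. dx {a<..<b} w x = w' x" .
qed

text \<open>Here the primitive of \<open>\<sigma>\<close> plays the part of the flux. It vanishes at both ends, so that no boundary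
  terms appear and \<open>z\<close> is arbitrary at the boundary; this is how the Neumann condition is encoded.\<close>

lemma integration_by_parts_H1:
  assumes z: "z \<in> H1 {a<..<b}" and \<sigma>: "integrable (lebesgue_on {a<..<b}) \<sigma>"
    and 0: "integral {a..b} \<sigma> = 0" and ab: "a < b"
  shows "L2_inner {a<..<b} (\<lambda>x. integral {a..x} \<sigma>) (dx {a<..<b} z) = - L2_inner {a<..<b} \<sigma> z"
proof -
  let ?M = "lebesgue_on {a<..<b}"
  let ?V = "\<lambda>x. integral {a..x} (dx {a<..<b} z)"
  note dz = H1_dx[OF z]
  obtain C where C: "AE x in lebesgue_on {a<..<b}. z x = C + ?V x"
    using has_weak_derivD[OF dz ab] by blast
  note V = continuous_on_imp_lebesgue_on[OF continuous_on_primitive[OF L2_integrable[OF dz(2)] ab]]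
  obtain B where B: "\<forall>x\<in>{a..b}. \<bar>?V x\<bar> \<le> B" using V(2) by blast
  have \<sigma>0: "(\<integral>x. \<sigma> x \<partial>?M) = 0" using 0 integral_eq_lebesgue_on_total[OF \<sigma> ab] by simp
  have \<sigma>V: "integrable ?M (\<lambda>x. \<sigma> x * ?V x)"
    by (rule integrable_mult_bounded(1)[OF \<sigma> V(1), of B])
       (use B in \<open>auto intro!: AE_I2 simp: space_restrict_space\<close>)
  have [measurable]: "\<sigma> \<in> borel_measurable ?M" using \<sigma> by auto
  have "L2_inner {a<..<b} \<sigma> z = (\<integral>x. C * \<sigma> x + \<sigma> x * ?V x \<partial>?M)"
    unfolding L2_inner_def using C V(1) L2D(1)[OF dz(1)]
    by (intro integral_cong_AE) (auto simp: algebra_simps)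
  also have "\<dots> = (\<integral>x. \<sigma> x * ?V x \<partial>?M)" using \<sigma> \<sigma>V \<sigma>0 by simp
  finally show ?thesis
    using integration_by_parts_primitives[OF \<sigma> L2_integrable[OF dz(2)] ab] \<sigma>0
    by (simp add: L2_inner_def)
qed

section \<open>First-order systems with a flux condition\<close>

text \<open>Banach's fixed point theorem in the space of bounded continuous functions. The integral operator is
  conjugated with the weight \<open>exp (2 * C * (t - a))\<close>, which makes it a contraction with factor \<open>1/2\<close> on
  the whole interval at once. Functions on \<open>{a..b}\<close> are extended to the line by clamping the
  argument.\<close>

lemma picard_lindeloef:
  fixes F :: "real \<Rightarrow> 'a::banach \<Rightarrow> 'a"
  assumes cont: "continuous_on ({a..b} \<times> UNIV) (\<lambda>(t, y). F t y)" and ab: "a \<le> b"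
    and lip: "\<And>t y z. t \<in> {a..b} \<Longrightarrow> norm (F t y - F t z) \<le> C * norm (y - z)" and C: "C > 0"
  shows "\<exists>y. \<forall>x\<in>{a..b}. y x = y\<^sub>0 + integral {a..x} (\<lambda>t. F t (y t)) \<and>
    (y has_vector_derivative F x (y x)) (at x within {a..b})"
proof -
  define cl where "cl x = max a (min b x)" for x :: real
  have cl: "cl x \<in> {a..b}" "x \<in> {a..b} \<Longrightarrow> cl x = x" for x using ab by (auto simp: cl_def)
  define e where "e t = exp (2 * C * (t - a))" for t :: real
  have e_pos: "e t > 0" for t by (simp add: e_def)
  have Fcont: "continuous_on {a..b} (\<lambda>t. F t (y t))" if "continuous_on {a..b} y" for y
  proof -
    have "continuous_on {a..b} (\<lambda>t. (t, y t))" using that by (intro continuous_intros)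
    from continuous_on_compose2[OF cont this] show ?thesis by auto
  qed
  have econt: "continuous_on S e" for S unfolding e_def by (intro continuous_intros)
  define G where "G u t = F t (e t *\<^sub>R apply_bcontfun u t)" for u :: "real \<Rightarrow>\<^sub>C 'a" and t
  have G: "continuous_on {a..b} (G u)" for u unfolding G_def
    by (intro Fcont continuous_intros econt continuous_on_apply_bcontfun)
  define P where "P u s = inverse (e s) *\<^sub>R (y\<^sub>0 + integral {a..s} (G u))" for u s
  have "continuous_on {a..b} (P u)" for u unfolding P_def
    by (intro continuous_intros econt indefinite_integral_continuous_1 integrable_continuous_real G)
       (use e_pos in \<open>auto simp: less_le\<close>)
  then have Pcl: "(\<lambda>x. P u (cl x)) \<in> bcontfun" for u
  proof -
    assume P: "\<And>u. continuous_on {a..b} (P u)"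
    have "continuous_on UNIV (\<lambda>x. P u (cl x))"
    proof (rule continuous_on_compose2[OF P])
      show "continuous_on UNIV cl" unfolding cl_def by (intro continuous_intros)
    qed (use cl in auto)
    moreover have "bounded (P u ` {a..b})"
      by (intro compact_imp_bounded compact_continuous_image P) simp
    then have "bounded (range (\<lambda>x. P u (cl x)))"
      by (rule bounded_subset) (use cl in auto)
    ultimately show ?thesis by (simp add: bcontfun_def)
  qed
  define T where "T u = Bcontfun (\<lambda>x. P u (cl x))" for u
  have T: "apply_bcontfun (T u) x = P u (cl x)" for u x
    unfolding T_def by (simp add: Bcontfun_inverse[OF Pcl])
  have contr: "dist (T u) (T v) \<le> 1/2 * dist u v" for u v
  proof (rule dist_bound)
    fix x
    define s where "s = cl x"
    have s: "s \<in> {a..b}" using cl by (simp add: s_def)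
    have Gi: "G u integrable_on {a..s}" for u
      by (intro integrable_continuous_real continuous_on_subset[OF G]) (use s in auto)
    have hi: "((\<lambda>t. C * e t * dist u v) has_integral (dist u v / 2 * e s - dist u v / 2 * e a)) {a..s}"
      using s by (intro fundamental_theorem_of_calculus)
        (auto simp: has_real_derivative_iff_has_vector_derivative[symmetric] e_def
          intro!: derivative_eq_intros)
    have "norm (integral {a..s} (\<lambda>t. G u t - G v t)) \<le> integral {a..s} (\<lambda>t. C * e t * dist u v)"
    proof (rule integral_norm_bound_integral)
      fix t assume "t \<in> {a..s}"
      then have "t \<in> {a..b}" using s by auto
      then have "norm (G u t - G v t) \<le> C * norm (e t *\<^sub>R apply_bcontfun u t - e t *\<^sub>R apply_bcontfun v t)"
        unfolding G_def by (rule lip)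
      also have "\<dots> = C * e t * dist (apply_bcontfun u t) (apply_bcontfun v t)"
        using e_pos[of t] by (simp add: dist_norm flip: scaleR_diff_right)
      also have "\<dots> \<le> C * e t * dist u v"
        using e_pos[of t] C by (intro mult_left_mono dist_bounded) auto
      finally show "norm (G u t - G v t) \<le> C * e t * dist u v" .
    qed (use Gi hi in \<open>auto intro: integrable_diff\<close>)
    also have "\<dots> = dist u v / 2 * e s - dist u v / 2 * e a" by (rule integral_unique[OF hi])
    also have "\<dots> \<le> dist u v / 2 * e s" using e_pos[of a] by simp
    finally have *: "norm (integral {a..s} (G u) - integral {a..s} (G v)) \<le> dist u v / 2 * e s"
      using Gi by (simp add: Henstock_Kurzweil_Integration.integral_diff)
    have "dist (P u s) (P v s) = inverse (e s) * norm (integral {a..s} (G u) - integral {a..s} (G v))"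
      unfolding P_def dist_norm using e_pos[of s] by (simp flip: scaleR_diff_right)
    also have "\<dots> \<le> inverse (e s) * (dist u v / 2 * e s)"
      using e_pos[of s] * by (intro mult_left_mono) auto
    also have "\<dots> = 1/2 * dist u v" using e_pos[of s] by (simp add: field_simps)
    finally show "dist (apply_bcontfun (T u) x) (apply_bcontfun (T v) x) \<le> 1/2 * dist u v"
      by (simp add: T s_def)
  qed
  obtain u where u: "T u = u" using banach_fix_type[of "1/2" T] contr by auto
  define y where "y t = e t *\<^sub>R apply_bcontfun u t" for t
  have y: "y x = y\<^sub>0 + integral {a..x} (\<lambda>t. F t (y t))" if x: "x \<in> {a..b}" for x
  proof -
    have "apply_bcontfun u x = P u x" using T[of u x] u cl(2)[OF x] by simp
    then have "y x = y\<^sub>0 + integral {a..x} (G u)" using e_pos[of x] by (simp add: y_def P_def)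
    then show ?thesis by (simp add: G_def[abs_def] y_def)
  qed
  have ycont: "continuous_on {a..b} y" unfolding y_def
    by (intro continuous_intros econt continuous_on_apply_bcontfun)
  have "(y has_vector_derivative F x (y x)) (at x within {a..b})" if x: "x \<in> {a..b}" for x
  proof (rule has_vector_derivative_transform[OF x y])
    have "((\<lambda>u. integral {a..u} (\<lambda>t. F t (y t))) has_vector_derivative F x (y x)) (at x within {a..b})"
      by (rule integral_has_vector_derivative[OF Fcont[OF ycont] x])
    then show "((\<lambda>x. y\<^sub>0 + integral {a..x} (\<lambda>t. F t (y t))) has_vector_derivative F x (y x)) (at x within {a..b})"
      by (auto intro!: derivative_eq_intros)
  qed
  with y show ?thesis by blast
qed

text \<open>The equation \<open>- (A w')' + H w = F\<close> as a first-order system. Here \<open>B\<close> is the inverse of \<open>A\<close>, \<open>\<Phi>\<close> the primitive of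
  \<open>F\<close>, and \<open>q\<close> is the flux \<open>A w'\<close> plus \<open>\<Phi>\<close>. Thanks to this shift, \<open>q\<close> is continuously differentiable for
  merely integrable \<open>F\<close>. The flux vanishes at \<open>a\<close> by definition, and at \<open>b\<close> iff \<open>q b = \<Phi> b\<close>.\<close>

definition flow :: "real \<Rightarrow> real \<Rightarrow> (real \<Rightarrow> real \<Rightarrow> real) \<Rightarrow> (real \<Rightarrow> real \<Rightarrow> real)
    \<Rightarrow> (real \<Rightarrow> real) \<Rightarrow> (real \<Rightarrow> real) \<Rightarrow> (real \<Rightarrow> real) \<Rightarrow> bool" where
  "flow a b B H \<Phi> w q \<longleftrightarrow> q a = 0 \<and>
     (\<forall>x\<in>{a..b}. (w has_real_derivative B x (q x - \<Phi> x)) (at x within {a..b}) \<and>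
                (q has_real_derivative H x (w x)) (at x within {a..b}))"

lemma flow_exists:
  assumes B: "continuous_on ({a..b} \<times> UNIV) (\<lambda>(t, y). B t y)"
    and H: "continuous_on ({a..b} \<times> UNIV) (\<lambda>(t, y). H t y)"
    and \<Phi>: "continuous_on {a..b} \<Phi>" and ab: "a \<le> b"
    and lipB: "\<And>t y z. t \<in> {a..b} \<Longrightarrow> \<bar>B t y - B t z\<bar> \<le> C * \<bar>y - z\<bar>"
    and lipH: "\<And>t y z. t \<in> {a..b} \<Longrightarrow> \<bar>H t y - H t z\<bar> \<le> C * \<bar>y - z\<bar>"
    and C: "C > 0"
  shows "\<exists>w q. flow a b B H \<Phi> w q \<and> w a = c"
proof -
  define F where "F t p = (B t (snd p - \<Phi> t), H t (fst p))" for t and p :: "real \<times> real"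
  have contF: "continuous_on ({a..b} \<times> UNIV) (\<lambda>(t, p). F t p)"
  proof -
    have "continuous_on ({a..b} \<times> (UNIV :: (real \<times> real) set)) (\<lambda>x. \<Phi> (fst x))"
      by (rule continuous_on_compose2[OF \<Phi>]) (auto intro!: continuous_intros)
    then have "continuous_on ({a..b} \<times> (UNIV :: (real \<times> real) set)) (\<lambda>x. (fst x, snd (snd x) - \<Phi> (fst x)))"
      by (intro continuous_intros)
    from continuous_on_compose2[OF B this]
    have "continuous_on ({a..b} \<times> (UNIV :: (real \<times> real) set)) (\<lambda>x. B (fst x) (snd (snd x) - \<Phi> (fst x)))"
      by (simp add: image_subset_iff mem_Times_iff)
    moreover have "continuous_on ({a..b} \<times> (UNIV :: (real \<times> real) set)) (\<lambda>x. (fst x, fst (snd x)))"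
      by (intro continuous_intros)
    from continuous_on_compose2[OF H this]
    have "continuous_on ({a..b} \<times> (UNIV :: (real \<times> real) set)) (\<lambda>x. H (fst x) (fst (snd x)))"
      by (simp add: image_subset_iff mem_Times_iff)
    ultimately show ?thesis unfolding F_def case_prod_beta by (intro continuous_intros)
  qed
  have lipF: "norm (F t y - F t z) \<le> 2 * C * norm (y - z)" if "t \<in> {a..b}" for t y z
  proof -
    have "norm (F t y - F t z) \<le> \<bar>B t (snd y - \<Phi> t) - B t (snd z - \<Phi> t)\<bar> + \<bar>H t (fst y) - H t (fst z)\<bar>"
      using norm_Pair_le[of "B t (snd y - \<Phi> t) - B t (snd z - \<Phi> t)" "H t (fst y) - H t (fst z)"]
      by (simp add: F_def)
    also have "\<dots> \<le> C * \<bar>snd y - snd z\<bar> + C * \<bar>fst y - fst z\<bar>"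
      using lipB[OF that, of "snd y - \<Phi> t" "snd z - \<Phi> t"] lipH[OF that, of "fst y" "fst z"] by simp
    also have "\<dots> \<le> C * norm (y - z) + C * norm (y - z)"
      using C norm_fst_le[of "fst (y - z)" "snd (y - z)", unfolded prod.collapse]
        norm_snd_le[of "snd (y - z)" "fst (y - z)", unfolded prod.collapse]
      by (intro add_mono mult_left_mono) auto
    finally show ?thesis by simp
  qed
  have "0 < 2 * C" using C by simp
  from picard_lindeloef[OF contF ab lipF this, of "(c, 0)"]
  obtain y where y: "\<And>x. x \<in> {a..b} \<Longrightarrow> y x = (c, 0) + integral {a..x} (\<lambda>t. F t (y t))"
    "\<And>x. x \<in> {a..b} \<Longrightarrow> (y has_vector_derivative F x (y x)) (at x within {a..b})"
    by blast
  have ya: "y a = (c, 0)" using y(1)[of a] ab by simp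
  have "((\<lambda>x. fst (y x)) has_real_derivative B x (snd (y x) - \<Phi> x)) (at x within {a..b})"
    "((\<lambda>x. snd (y x)) has_real_derivative H x (fst (y x))) (at x within {a..b})"
    if "x \<in> {a..b}" for x
    using bounded_linear.has_vector_derivative[OF bounded_linear_fst y(2)[OF that]]
      bounded_linear.has_vector_derivative[OF bounded_linear_snd y(2)[OF that]]
    by (simp_all add: has_real_derivative_iff_has_vector_derivative F_def)
  then have "flow a b B H \<Phi> (\<lambda>x. fst (y x)) (\<lambda>x. snd (y x))"
    using ya by (simp add: flow_def)
  then show ?thesis using ya by (intro exI[of _ "\<lambda>x. fst (y x)"] exI[of _ "\<lambda>x. snd (y x)"]) simp
qed

lemma mean_value_within:
  fixes f :: "real \<Rightarrow> real"
  assumes f: "\<And>x. x \<in> {a..b} \<Longrightarrow> (f has_real_derivative f' x) (at x within {a..b})"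
    and xy: "a \<le> x" "x < y" "y \<le> b"
  obtains \<xi> where "x < \<xi>" "\<xi> < y" "f y - f x = f' \<xi> * (y - x)"
proof -
  show thesis
  proof (rule mvt[OF xy(2), where f' = "\<lambda>\<xi> h. f' \<xi> * h"])
    have "continuous_on {a..b} f" using f DERIV_continuous_on by blast
    then show "continuous_on {x..y} f" by (rule continuous_on_subset) (use xy in auto)
    fix z assume z: "x < z" "z < y"
    then have "(f has_real_derivative f' z) (at z within {a<..<b})"
      using xy by (intro DERIV_subset[OF f]) auto
    moreover have "z \<in> {a<..<b}" using z xy by simp
    ultimately have "(f has_real_derivative f' z) (at z)" using at_within_open[of z "{a<..<b}"] by simp
    then show "(f has_derivative (\<lambda>h. f' z * h)) (at z)" by (simp add: has_field_derivative_def)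
  qed (use that in auto)
qed

lemma within_nonneg_imp_le:
  fixes f :: "real \<Rightarrow> real"
  assumes "\<And>x. x \<in> {a..b} \<Longrightarrow> (f has_real_derivative f' x) (at x within {a..b})"
    and "\<And>x. x \<in> {a..b} \<Longrightarrow> 0 \<le> f' x" and "a \<le> x" "x \<le> y" "y \<le> b"
  shows "f x \<le> f y"
proof (cases "x = y")
  case False
  then obtain \<xi> where "x < \<xi>" "\<xi> < y" "f y - f x = f' \<xi> * (y - x)"
    using mean_value_within[OF assms(1), of x y] assms(3-5) by auto
  moreover have "0 \<le> f' \<xi> * (y - x)" using assms(2)[of \<xi>] assms(3-5) calculation by auto
  ultimately show ?thesis by simp
qed simp

definition strongly_mono :: "real \<Rightarrow> (real \<Rightarrow> real) \<Rightarrow> bool" where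
  "strongly_mono \<eta> h \<longleftrightarrow> (\<forall>r s. s \<le> r \<longrightarrow> \<eta> * (r - s) \<le> h r - h s)"

lemma strongly_monoD:
  assumes "strongly_mono \<eta> h"
  shows "s \<le> r \<Longrightarrow> \<eta> * (r - s) \<le> h r - h s" "\<eta> * (r - s)\<^sup>2 \<le> (h r - h s) * (r - s)"
    "\<eta> * \<bar>r - s\<bar> \<le> \<bar>h r - h s\<bar>"
proof -
  have *: "\<eta> * (r - s) \<le> h r - h s" if "s \<le> r" for r s
    using assms that by (auto simp: strongly_mono_def)
  show "s \<le> r \<Longrightarrow> \<eta> * (r - s) \<le> h r - h s" by (rule *)
  show "\<eta> * \<bar>r - s\<bar> \<le> \<bar>h r - h s\<bar>" using *[of s r] *[of r s] by (cases "s \<le> r") auto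
  show "\<eta> * (r - s)\<^sup>2 \<le> (h r - h s) * (r - s)"
  proof (cases "s \<le> r")
    case True
    then show ?thesis using mult_right_mono[OF *[OF True], of "r - s"] by (simp add: power2_eq_square)
  next
    case False
    then show ?thesis using mult_right_mono[OF *[of r s], of "s - r"]
      by (simp add: power2_eq_square algebra_simps)
  qed
qed

text \<open>Let \<open>D\<close> and \<open>E\<close> be the differences of the two solution components. Monotonicity of both coefficients makes
  \<open>D * E\<close> nondecreasing, hence nonnegative. So \<open>D'\<close> has the sign of \<open>D\<close>, which keeps \<open>D\<close> above its
  initial value and drives \<open>E\<close> up at a definite rate.\<close>

lemma flow_shooting:
  assumes 1: "flow a b B H \<Phi> w\<^sub>1 q\<^sub>1" and 2: "flow a b B H \<Phi> w\<^sub>2 q\<^sub>2" and ab: "a < b"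
    and B: "\<And>x. x \<in> {a..b} \<Longrightarrow> strict_mono (B x)"
    and H: "\<And>x. x \<in> {a..b} \<Longrightarrow> strongly_mono \<eta> (H x)" and \<eta>: "\<eta> > 0"
    and c: "w\<^sub>2 a < w\<^sub>1 a"
  shows "\<eta> * (w\<^sub>1 a - w\<^sub>2 a) * (b - a) \<le> q\<^sub>1 b - q\<^sub>2 b"
proof -
  define D where "D x = w\<^sub>1 x - w\<^sub>2 x" for x
  define E where "E x = q\<^sub>1 x - q\<^sub>2 x" for x
  define D' where "D' x = B x (q\<^sub>1 x - \<Phi> x) - B x (q\<^sub>2 x - \<Phi> x)" for x
  define E' where "E' x = H x (w\<^sub>1 x) - H x (w\<^sub>2 x)" for x
  have D: "(D has_real_derivative D' x) (at x within {a..b})"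
    and E: "(E has_real_derivative E' x) (at x within {a..b})" if "x \<in> {a..b}" for x
    using 1 2 that unfolding flow_def D_def E_def D'_def E'_def by (auto intro!: derivative_intros)
  have D'E: "0 < E x \<Longrightarrow> 0 \<le> D' x" "E x < 0 \<Longrightarrow> D' x \<le> 0" "E x = 0 \<Longrightarrow> D' x = 0" if "x \<in> {a..b}" for x
    using strict_mono_less_eq[OF B[OF that], of "q\<^sub>1 x - \<Phi> x" "q\<^sub>2 x - \<Phi> x"]
      strict_mono_less_eq[OF B[OF that], of "q\<^sub>2 x - \<Phi> x" "q\<^sub>1 x - \<Phi> x"]
    by (auto simp: D'_def E_def)
  have E'D: "\<eta> * (D x)\<^sup>2 \<le> E' x * D x" if "x \<in> {a..b}" for x
    using strongly_monoD(2)[OF H[OF that]] by (simp add: D_def E'_def)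
  have DE: "0 \<le> D x * E x" if x: "x \<in> {a..b}" for x
  proof -
    have "D a * E a \<le> D x * E x"
    proof (rule within_nonneg_imp_le[where f = "\<lambda>x. D x * E x"])
      show "((\<lambda>x. D x * E x) has_real_derivative D' x * E x + D x * E' x) (at x within {a..b})"
        if "x \<in> {a..b}" for x
        using D[OF that] E[OF that] by (auto intro!: derivative_eq_intros)
      show "0 \<le> D' x * E x + D x * E' x" if "x \<in> {a..b}" for x
      proof -
        have "0 \<le> D' x * E x" using D'E[OF that]
          by (cases "E x" "0 :: real" rule: linorder_cases) (auto intro: mult_nonneg_nonneg mult_nonpos_nonpos)
        moreover have "0 \<le> \<eta> * (D x)\<^sup>2" using \<eta> by simp
        ultimately show ?thesis using E'D[OF that] by (simp add: mult.commute)
      qed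
    qed (use x in auto)
    moreover have "E a = 0" using 1 2 by (simp add: E_def flow_def)
    ultimately show ?thesis by simp
  qed
  have Dsq: "(D a)\<^sup>2 \<le> (D x)\<^sup>2" if x: "x \<in> {a..b}" for x
  proof (rule within_nonneg_imp_le[where f = "\<lambda>x. (D x)\<^sup>2"])
    show "((\<lambda>x. (D x)\<^sup>2) has_real_derivative 2 * (D x * D' x)) (at x within {a..b})"
      if "x \<in> {a..b}" for x
      using D[OF that] by (auto intro!: derivative_eq_intros)
    show "0 \<le> 2 * (D x * D' x)" if "x \<in> {a..b}" for x
    proof -
      have "0 \<le> D x * D' x"
      proof (cases "D x" "0 :: real" rule: linorder_cases)
        case less
        with DE[OF that] have "E x \<le> 0" by (simp add: zero_le_mult_iff)
        then have "D' x \<le> 0" using D'E[OF that] by fastforce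
        then show ?thesis using less by (intro mult_nonpos_nonpos) auto
      next
        case greater
        with DE[OF that] have "E x \<ge> 0" by (simp add: zero_le_mult_iff)
        then have "D' x \<ge> 0" using D'E[OF that] by fastforce
        then show ?thesis using greater by auto
      qed simp
      then show ?thesis by simp
    qed
  qed (use x in auto)
  have Da: "D a > 0" using c by (simp add: D_def)
  have Dc: "D a \<le> D x" if x: "x \<in> {a..b}" for x
  proof -
    have "\<not> D x < 0"
    proof
      assume "D x < 0"
      moreover have "continuous_on {a..x} D"
        using DERIV_continuous_on[OF D] by (rule continuous_on_subset) (use x in auto)
      ultimately obtain z where "a \<le> z" "z \<le> x" "D z = 0"
        using IVT2'[of D x 0 a] x Da by auto
      then show False using Dsq[of z] Da x by auto
    qed
    then show ?thesis using power2_le_imp_le[OF Dsq[OF x]] by simp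
  qed
  obtain \<xi> where \<xi>: "a < \<xi>" "\<xi> < b" "E b - E a = E' \<xi> * (b - a)"
    using mean_value_within[OF E, of a b] ab by auto
  have "\<eta> * D a \<le> \<eta> * D \<xi>" using Dc[of \<xi>] \<xi> \<eta> by simp
  also have "\<dots> \<le> E' \<xi>" using strongly_monoD(1)[OF H[of \<xi>], of "w\<^sub>2 \<xi>" "w\<^sub>1 \<xi>"] Dc[of \<xi>] Da \<xi>
    by (simp add: D_def E'_def)
  finally have "\<eta> * D a * (b - a) \<le> E b - E a" using ab \<xi>(3) by simp
  moreover have "E a = 0" using 1 2 by (simp add: E_def flow_def)
  ultimately show ?thesis by (simp add: D_def E_def)
qed

text \<open>Gronwall's inequality for the sum of the squares of the differences.\<close>

lemma flow_dependence:
  assumes 1: "flow a b B H \<Phi> w\<^sub>1 q\<^sub>1" and 2: "flow a b B H \<Phi> w\<^sub>2 q\<^sub>2" and ab: "a < b"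
    and lipB: "\<And>t y z. t \<in> {a..b} \<Longrightarrow> \<bar>B t y - B t z\<bar> \<le> C * \<bar>y - z\<bar>"
    and lipH: "\<And>t y z. t \<in> {a..b} \<Longrightarrow> \<bar>H t y - H t z\<bar> \<le> C * \<bar>y - z\<bar>"
  shows "\<bar>q\<^sub>1 b - q\<^sub>2 b\<bar> \<le> exp (C * (b - a)) * \<bar>w\<^sub>1 a - w\<^sub>2 a\<bar>"
proof -
  define D where "D x = w\<^sub>1 x - w\<^sub>2 x" for x
  define E where "E x = q\<^sub>1 x - q\<^sub>2 x" for x
  define D' where "D' x = B x (q\<^sub>1 x - \<Phi> x) - B x (q\<^sub>2 x - \<Phi> x)" for x
  define E' where "E' x = H x (w\<^sub>1 x) - H x (w\<^sub>2 x)" for x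
  have D: "(D has_real_derivative D' x) (at x within {a..b})"
    and E: "(E has_real_derivative E' x) (at x within {a..b})" if "x \<in> {a..b}" for x
    using 1 2 that unfolding flow_def D_def E_def D'_def E'_def by (auto intro!: derivative_intros)
  have D': "\<bar>D' x\<bar> \<le> C * \<bar>E x\<bar>" and E': "\<bar>E' x\<bar> \<le> C * \<bar>D x\<bar>" if "x \<in> {a..b}" for x
    using lipB[OF that, of "q\<^sub>1 x - \<Phi> x" "q\<^sub>2 x - \<Phi> x"] lipH[OF that, of "w\<^sub>1 x" "w\<^sub>2 x"]
    by (auto simp: D_def E_def D'_def E'_def)
  define N where "N x = - (exp (- (2 * C * (x - a))) * ((D x)\<^sup>2 + (E x)\<^sup>2))" for x
  define N' where "N' x = exp (- (2 * C * (x - a))) * (2 * C * ((D x)\<^sup>2 + (E x)\<^sup>2) - 2 * (D x * D' x + E x * E' x))" for x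
  have "N a \<le> N b"
  proof (rule within_nonneg_imp_le[where f = N and f' = N'])
    fix x assume x: "x \<in> {a..b}"
    show "(N has_real_derivative N' x) (at x within {a..b})"
      unfolding N_def[abs_def] N'_def
      by (rule derivative_eq_intros refl D[OF x] E[OF x])+ (simp add: algebra_simps)
    have "D x * D' x + E x * E' x \<le> \<bar>D x\<bar> * \<bar>D' x\<bar> + \<bar>E x\<bar> * \<bar>E' x\<bar>"
      by (intro add_mono) (auto simp flip: abs_mult)
    also have "\<dots> \<le> \<bar>D x\<bar> * (C * \<bar>E x\<bar>) + \<bar>E x\<bar> * (C * \<bar>D x\<bar>)"
      by (intro add_mono mult_left_mono D' E' x) auto
    also have "\<dots> = C * (2 * \<bar>D x\<bar> * \<bar>E x\<bar>)" by simp
    also have "\<dots> \<le> C * ((D x)\<^sup>2 + (E x)\<^sup>2)"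
    proof (rule mult_left_mono)
      show "2 * \<bar>D x\<bar> * \<bar>E x\<bar> \<le> (D x)\<^sup>2 + (E x)\<^sup>2" using sum_squares_bound[of "\<bar>D x\<bar>" "\<bar>E x\<bar>"] by simp
      show "0 \<le> C" using lipB[OF x, of 1 0] by simp
    qed
    finally show "0 \<le> N' x" unfolding N'_def by (intro mult_nonneg_nonneg) auto
  qed (use ab in auto)
  moreover have "E a = 0" using 1 2 by (simp add: E_def flow_def)
  ultimately have "exp (- (2 * C * (b - a))) * ((D b)\<^sup>2 + (E b)\<^sup>2) \<le> (D a)\<^sup>2" by (simp add: N_def)
  then have "(D b)\<^sup>2 + (E b)\<^sup>2 \<le> exp (2 * C * (b - a)) * (D a)\<^sup>2"
  proof -
    have "(D b)\<^sup>2 + (E b)\<^sup>2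
        = exp (2 * C * (b - a)) * (exp (- (2 * C * (b - a))) * ((D b)\<^sup>2 + (E b)\<^sup>2))"
      by (simp add: mult.assoc[symmetric] flip: exp_add)
    also have "\<dots> \<le> exp (2 * C * (b - a)) * (D a)\<^sup>2"
      using \<open>exp (- (2 * C * (b - a))) * _ \<le> _\<close> by (rule mult_left_mono) simp
    finally show ?thesis .
  qed
  then have "(E b)\<^sup>2 \<le> exp (2 * C * (b - a)) * (D a)\<^sup>2" using zero_le_power2[of "D b"] by linarith
  also have "exp (2 * C * (b - a)) = (exp (C * (b - a)))\<^sup>2"
    by (simp add: power2_eq_square flip: exp_add)
  finally have "\<bar>E b\<bar>\<^sup>2 \<le> (exp (C * (b - a)) * \<bar>D a\<bar>)\<^sup>2" by (simp add: power_mult_distrib)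
  then have "\<bar>E b\<bar> \<le> exp (C * (b - a)) * \<bar>D a\<bar>" by (rule power2_le_imp_le) simp
  then show ?thesis by (simp add: D_def E_def)
qed

text \<open>The value of \<open>q\<close> at \<open>b\<close> depends continuously on the initial value of \<open>w\<close> and grows at least linearly with it,
  so the intermediate value theorem finds the initial value with the prescribed \<open>q b\<close>.\<close>

lemma neumann_exists:
  assumes B: "continuous_on ({a..b} \<times> UNIV) (\<lambda>(t, y). B t y)"
    and H: "continuous_on ({a..b} \<times> UNIV) (\<lambda>(t, y). H t y)"
    and \<Phi>: "continuous_on {a..b} \<Phi>" and ab: "a < b"
    and lipB: "\<And>t y z. t \<in> {a..b} \<Longrightarrow> \<bar>B t y - B t z\<bar> \<le> C * \<bar>y - z\<bar>"
    and lipH: "\<And>t y z. t \<in> {a..b} \<Longrightarrow> \<bar>H t y - H t z\<bar> \<le> C * \<bar>y - z\<bar>"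
    and C: "C > 0"
    and monoB: "\<And>x. x \<in> {a..b} \<Longrightarrow> strict_mono (B x)"
    and monoH: "\<And>x. x \<in> {a..b} \<Longrightarrow> strongly_mono \<eta> (H x)" and \<eta>: "\<eta> > 0"
  shows "\<exists>w q. flow a b B H \<Phi> w q \<and> q b = \<Phi> b"
proof -
  have "\<forall>c. \<exists>w q. flow a b B H \<Phi> w q \<and> w a = c"
    using flow_exists[OF B H \<Phi> _ lipB lipH C] ab by auto
  then obtain W Q where WQ: "\<And>c. flow a b B H \<Phi> (W c) (Q c)" "\<And>c. W c a = c" by metis
  have lip: "\<bar>Q c b - Q c' b\<bar> \<le> exp (C * (b - a)) * \<bar>c - c'\<bar>" for c c'
    using flow_dependence[OF WQ(1) WQ(1) ab lipB lipH, of c c'] by (simp add: WQ(2))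
  have "continuous_on UNIV (\<lambda>c. Q c b)"
  proof (rule continuous_on_iff[THEN iffD2], intro ballI allI impI)
    fix c e :: real assume "e > 0"
    then show "\<exists>d>0. \<forall>c'\<in>UNIV. dist c' c < d \<longrightarrow> dist (Q c' b) (Q c b) < e"
      by (intro exI[of _ "e / exp (C * (b - a))"] conjI ballI impI)
         (auto simp: dist_real_def field_simps intro: le_less_trans[OF lip])
  qed
  then have cont: "continuous_on S (\<lambda>c. Q c b)" for S by (rule continuous_on_subset) simp
  define k where "k = \<eta> * (b - a)"
  have k: "k > 0" using \<eta> ab by (simp add: k_def)
  have up: "k * (c - c') \<le> Q c b - Q c' b" if "c' < c" for c c'
    using flow_shooting[OF WQ(1) WQ(1) ab monoB monoH \<eta>, of c' c] that by (simp add: WQ(2) k_def mult_ac)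
  define c where "c = (\<bar>\<Phi> b - Q 0 b\<bar> + 1) / k"
  have c: "c > 0" "k * c = \<bar>\<Phi> b - Q 0 b\<bar> + 1" using k by (auto simp: c_def)
  have "Q (- c) b \<le> \<Phi> b" "\<Phi> b \<le> Q c b" using up[of 0 c] up[of "- c" 0] c by auto
  then obtain c' where "Q c' b = \<Phi> b" using IVT'[OF _ _ _ cont, of "- c" "\<Phi> b" c] c by auto
  then show ?thesis using WQ(1)[of c'] by blast
qed

text \<open>A maximum principle. At an interior maximum of \<open>q\<^sub>1 - q\<^sub>2\<close> the values of \<open>w\<^sub>1\<close> and \<open>w\<^sub>2\<close> agree. If the
  maximum exceeded \<open>d\<close>, then to the right of it \<open>w\<^sub>1 - w\<^sub>2\<close> would become positive and \<open>q\<^sub>1 - q\<^sub>2\<close> would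
  grow further.\<close>

lemma flow_flux_le:
  assumes 1: "flow a b B H \<Phi>\<^sub>1 w\<^sub>1 q\<^sub>1" "q\<^sub>1 b = \<Phi>\<^sub>1 b" and 2: "flow a b B H \<Phi>\<^sub>2 w\<^sub>2 q\<^sub>2" "q\<^sub>2 b = \<Phi>\<^sub>2 b"
    and ab: "a < b"
    and B: "\<And>x. x \<in> {a..b} \<Longrightarrow> strict_mono (B x)"
    and H: "\<And>x. x \<in> {a..b} \<Longrightarrow> strongly_mono \<eta> (H x)" and \<eta>: "\<eta> > 0"
    and d: "\<And>x. x \<in> {a..b} \<Longrightarrow> \<Phi>\<^sub>1 x - \<Phi>\<^sub>2 x \<le> d" and d0: "0 \<le> d" and x: "x \<in> {a..b}"
  shows "q\<^sub>1 x - q\<^sub>2 x \<le> d"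
proof (rule ccontr)
  assume contra: "\<not> q\<^sub>1 x - q\<^sub>2 x \<le> d"
  define D where "D x = w\<^sub>1 x - w\<^sub>2 x" for x
  define E where "E x = q\<^sub>1 x - q\<^sub>2 x" for x
  define D' where "D' x = B x (q\<^sub>1 x - \<Phi>\<^sub>1 x) - B x (q\<^sub>2 x - \<Phi>\<^sub>2 x)" for x
  define E' where "E' x = H x (w\<^sub>1 x) - H x (w\<^sub>2 x)" for x
  have D: "(D has_real_derivative D' x) (at x within {a..b})"
    and E: "(E has_real_derivative E' x) (at x within {a..b})" if "x \<in> {a..b}" for x
    using 1 2 that unfolding flow_def D_def E_def D'_def E'_def by (auto intro!: derivative_intros)
  have Econt: "continuous_on {a..b} E" using DERIV_continuous_on[OF E] .
  obtain x\<^sub>0 where x\<^sub>0: "x\<^sub>0 \<in> {a..b}" "\<And>y. y \<in> {a..b} \<Longrightarrow> E y \<le> E x\<^sub>0"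
    using continuous_attains_sup[OF _ _ Econt] ab by auto
  have Ex0: "E x\<^sub>0 > d" using contra x\<^sub>0(2)[OF x] by (simp add: E_def)
  have "E a = 0" using 1 2 by (simp add: E_def flow_def)
  moreover have "E b \<le> d" using 1 2 d[of b] ab by (simp add: E_def)
  ultimately have "x\<^sub>0 \<noteq> a" "x\<^sub>0 \<noteq> b" using Ex0 d0 by auto
  with x\<^sub>0 have in0: "x\<^sub>0 \<in> {a<..<b}" by auto
  have "(E has_real_derivative E' x\<^sub>0) (at x\<^sub>0 within {a<..<b})"
    by (rule DERIV_subset[OF E[OF x\<^sub>0(1)]]) auto
  then have "(E has_real_derivative E' x\<^sub>0) (at x\<^sub>0)" using at_within_open[OF in0] by simp
  then have "E' x\<^sub>0 = 0"
  proof (rule DERIV_local_max)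
    show "0 < min (x\<^sub>0 - a) (b - x\<^sub>0)" using in0 by simp
    show "\<forall>y. \<bar>x\<^sub>0 - y\<bar> < min (x\<^sub>0 - a) (b - x\<^sub>0) \<longrightarrow> E y \<le> E x\<^sub>0"
      by (intro allI impI x\<^sub>0(2)) auto
  qed
  then have D0: "D x\<^sub>0 = 0"
    using strongly_monoD(3)[OF H[OF x\<^sub>0(1)], of "w\<^sub>1 x\<^sub>0" "w\<^sub>2 x\<^sub>0"] \<eta>
    by (simp add: E'_def D_def mult_le_0_iff)
  obtain r where r: "r > 0" "\<And>y. y \<in> {a..b} \<Longrightarrow> dist y x\<^sub>0 < r \<Longrightarrow> dist (E y) (E x\<^sub>0) < E x\<^sub>0 - d"
    using Econt x\<^sub>0(1) Ex0 unfolding continuous_on_iff by (meson diff_gt_0_iff_gt)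
  define x\<^sub>1 where "x\<^sub>1 = x\<^sub>0 + min (r / 2) ((b - x\<^sub>0) / 2)"
  have x1: "x\<^sub>0 < x\<^sub>1" "x\<^sub>1 < b" "x\<^sub>1 < x\<^sub>0 + r" using r(1) in0 by (auto simp: x\<^sub>1_def min_def field_simps)
  have Ed: "E y > d" if "y \<in> {x\<^sub>0..x\<^sub>1}" for y
    using r(2)[of y] that x1 in0 by (auto simp: dist_real_def)
  have D'pos: "D' y > 0" if "y \<in> {x\<^sub>0..x\<^sub>1}" for y
  proof -
    have y: "y \<in> {a..b}" using that x1 in0 by auto
    have "q\<^sub>2 y - \<Phi>\<^sub>2 y < q\<^sub>1 y - \<Phi>\<^sub>1 y" using Ed[OF that] d[OF y] by (simp add: E_def)
    then show ?thesis using strict_monoD[OF B[OF y]] by (simp add: D'_def)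
  qed
  obtain \<xi> where \<xi>: "x\<^sub>0 < \<xi>" "\<xi> < x\<^sub>1" "E x\<^sub>1 - E x\<^sub>0 = E' \<xi> * (x\<^sub>1 - x\<^sub>0)"
    using mean_value_within[OF E, of x\<^sub>0 x\<^sub>1] x1 in0 by auto
  obtain \<zeta> where \<zeta>: "x\<^sub>0 < \<zeta>" "\<zeta> < \<xi>" "D \<xi> - D x\<^sub>0 = D' \<zeta> * (\<xi> - x\<^sub>0)"
    using mean_value_within[OF D, of x\<^sub>0 \<xi>] x1 in0 \<xi> by auto
  have "D \<xi> > 0" using \<zeta> \<xi> D'pos[of \<zeta>] D0 by simp
  then have "0 < \<eta> * D \<xi>" using \<eta> by simp
  also have "\<dots> \<le> E' \<xi>"
    using strongly_monoD(1)[OF H[of \<xi>], of "w\<^sub>2 \<xi>" "w\<^sub>1 \<xi>"] \<open>D \<xi> > 0\<close> \<xi> x1 in0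
    by (simp add: D_def E'_def)
  finally have "0 < E' \<xi> * (x\<^sub>1 - x\<^sub>0)" using x1 by simp
  then have "E x\<^sub>0 < E x\<^sub>1" using \<xi>(3) by linarith
  then show False using x\<^sub>0(2)[of x\<^sub>1] x1 in0 by auto
qed

text \<open>The maximum principle bounds the difference of the derivatives. The mean value theorem for \<open>q\<^sub>1 - q\<^sub>2\<close>
  supplies one point where \<open>w\<^sub>1 - w\<^sub>2\<close> is small, and the derivative bound spreads this to the
  interval.\<close>

lemma flow_stability:
  assumes 1: "flow a b B H \<Phi>\<^sub>1 w\<^sub>1 q\<^sub>1" "q\<^sub>1 b = \<Phi>\<^sub>1 b" and 2: "flow a b B H \<Phi>\<^sub>2 w\<^sub>2 q\<^sub>2" "q\<^sub>2 b = \<Phi>\<^sub>2 b"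
    and ab: "a < b"
    and B: "\<And>x. x \<in> {a..b} \<Longrightarrow> strict_mono (B x)"
    and lipB: "\<And>t y z. t \<in> {a..b} \<Longrightarrow> \<bar>B t y - B t z\<bar> \<le> C * \<bar>y - z\<bar>"
    and H: "\<And>x. x \<in> {a..b} \<Longrightarrow> strongly_mono \<eta> (H x)" and \<eta>: "\<eta> > 0"
    and d: "\<And>x. x \<in> {a..b} \<Longrightarrow> \<bar>\<Phi>\<^sub>1 x - \<Phi>\<^sub>2 x\<bar> \<le> d" and x: "x \<in> {a..b}"
  shows "\<bar>B x (q\<^sub>1 x - \<Phi>\<^sub>1 x) - B x (q\<^sub>2 x - \<Phi>\<^sub>2 x)\<bar> \<le> 2 * C * d"
    and "\<bar>w\<^sub>1 x - w\<^sub>2 x\<bar> \<le> (1 / ((b - a) * \<eta>) + 2 * C * (b - a)) * d"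
proof -
  have d0: "0 \<le> d" using d[OF x] by linarith
  define D where "D x = w\<^sub>1 x - w\<^sub>2 x" for x
  define E where "E x = q\<^sub>1 x - q\<^sub>2 x" for x
  define D' where "D' x = B x (q\<^sub>1 x - \<Phi>\<^sub>1 x) - B x (q\<^sub>2 x - \<Phi>\<^sub>2 x)" for x
  define E' where "E' x = H x (w\<^sub>1 x) - H x (w\<^sub>2 x)" for x
  have D: "(D has_real_derivative D' x) (at x within {a..b})"
    and E: "(E has_real_derivative E' x) (at x within {a..b})" if "x \<in> {a..b}" for x
    using 1 2 that unfolding flow_def D_def E_def D'_def E'_def by (auto intro!: derivative_intros)
  have q: "\<bar>E x\<bar> \<le> d" if x: "x \<in> {a..b}" for x
  proof -
    have "\<Phi>\<^sub>1 y - \<Phi>\<^sub>2 y \<le> d" "\<Phi>\<^sub>2 y - \<Phi>\<^sub>1 y \<le> d" if "y \<in> {a..b}" for y using d[OF that] by auto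
    then show ?thesis
      using flow_flux_le[OF 1 2 ab B H \<eta> _ d0 x] flow_flux_le[OF 2 1 ab B H \<eta> _ d0 x]
      by (auto simp: E_def)
  qed
  have D': "\<bar>D' x\<bar> \<le> 2 * C * d" if x: "x \<in> {a..b}" for x
  proof -
    have "C \<ge> 0" using lipB[OF x, of 1 0] by simp
    moreover have "\<bar>(q\<^sub>1 x - \<Phi>\<^sub>1 x) - (q\<^sub>2 x - \<Phi>\<^sub>2 x)\<bar> \<le> 2 * d"
      using q[OF x] d[OF x] by (auto simp: E_def)
    ultimately have "C * \<bar>(q\<^sub>1 x - \<Phi>\<^sub>1 x) - (q\<^sub>2 x - \<Phi>\<^sub>2 x)\<bar> \<le> C * (2 * d)" by (intro mult_left_mono)
    then show ?thesis using lipB[OF x, of "q\<^sub>1 x - \<Phi>\<^sub>1 x" "q\<^sub>2 x - \<Phi>\<^sub>2 x"] by (simp add: D'_def)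
  qed
  from D'[OF x] show "\<bar>B x (q\<^sub>1 x - \<Phi>\<^sub>1 x) - B x (q\<^sub>2 x - \<Phi>\<^sub>2 x)\<bar> \<le> 2 * C * d" by (simp add: D'_def)
  obtain \<xi> where \<xi>: "a < \<xi>" "\<xi> < b" "E b - E a = E' \<xi> * (b - a)"
    using mean_value_within[OF E, of a b] ab by auto
  have "E a = 0" using 1 2 by (simp add: E_def flow_def)
  then have "\<bar>E' \<xi>\<bar> * (b - a) \<le> d" using q[of b] \<xi>(3) ab by (simp add: abs_mult)
  then have "\<bar>E' \<xi>\<bar> \<le> d / (b - a)" using ab by (simp add: pos_le_divide_eq)
  moreover have "\<eta> * \<bar>D \<xi>\<bar> \<le> \<bar>E' \<xi>\<bar>"
    using strongly_monoD(3)[OF H[of \<xi>], of "w\<^sub>1 \<xi>" "w\<^sub>2 \<xi>"] \<xi> by (simp add: D_def E'_def)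
  ultimately have "\<eta> * \<bar>D \<xi>\<bar> \<le> d / (b - a)" by linarith
  then have D\<xi>: "\<bar>D \<xi>\<bar> \<le> 1 / ((b - a) * \<eta>) * d" using \<eta> ab by (simp add: field_simps)
  have mv: "\<bar>D s - D t\<bar> \<le> 2 * C * d * (b - a)" if st: "t < s" "s \<in> {a..b}" "t \<in> {a..b}" for s t
  proof -
    obtain \<zeta> where \<zeta>: "t < \<zeta>" "\<zeta> < s" "D s - D t = D' \<zeta> * (s - t)"
      using mean_value_within[OF D, of t s] st by auto
    have "\<bar>D s - D t\<bar> = \<bar>D' \<zeta>\<bar> * (s - t)" using \<zeta> st by (simp add: abs_mult)
    also have "\<dots> \<le> 2 * C * d * (b - a)"
      using D'[of \<zeta>] \<zeta> st by (intro mult_mono) (auto intro: order_trans[OF abs_ge_zero])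
    finally show ?thesis .
  qed
  have "\<bar>D x - D \<xi>\<bar> \<le> 2 * C * d * (b - a)"
  proof (cases x \<xi> rule: linorder_cases)
    case less then show ?thesis using mv[of x \<xi>] x \<xi> by (simp add: abs_minus_commute)
  next
    case greater then show ?thesis using mv[of \<xi> x] x \<xi> by simp
  next
    case equal then show ?thesis using D'[OF x] ab by (simp add: order_trans[OF abs_ge_zero])
  qed
  then have "\<bar>D x\<bar> \<le> 1 / ((b - a) * \<eta>) * d + 2 * C * d * (b - a)" using D\<xi> by linarith
  then show "\<bar>w\<^sub>1 x - w\<^sub>2 x\<bar> \<le> (1 / ((b - a) * \<eta>) + 2 * C * (b - a)) * d"
    by (simp add: D_def algebra_simps)
qed

section \<open>Neumann problems for monotone second-order equations\<close>

text \<open>The classical formulation of \<open>- (A w')' + H w = F\<close> with zero flux at both ends, where \<open>w'\<close> is the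
  derivative of \<open>w\<close>. The equation is integrated once because \<open>F\<close> is only integrable.\<close>

definition neumann_sol :: "real \<Rightarrow> real \<Rightarrow> (real \<Rightarrow> real \<Rightarrow> real) \<Rightarrow> (real \<Rightarrow> real \<Rightarrow> real)
    \<Rightarrow> (real \<Rightarrow> real) \<Rightarrow> (real \<Rightarrow> real) \<Rightarrow> (real \<Rightarrow> real) \<Rightarrow> bool" where
  "neumann_sol a b A H F w w' \<longleftrightarrow> continuous_on {a..b} w' \<and>
     integral {a..b} (\<lambda>t. H t (w t) - F t) = 0 \<and>
     (\<forall>x\<in>{a..b}. (w has_real_derivative w' x) (at x within {a..b}) \<and>
                A x (w' x) = integral {a..x} (\<lambda>t. H t (w t) - F t))"

lemma neumann_solD:
  assumes "neumann_sol a b A H F w w'"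
  shows "continuous_on {a..b} w'" "continuous_on {a..b} w"
    "x \<in> {a..b} \<Longrightarrow> (w has_real_derivative w' x) (at x within {a..b})"
  using assms DERIV_continuous_on[of "{a..b}" w w'] by (auto simp: neumann_sol_def)

lemma strongly_mono_inverse:
  assumes A: "strongly_mono \<kappa> A" and \<kappa>: "\<kappa> > 0" and inv: "\<And>s. A (B s) = s"
  shows "strict_mono B" "\<bar>B s - B t\<bar> \<le> 1 / \<kappa> * \<bar>s - t\<bar>" "B (A r) = r"
proof -
  have "\<kappa> * \<bar>B s - B t\<bar> \<le> \<bar>s - t\<bar>" for s t
    using strongly_monoD(3)[OF A, of "B s" "B t"] by (simp add: inv)
  then show "\<bar>B s - B t\<bar> \<le> 1 / \<kappa> * \<bar>s - t\<bar>" using \<kappa> by (simp add: field_simps)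
  show "strict_mono B"
  proof (rule strict_monoI, rule ccontr)
    fix s t :: real assume "s < t" "\<not> B s < B t"
    then have "\<kappa> * (B s - B t) \<le> A (B s) - A (B t)" by (intro strongly_monoD(1)[OF A]) simp
    moreover have "0 \<le> \<kappa> * (B s - B t)" using \<open>\<not> B s < B t\<close> \<kappa> by simp
    ultimately show False using \<open>s < t\<close> by (simp add: inv)
  qed
  have "\<kappa> * \<bar>B (A r) - r\<bar> \<le> 0"
    using strongly_monoD(3)[OF A, of "B (A r)" r] by (simp add: inv)
  then show "B (A r) = r" using \<kappa> by (simp add: mult_le_0_iff)
qed

text \<open>The coefficients may depend on the position because those of the adjoint equation are evaluated along
  the optimal state.\<close>

locale neumann_problem =
  fixes a b \<kappa> \<eta> :: real and A B H :: "real \<Rightarrow> real \<Rightarrow> real"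
  assumes ab: "a < b" and \<kappa>: "\<kappa> > 0" and \<eta>: "\<eta> > 0"
    and A: "\<And>x. x \<in> {a..b} \<Longrightarrow> strongly_mono \<kappa> (A x)"
    and H: "\<And>x. x \<in> {a..b} \<Longrightarrow> strongly_mono \<eta> (H x)"
    and inv: "\<And>x s. x \<in> {a..b} \<Longrightarrow> A x (B x s) = s"
    and contB: "continuous_on ({a..b} \<times> UNIV) (\<lambda>(t, y). B t y)"
    and contH: "continuous_on ({a..b} \<times> UNIV) (\<lambda>(t, y). H t y)"
begin

lemma B_props:
  assumes "x \<in> {a..b}"
  shows "strict_mono (B x)" "\<bar>B x s - B x t\<bar> \<le> 1 / \<kappa> * \<bar>s - t\<bar>" "B x (A x r) = r"
  using strongly_mono_inverse[OF A[OF assms] \<kappa> inv[OF assms]] by auto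

lemma continuous_on_H: "continuous_on {a..b} w \<Longrightarrow> continuous_on {a..b} (\<lambda>x. H x (w x))"
proof -
  assume "continuous_on {a..b} w"
  then have "continuous_on {a..b} (\<lambda>t. (t, w t))" by (intro continuous_intros)
  from continuous_on_compose2[OF contH this] show ?thesis by auto
qed

lemma continuous_on_B: "continuous_on {a..b} w \<Longrightarrow> continuous_on {a..b} (\<lambda>x. B x (w x))"
proof -
  assume "continuous_on {a..b} w"
  then have "continuous_on {a..b} (\<lambda>t. (t, w t))" by (intro continuous_intros)
  from continuous_on_compose2[OF contB this] show ?thesis by auto
qed

lemma neumann_sol_imp_flow:
  assumes sol: "neumann_sol a b A H F w w'" and F: "integrable (lebesgue_on {a<..<b}) F"
  shows "flow a b B H (\<lambda>x. integral {a..x} F) w (\<lambda>x. integral {a..x} (\<lambda>t. H t (w t)))"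
    "integral {a..b} (\<lambda>t. H t (w t)) = integral {a..b} F"
    "x \<in> {a..b} \<Longrightarrow> w' x = B x (integral {a..x} (\<lambda>t. H t (w t)) - integral {a..x} F)"
proof -
  note Hw = continuous_on_H[OF neumann_solD(2)[OF sol]]
  have split: "integral {a..x} (\<lambda>t. H t (w t) - F t) = integral {a..x} (\<lambda>t. H t (w t)) - integral {a..x} F"
    if "x \<in> {a..b}" for x
    using that integral_eq_lebesgue_on(1)[OF F that] integral_eq_lebesgue_on(1)[OF continuous_on_imp_lebesgue_on(3)[OF Hw] that]
    by (intro Henstock_Kurzweil_Integration.integral_diff)
  then show "integral {a..b} (\<lambda>t. H t (w t)) = integral {a..b} F"
    using sol ab by (simp add: neumann_sol_def)
  show *: "w' x = B x (integral {a..x} (\<lambda>t. H t (w t)) - integral {a..x} F)" if "x \<in> {a..b}" for x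
    using sol that split[OF that] B_props(3)[OF that, of "w' x"] by (simp add: neumann_sol_def)
  show "flow a b B H (\<lambda>x. integral {a..x} F) w (\<lambda>x. integral {a..x} (\<lambda>t. H t (w t)))"
    using sol integral_has_real_derivative[OF Hw] *
    by (simp add: flow_def neumann_sol_def)
qed

lemma neumann_sol_exists:
  assumes F: "integrable (lebesgue_on {a<..<b}) F"
    and lip: "\<And>t y z. t \<in> {a..b} \<Longrightarrow> \<bar>H t y - H t z\<bar> \<le> C * \<bar>y - z\<bar>"
  shows "\<exists>w w'. neumann_sol a b A H F w w'"
proof -
  let ?\<Phi> = "\<lambda>x. integral {a..x} F"
  define C' where "C' = max C (1 / \<kappa>)"
  have C': "C' > 0" "C \<le> C'" "1 / \<kappa> \<le> C'" using \<kappa> by (auto simp: C'_def less_max_iff_disj)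
  have \<Phi>: "continuous_on {a..b} ?\<Phi>" by (rule continuous_on_primitive[OF F ab])
  have "\<exists>w q. flow a b B H ?\<Phi> w q \<and> q b = ?\<Phi> b"
  proof (rule neumann_exists[OF contB contH \<Phi> ab _ _ C'(1) B_props(1) H \<eta>])
    fix t y z assume t: "t \<in> {a..b}"
    show "\<bar>B t y - B t z\<bar> \<le> C' * \<bar>y - z\<bar>"
      using B_props(2)[OF t, of y z] mult_right_mono[OF C'(3), of "\<bar>y - z\<bar>"] by simp
    show "\<bar>H t y - H t z\<bar> \<le> C' * \<bar>y - z\<bar>"
      using lip[OF t, of y z] mult_right_mono[OF C'(2), of "\<bar>y - z\<bar>"] by simp
  qed
  then obtain w q where wq: "flow a b B H ?\<Phi> w q" "q b = ?\<Phi> b" by blast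
  have w: "(w has_real_derivative B x (q x - ?\<Phi> x)) (at x within {a..b})"
    and q: "(q has_real_derivative H x (w x)) (at x within {a..b})" if "x \<in> {a..b}" for x
    using wq that by (auto simp: flow_def)
  have cq: "continuous_on {a..b} q" by (rule DERIV_continuous_on[OF q])
  have qint: "integral {a..x} (\<lambda>t. H t (w t) - F t) = q x - ?\<Phi> x" if x: "x \<in> {a..b}" for x
  proof -
    have "((\<lambda>t. H t (w t)) has_integral q x - q a) {a..x}"
      using x by (intro fundamental_theorem_of_calculus)
        (auto simp: has_real_derivative_iff_has_vector_derivative[symmetric] intro!: DERIV_subset[OF q])
    then have "((\<lambda>t. H t (w t)) has_integral q x) {a..x}" using wq by (simp add: flow_def)
    from has_integral_diff[OF this integrable_integral[OF integral_eq_lebesgue_on(1)[OF F x]]]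
    show ?thesis by (rule integral_unique)
  qed
  have "neumann_sol a b A H F w (\<lambda>x. B x (q x - ?\<Phi> x))"
    unfolding neumann_sol_def
  proof (intro conjI ballI)
    show "continuous_on {a..b} (\<lambda>x. B x (q x - ?\<Phi> x))"
      by (intro continuous_on_B continuous_on_diff cq \<Phi>)
    show "integral {a..b} (\<lambda>t. H t (w t) - F t) = 0" using qint[of b] wq(2) ab by simp
    fix x assume x: "x \<in> {a..b}"
    show "(w has_real_derivative B x (q x - ?\<Phi> x)) (at x within {a..b})" by (rule w[OF x])
    show "A x (B x (q x - ?\<Phi> x)) = integral {a..x} (\<lambda>t. H t (w t) - F t)"
      by (simp add: inv[OF x] qint[OF x])
  qed
  then show ?thesis by blast
qed

lemma neumann_sol_stability:
  assumes 1: "neumann_sol a b A H F\<^sub>1 w\<^sub>1 w\<^sub>1'" and 2: "neumann_sol a b A H F\<^sub>2 w\<^sub>2 w\<^sub>2'"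
    and F: "integrable (lebesgue_on {a<..<b}) F\<^sub>1" "integrable (lebesgue_on {a<..<b}) F\<^sub>2"
    and x: "x \<in> {a..b}"
  defines "d \<equiv> (\<integral>x. \<bar>F\<^sub>1 x - F\<^sub>2 x\<bar> \<partial>lebesgue_on {a<..<b})"
  shows "\<bar>w\<^sub>1' x - w\<^sub>2' x\<bar> \<le> 2 / \<kappa> * d"
    "\<bar>w\<^sub>1 x - w\<^sub>2 x\<bar> \<le> (1 / ((b - a) * \<eta>) + 2 / \<kappa> * (b - a)) * d"
proof -
  let ?M = "lebesgue_on {a<..<b}"
  have d: "\<bar>integral {a..x} F\<^sub>1 - integral {a..x} F\<^sub>2\<bar> \<le> d" if x: "x \<in> {a..b}" for x
  proof -
    have [measurable]: "F\<^sub>1 \<in> borel_measurable ?M" "F\<^sub>2 \<in> borel_measurable ?M" using F by auto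
    have m: "indicat_real {..<x} \<in> borel_measurable ?M"
      by (intro measurable_restrict_space1) (simp add: measurable_completion)
    have i: "integrable ?M (\<lambda>y. indicat_real {..<x} y * F y)" if "integrable ?M F" for F
      by (rule integrable_mult_bounded(2)[OF that m, of 1]) (auto simp: indicator_def)
    have "integral {a..x} F\<^sub>1 - integral {a..x} F\<^sub>2
        = (\<integral>y. indicat_real {..<x} y * F\<^sub>1 y - indicat_real {..<x} y * F\<^sub>2 y \<partial>?M)"
      using integral_eq_lebesgue_on(2)[OF F(1) x] integral_eq_lebesgue_on(2)[OF F(2) x] i[OF F(1)] i[OF F(2)]
      by simp
    also have "\<bar>\<dots>\<bar> \<le> (\<integral>y. \<bar>indicat_real {..<x} y * F\<^sub>1 y - indicat_real {..<x} y * F\<^sub>2 y\<bar> \<partial>?M)"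
      by (rule integral_abs_bound)
    also have "\<dots> \<le> d" unfolding d_def
    proof (rule integral_mono)
      show "integrable ?M (\<lambda>y. \<bar>indicat_real {..<x} y * F\<^sub>1 y - indicat_real {..<x} y * F\<^sub>2 y\<bar>)"
        using i[OF F(1)] i[OF F(2)] by simp
      show "integrable ?M (\<lambda>y. \<bar>F\<^sub>1 y - F\<^sub>2 y\<bar>)" using F by simp
    qed (auto simp: indicator_def)
    finally show ?thesis .
  qed
  have lip: "\<bar>B t y - B t z\<bar> \<le> 1 / \<kappa> * \<bar>y - z\<bar>" if "t \<in> {a..b}" for t y z by (rule B_props(2)[OF that])
  note S = flow_stability[OF neumann_sol_imp_flow(1,2)[OF 1 F(1)] neumann_sol_imp_flow(1,2)[OF 2 F(2)]
      ab B_props(1) lip H \<eta> d x]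
  show "\<bar>w\<^sub>1' x - w\<^sub>2' x\<bar> \<le> 2 / \<kappa> * d"
    using S(1) neumann_sol_imp_flow(3)[OF 1 F(1) x] neumann_sol_imp_flow(3)[OF 2 F(2) x] by simp
  show "\<bar>w\<^sub>1 x - w\<^sub>2 x\<bar> \<le> (1 / ((b - a) * \<eta>) + 2 / \<kappa> * (b - a)) * d"
    using S(2) by simp
qed

lemma neumann_sol_weak:
  assumes sol: "neumann_sol a b A H F w w'" and F: "F \<in> L2 {a<..<b}" and z: "z \<in> H1 {a<..<b}"
  shows "L2_inner {a<..<b} (\<lambda>x. A x (w' x)) (dx {a<..<b} z) + L2_inner {a<..<b} (\<lambda>x. H x (w x)) z
    = L2_inner {a<..<b} F z"
proof -
  have HL2: "(\<lambda>x. H x (w x)) \<in> L2 {a<..<b}"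
    by (intro L2_continuous continuous_on_H neumann_solD(2)[OF sol])
  let ?\<sigma> = "\<lambda>x. H x (w x) - F x"
  have \<sigma>: "integrable (lebesgue_on {a<..<b}) ?\<sigma>" by (rule L2_integrable[OF L2_diff[OF HL2 F]])
  have "L2_inner {a<..<b} (\<lambda>x. A x (w' x)) (dx {a<..<b} z)
      = L2_inner {a<..<b} (\<lambda>x. integral {a..x} ?\<sigma>) (dx {a<..<b} z)"
    unfolding L2_inner_def using sol
    by (intro Bochner_Integration.integral_cong) (auto simp: space_restrict_space neumann_sol_def)
  also have "\<dots> = - L2_inner {a<..<b} ?\<sigma> z"
    using integration_by_parts_H1[OF z \<sigma> _ ab] sol by (simp add: neumann_sol_def)
  also have "L2_inner {a<..<b} ?\<sigma> z = L2_inner {a<..<b} (\<lambda>x. H x (w x)) z - L2_inner {a<..<b} F z"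
    unfolding L2_inner_def using L2_mult_integrable[OF HL2 H1_dx(1)[OF z]] L2_mult_integrable[OF F H1_dx(1)[OF z]]
    by (simp add: left_diff_distrib)
  finally show ?thesis by simp
qed

end

text \<open>Since \<open>h\<close> is Lipschitz on bounded sets only, it is replaced outside \<open>{-R..R}\<close> by an affine
  continuation with slope \<open>\<eta>\<close>. The stability estimate, applied to a solution of the truncated problem
  and to the zero function, gives a bound that is the same for all truncations. With this bound as
  \<open>R\<close>, the solution does not see the truncation.\<close>

lemma neumann_sol_exists_autonomous:
  assumes prob: "neumann_problem a b \<kappa> \<eta> (\<lambda>_. A) (\<lambda>_. B) (\<lambda>_. h)" and A0: "A 0 = 0"
    and h: "\<And>r. (h has_real_derivative h' r) (at r)" and h': "continuous_on UNIV h'"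
    and F: "integrable (lebesgue_on {a<..<b}) F"
  shows "\<exists>w w'. neumann_sol a b (\<lambda>_. A) (\<lambda>_. h) F w w'"
proof -
  interpret neumann_problem a b \<kappa> \<eta> "\<lambda>_. A" "\<lambda>_. B" "\<lambda>_. h" by (rule prob)
  interpret M: finite_measure "lebesgue_on {a<..<b}" by (rule lebesgue_on_interval_finite)
  have hm: "strongly_mono \<eta> h" using H[of a] ab by simp
  define d where "d = (\<integral>x. \<bar>F x - h 0\<bar> \<partial>lebesgue_on {a<..<b})"
  define R where "R = (1 / ((b - a) * \<eta>) + 2 / \<kappa> * (b - a)) * d"
  have "0 \<le> d" by (simp add: d_def)
  then have R: "R \<ge> 0" using ab \<eta> \<kappa> by (simp add: R_def)
  define c where "c r = max (- R) (min R r)" for r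
  have c: "\<bar>c r - c s\<bar> \<le> \<bar>r - s\<bar>" "c r \<in> {-R..R}" "s \<le> r \<Longrightarrow> c s \<le> c r" "r \<in> {-R..R} \<Longrightarrow> c r = r" for r s
    using R by (auto simp: c_def)
  define hR where "hR r = h (c r) + \<eta> * (r - c r)" for r
  have hcont: "continuous_on S h" for S
    using h DERIV_isCont by (intro continuous_at_imp_continuous_on) blast
  have hRm: "strongly_mono \<eta> hR"
    unfolding strongly_mono_def
  proof (intro allI impI)
    fix r s :: real assume "s \<le> r"
    then show "\<eta> * (r - s) \<le> hR r - hR s"
      using strongly_monoD(1)[OF hm, of "c s" "c r"] c(3)[of s r] by (simp add: hR_def algebra_simps)
  qed
  have "compact (h' ` {-R..R})"
    by (intro compact_continuous_image continuous_on_subset[OF h']) auto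
  then obtain K where K: "\<forall>r\<in>{-R..R}. \<bar>h' r\<bar> \<le> K"
    by (auto dest!: compact_imp_bounded simp: bounded_iff)
  have "\<bar>h r - h s\<bar> \<le> K * \<bar>r - s\<bar>" if "r \<in> {-R..R}" "s \<in> {-R..R}" for r s
    using field_differentiable_bound[of "{-R..R}" h h' K r s] that K h
    by (auto intro: has_field_derivative_at_within)
  then have hc: "\<bar>h (c r) - h (c s)\<bar> \<le> K * \<bar>r - s\<bar>" for r s
  proof -
    assume *: "\<And>r s. r \<in> {-R..R} \<Longrightarrow> s \<in> {-R..R} \<Longrightarrow> \<bar>h r - h s\<bar> \<le> K * \<bar>r - s\<bar>"
    have "K \<ge> 0" using K R abs_ge_zero order_trans by (metis atLeastAtMost_iff neg_le_0_iff_le)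
    then show ?thesis using *[OF c(2) c(2), of r s] mult_left_mono[OF c(1)[of r s], of K] by simp
  qed
  have hRlip: "\<bar>hR r - hR s\<bar> \<le> (K + 2 * \<eta>) * \<bar>r - s\<bar>" for r s
  proof -
    have "hR r - hR s = (h (c r) - h (c s)) + \<eta> * ((r - s) - (c r - c s))"
      by (simp add: hR_def algebra_simps)
    also have "\<bar>\<dots>\<bar> \<le> \<bar>h (c r) - h (c s)\<bar> + \<eta> * \<bar>(r - s) - (c r - c s)\<bar>"
      using abs_triangle_ineq[of "h (c r) - h (c s)" "\<eta> * ((r - s) - (c r - c s))"] \<eta> by (simp add: abs_mult)
    also have "\<dots> \<le> K * \<bar>r - s\<bar> + \<eta> * (2 * \<bar>r - s\<bar>)"
    proof (intro add_mono mult_left_mono hc)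
      show "\<bar>(r - s) - (c r - c s)\<bar> \<le> 2 * \<bar>r - s\<bar>"
        using c(1)[of r s] abs_triangle_ineq4[of "r - s" "c r - c s"] by simp
    qed (use \<eta> in auto)
    finally show ?thesis by (simp add: algebra_simps)
  qed
  have ccont: "continuous_on UNIV c" unfolding c_def by (intro continuous_intros)
  have hRcont: "continuous_on UNIV hR" unfolding hR_def
    by (intro continuous_intros ccont continuous_on_compose2[OF hcont ccont]) auto
  have "continuous_on ({a..b} \<times> UNIV) (\<lambda>x. hR (snd x))"
    by (rule continuous_on_compose2[OF hRcont]) (auto intro: continuous_intros)
  then interpret R: neumann_problem a b \<kappa> \<eta> "\<lambda>_. A" "\<lambda>_. B" "\<lambda>_. hR"
    using ab \<kappa> \<eta> A inv contB hRm by unfold_locales (auto simp: case_prod_beta)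
  obtain w w' where w: "neumann_sol a b (\<lambda>_. A) (\<lambda>_. hR) F w w'"
    using R.neumann_sol_exists[OF F hRlip] by blast
  have "c 0 = 0" using R by (simp add: c_def)
  then have hR0: "hR 0 = h 0" by (simp add: hR_def)
  \<comment> \<open>the zero function solves the problem with the constant right-hand side \<open>h 0\<close>\<close>
  have zero: "neumann_sol a b (\<lambda>_. A) (\<lambda>_. hR) (\<lambda>_. h 0) (\<lambda>_. 0) (\<lambda>_. 0)"
    by (auto simp: neumann_sol_def hR0 A0)
  have "\<bar>w x\<bar> \<le> R" if "x \<in> {a..b}" for x
    using R.neumann_sol_stability(2)[OF w zero F _ that] by (simp add: R_def d_def)
  then have "hR (w x) = h (w x)" if "x \<in> {a..b}" for x
    using c(4)[of "w x"] that by (auto simp: hR_def abs_le_iff minus_le_iff)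
  then have "integral {a..x} (\<lambda>t. hR (w t) - F t) = integral {a..x} (\<lambda>t. h (w t) - F t)" if "x \<le> b" for x
    using that by (intro Henstock_Kurzweil_Integration.integral_cong) auto
  then have "neumann_sol a b (\<lambda>_. A) (\<lambda>_. h) F w w'"
    using w by (auto simp: neumann_sol_def)
  then show ?thesis by blast
qed

section \<open>The state equation\<close>

lemma mono_imp_derivative_nonneg:
  fixes h :: "real \<Rightarrow> real"
  assumes "mono h" "(h has_real_derivative h') (at r)"
  shows "0 \<le> h'"
proof (rule ccontr)
  assume "\<not> 0 \<le> h'"
  then obtain d where d: "d > 0" "\<And>t. 0 < t \<Longrightarrow> t < d \<Longrightarrow> h (r + t) < h r"
    using DERIV_neg_dec_right[OF assms(2)] by auto
  then have "h (r + d / 2) < h r" by simp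
  moreover have "h r \<le> h (r + d / 2)" using assms(1) d(1) by (auto intro: monoD)
  ultimately show False by simp
qed

lemma derivative_ge_imp_strongly_mono:
  fixes h :: "real \<Rightarrow> real"
  assumes h: "\<And>r. (h has_real_derivative h' r) (at r)" and ge: "\<And>r. \<eta> \<le> h' r"
  shows "strongly_mono \<eta> h"
  unfolding strongly_mono_def
proof (intro allI impI)
  fix r s :: real assume "s \<le> r"
  have "h s - \<eta> * s \<le> h r - \<eta> * r"
  proof (rule DERIV_nonneg_imp_nondecreasing[OF \<open>s \<le> r\<close>])
    fix x
    show "\<exists>y. ((\<lambda>s. h s - \<eta> * s) has_real_derivative y) (at x) \<and> 0 \<le> y"
      using h[of x] ge[of x] by (intro exI[of _ "h' x - \<eta>"]) (auto intro!: derivative_eq_intros)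
  qed
  then show "\<eta> * (r - s) \<le> h r - h s" by (simp add: algebra_simps)
qed

lemma convex_above_tangent:
  fixes f :: "real \<Rightarrow> real"
  assumes "convex_on UNIV f" "(f has_real_derivative f') (at r)"
  shows "f r - f s \<le> f' * (r - s)"
  using convex_on_imp_above_tangent[OF assms(1) connected_UNIV, of r s f'] assms(2)
  by (simp add: algebra_simps)

lemma convex_derivative_mono:
  fixes f :: "real \<Rightarrow> real"
  assumes "convex_on UNIV f" "\<And>r. (f has_real_derivative f' r) (at r)"
  shows "mono f'"
proof (rule monoI, rule ccontr)
  fix r s :: real assume "r \<le> s" "\<not> f' r \<le> f' s"
  then have "r < s" by (metis less_eq_real_def)
  with \<open>\<not> f' r \<le> f' s\<close> have "(f' r - f' s) * (s - r) > 0" by simp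
  moreover have "f r - f s \<le> f' r * (r - s)" "f s - f r \<le> f' s * (s - r)"
    using convex_above_tangent[OF assms] by blast+
  ultimately show False by (simp add: algebra_simps)
qed

text \<open>The potentials for one fixed pair of parameters; \<open>kh\<close> is the potential of the constraint, and primes denote
  derivatives. The time step is so small that \<open>h\<close> below is strongly monotone.\<close>

locale allen_cahn =
  fixes a b \<tau> \<nu> C\<^sub>g M\<^sub>u :: real and f f' f'' kh k k' g g' :: "real \<Rightarrow> real"
  assumes ab: "a < b" and \<tau>: "0 < \<tau>" "C\<^sub>g < 1 / \<tau>" and \<nu>: "0 < \<nu>"
    and f: "convex_on UNIV f" "f 0 = 0" "\<And>r. 0 \<le> f r"
      "\<And>r. (f has_real_derivative f' r) (at r)" "\<And>r. (f' has_real_derivative f'' r) (at r)"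
      "continuous_on UNIV f''"
    and kh: "\<And>r. 0 \<le> kh r" "\<And>r. (kh has_real_derivative k r) (at r)"
      "\<And>r. (k has_real_derivative k' r) (at r)" "\<And>r. 0 \<le> k' r" "continuous_on UNIV k'"
    and g: "\<And>r. (g has_real_derivative g' r) (at r)" "\<And>r. - C\<^sub>g \<le> g' r" "continuous_on UNIV g'"
begin

abbreviation \<Omega> where "\<Omega> \<equiv> {a<..<b}"
abbreviation \<mu> where "\<mu> \<equiv> lebesgue_on {a<..<b}"

definition A where "A r = f' r + \<nu>\<^sup>2 * r"
definition h where "h r = r / \<tau> + k r + g r"
definition h' where "h' r = 1 / \<tau> + k' r + g' r"
definition \<eta> where "\<eta> = 1 / \<tau> - C\<^sub>g"

lemma \<eta>_pos: "\<eta> > 0" using \<tau> by (simp add: \<eta>_def)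

lemma h_derivative: "(h has_real_derivative h' r) (at r)"
  unfolding h_def[abs_def] h'_def using kh(3)[of r] g(1)[of r] \<tau>(1) by (auto intro!: derivative_eq_intros)

lemma h'_ge: "\<eta> \<le> h' r"
  unfolding \<eta>_def h'_def using kh(4)[of r] g(2)[of r] by simp

lemma h'_continuous: "continuous_on S h'"
  unfolding h'_def[abs_def]
  by (intro continuous_intros continuous_on_subset[OF kh(5)] continuous_on_subset[OF g(3)]) auto

lemma h_strongly_mono: "strongly_mono \<eta> h"
  by (rule derivative_ge_imp_strongly_mono[OF h_derivative h'_ge])

lemma f''_nonneg: "0 \<le> f'' r"
  by (rule mono_imp_derivative_nonneg[OF convex_derivative_mono[OF f(1,4)] f(5)])

lemma A_derivative: "(A has_real_derivative f'' r + \<nu>\<^sup>2) (at r)"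
  unfolding A_def[abs_def] using f(5)[of r] by (auto intro!: derivative_eq_intros)

lemma A_strongly_mono: "strongly_mono (\<nu>\<^sup>2) A"
  using f''_nonneg by (intro derivative_ge_imp_strongly_mono[OF A_derivative]) simp

lemma A_0: "A 0 = 0"
proof -
  have "f' 0 = 0"
    by (rule DERIV_local_min[OF f(4), of 1]) (use f in auto)
  then show ?thesis by (simp add: A_def)
qed

lemma continuous_on_derivative:
  fixes \<phi> :: "real \<Rightarrow> real"
  assumes "\<And>r. (\<phi> has_real_derivative \<phi>' r) (at r)" shows "continuous_on S \<phi>"
  using assms by (intro continuous_at_imp_continuous_on ballI DERIV_isCont[of \<phi>])

lemmas continuous = continuous_on_derivative[OF f(4)] continuous_on_derivative[OF f(5)]
  continuous_on_derivative[OF kh(2)] continuous_on_derivative[OF kh(3)] continuous_on_derivative[OF g(1)]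
  continuous_on_derivative[OF h_derivative] continuous_on_derivative[OF A_derivative]

text \<open>Coercivity, from strong monotonicity and \<open>A 0 = 0\<close>, and the intermediate value theorem.\<close>

lemma A_surj: "A (inv A s) = s"
proof (rule f_inv_into_f)
  have "\<nu>\<^sup>2 > 0" using \<nu> by simp
  define r where "r = \<bar>s\<bar> / \<nu>\<^sup>2"
  have r: "r \<ge> 0" "\<nu>\<^sup>2 * r = \<bar>s\<bar>" using \<nu> by (auto simp: r_def)
  have "A (- r) \<le> s" "s \<le> A r"
    using strongly_monoD(1)[OF A_strongly_mono, of "- r" 0] strongly_monoD(1)[OF A_strongly_mono, of 0 r] r A_0
    by auto
  then obtain t where "A t = s" using IVT'[of A "- r" s r] r(1) continuous(7) by auto
  then show "s \<in> range A" by auto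
qed

sublocale neumann_problem a b "\<nu>\<^sup>2" \<eta> "\<lambda>_. A" "\<lambda>_. inv A" "\<lambda>_. h"
proof
  note inverse = strongly_mono_inverse[OF A_strongly_mono _ A_surj]
  have "continuous_on UNIV (inv A)"
  proof (rule continuous_on_iff[THEN iffD2], intro ballI allI impI)
    fix s e :: real assume "e > 0"
    then show "\<exists>d>0. \<forall>t\<in>UNIV. dist t s < d \<longrightarrow> dist (inv A t) (inv A s) < e"
      using \<nu> by (intro exI[of _ "e * \<nu>\<^sup>2"] conjI ballI impI)
         (auto simp: dist_real_def field_simps intro: le_less_trans[OF inverse(2)])
  qed
  then have "continuous_on ({a..b} \<times> UNIV) (\<lambda>x. inv A (snd x))"
    by (rule continuous_on_compose2) (auto intro: continuous_intros)
  then show "continuous_on ({a..b} \<times> UNIV) (\<lambda>(t, y). inv A y)" by (simp add: case_prod_beta)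
  have "continuous_on ({a..b} \<times> UNIV) (\<lambda>x. h (snd x))"
    by (rule continuous_on_compose2[OF continuous(6)[of UNIV]]) (auto intro: continuous_intros)
  then show "continuous_on ({a..b} \<times> UNIV) (\<lambda>(t, y). h y)" by (simp add: case_prod_beta)
qed (use ab \<nu> \<eta>_pos A_strongly_mono h_strongly_mono A_surj in auto)

definition step :: "(real \<Rightarrow> real) \<Rightarrow> (real \<Rightarrow> real) \<Rightarrow> (real \<Rightarrow> real) \<Rightarrow> (real \<Rightarrow> real) \<Rightarrow> bool" where
  "step p u w w' \<longleftrightarrow> neumann_sol a b (\<lambda>_. A) (\<lambda>_. h) (\<lambda>x. p x / \<tau> + M\<^sub>u * u x) w w'"

lemma step_rhs_L2: "p \<in> L2 \<Omega> \<Longrightarrow> u \<in> L2 \<Omega> \<Longrightarrow> (\<lambda>x. p x / \<tau> + M\<^sub>u * u x) \<in> L2 \<Omega>"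
  using L2_add[OF L2_cmult[of p \<Omega> "1 / \<tau>"] L2_cmult[of u \<Omega> M\<^sub>u]] by simp

lemma step_exists:
  assumes "p \<in> L2 \<Omega>" "u \<in> L2 \<Omega>"
  shows "\<exists>w w'. step p u w w'"
  unfolding step_def
  by (rule neumann_sol_exists_autonomous[OF neumann_problem_axioms A_0 h_derivative h'_continuous
        L2_integrable[OF step_rhs_L2[OF assms]]])

lemma step_H1:
  assumes "step p u w w'"
  shows "w \<in> H1 \<Omega>" "AE x in \<mu>. dx \<Omega> w x = w' x" "continuous_on {a..b} w" "continuous_on {a..b} w'"
proof -
  note s = neumann_solD[OF assms[unfolded step_def]]
  show "w \<in> H1 \<Omega>" "AE x in \<mu>. dx \<Omega> w x = w' x" "continuous_on {a..b} w" "continuous_on {a..b} w'"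
    using C1_H1[OF s(3) s(1) ab] s(1,2) by auto
qed

abbreviation \<Psi> where "\<Psi> \<equiv> Psi \<Omega> \<nu> f (\<lambda>r. ereal (kh r))"

text \<open>The finite value of \<open>\<Psi>\<close> on its effective domain, as a real number.\<close>

definition \<psi> where "\<psi> z = (\<integral>x. f (dx \<Omega> z x) \<partial>\<mu>) + \<nu>\<^sup>2 / 2 * (\<integral>x. (dx \<Omega> z x)\<^sup>2 \<partial>\<mu>) + (\<integral>x. kh (z x) \<partial>\<mu>)"

lemma Psi_eq:
  assumes "z \<in> H1 \<Omega>" "integrable \<mu> (\<lambda>x. f (dx \<Omega> z x))" "integrable \<mu> (\<lambda>x. kh (z x))"
  shows "\<Psi> z = ereal (\<psi> z)"
  using assms f(3) kh(1)
  by (simp add: Psi_def \<psi>_def nn_integral_eq_integral enn2ereal_ennreal e2ennreal_ereal)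

lemma eff_dom_Psi:
  "z \<in> eff_dom \<Psi> \<longleftrightarrow> z \<in> H1 \<Omega> \<and> integrable \<mu> (\<lambda>x. f (dx \<Omega> z x)) \<and> integrable \<mu> (\<lambda>x. kh (z x))"
proof
  assume "z \<in> eff_dom \<Psi>"
  then have fin: "\<Psi> z < \<infinity>" by (simp add: eff_dom_def)
  then have z: "z \<in> H1 \<Omega>" by (auto simp: Psi_def split: if_splits)
  have m: "(\<lambda>x. f (dx \<Omega> z x)) \<in> borel_measurable \<mu>" "(\<lambda>x. kh (z x)) \<in> borel_measurable \<mu>"
    by (rule borel_measurable_continuous_on[OF continuous(1) L2D(1)[OF H1_dx(2)[OF z]]],
        rule borel_measurable_continuous_on[OF continuous(3) L2D(1)[OF H1_dx(1)[OF z]]])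
  have "(\<integral>\<^sup>+x. ennreal (f (dx \<Omega> z x)) \<partial>\<mu>) < \<infinity>" "(\<integral>\<^sup>+x. ennreal (kh (z x)) \<partial>\<mu>) < \<infinity>"
    using fin z by (auto simp: Psi_def less_top[symmetric] e2ennreal_ereal top_ennreal.rep_eq[symmetric])
  then show "z \<in> H1 \<Omega> \<and> integrable \<mu> (\<lambda>x. f (dx \<Omega> z x)) \<and> integrable \<mu> (\<lambda>x. kh (z x))"
    using z m f(3) kh(1) by (auto intro!: integrableI_nonneg)
next
  assume "z \<in> H1 \<Omega> \<and> integrable \<mu> (\<lambda>x. f (dx \<Omega> z x)) \<and> integrable \<mu> (\<lambda>x. kh (z x))"
  then have "\<Psi> z = ereal (\<psi> z)" by (intro Psi_eq) auto
  then show "z \<in> eff_dom \<Psi>" by (simp add: eff_dom_def)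
qed

lemma step_eff_dom:
  assumes s: "step p u w w'" shows "w \<in> eff_dom \<Psi>"
proof -
  note w = step_H1[OF s]
  have c: "continuous_on {a..b} (\<lambda>x. f (w' x))" "continuous_on {a..b} (\<lambda>x. kh (w x))"
    by (auto intro: continuous_on_compose2[OF continuous(1)[of UNIV] w(4)]
        continuous_on_compose2[OF continuous(3)[of UNIV] w(3)])
  have "integrable \<mu> (\<lambda>x. f (dx \<Omega> w x))"
  proof (rule integrable_cong_AE_imp[OF continuous_on_imp_lebesgue_on(3)[OF c(1)]])
    show "(\<lambda>x. f (dx \<Omega> w x)) \<in> borel_measurable \<mu>"
      by (rule borel_measurable_continuous_on[OF continuous(1) L2D(1)[OF H1_dx(2)[OF w(1)]]])
    show "AE x in \<mu>. f (w' x) = f (dx \<Omega> w x)" using w(2) by eventually_elim simp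
  qed
  with w(1) continuous_on_imp_lebesgue_on(3)[OF c(2)] show ?thesis by (simp add: eff_dom_Psi)
qed

text \<open>One time step of \<open>state_solution\<close>, with the previous state as a parameter.\<close>

definition variational :: "(real \<Rightarrow> real) \<Rightarrow> (real \<Rightarrow> real) \<Rightarrow> (real \<Rightarrow> real) \<Rightarrow> bool" where
  "variational p u w \<longleftrightarrow> w \<in> eff_dom \<Psi> \<and> (\<forall>z\<in>eff_dom \<Psi>.
     ereal (1 / \<tau> * L2_inner \<Omega> (\<lambda>x. w x - p x) (\<lambda>x. w x - z x)
       + L2_inner \<Omega> (\<lambda>x. g (w x) - M\<^sub>u * u x) (\<lambda>x. w x - z x)) + \<Psi> w - \<Psi> z \<le> 0)"

text \<open>By convexity, \<open>\<psi> w - \<psi> z\<close> is at most the first variation at \<open>w\<close> in direction \<open>w - z\<close>, and the weak form of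
  the equation evaluates that variation.\<close>

lemma step_variational:
  assumes s: "step p u w w'" and p: "p \<in> L2 \<Omega>" and u: "u \<in> L2 \<Omega>"
  shows "variational p u w"
  unfolding variational_def
proof (intro conjI ballI)
  show wD: "w \<in> eff_dom \<Psi>" by (rule step_eff_dom[OF s])
  fix z assume zD: "z \<in> eff_dom \<Psi>"
  note w = step_H1[OF s]
  have z: "z \<in> H1 \<Omega>" and zi: "integrable \<mu> (\<lambda>x. f (dx \<Omega> z x))" "integrable \<mu> (\<lambda>x. kh (z x))"
    using zD by (auto simp: eff_dom_Psi)
  have wi: "integrable \<mu> (\<lambda>x. f (dx \<Omega> w x))" "integrable \<mu> (\<lambda>x. kh (w x))"
    using wD by (auto simp: eff_dom_Psi)
  note dw = H1_dx[OF w(1)] and dz = H1_dx[OF z]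
  define D where "D x = w x - z x" for x
  have D: "D \<in> H1 \<Omega>" "AE x in \<mu>. dx \<Omega> D x = dx \<Omega> w x - dx \<Omega> z x"
    unfolding D_def[abs_def] by (rule H1_diff[OF w(1) z ab])+
  have cL2: "(\<lambda>x. \<phi> (w x)) \<in> L2 \<Omega>" "(\<lambda>x. \<phi> (w' x)) \<in> L2 \<Omega>" if "continuous_on UNIV \<phi>" for \<phi> :: "real \<Rightarrow> real"
    by (intro L2_continuous[OF continuous_on_compose2[OF that w(3)]] subset_UNIV,
        intro L2_continuous[OF continuous_on_compose2[OF that w(4)]] subset_UNIV)
  note [simp] = L2_mult_integrable[OF _ H1_dx(1)[OF D(1)]] L2_mult_integrable[OF _ H1_dx(2)[OF D(1)]]
  have weak: "(\<integral>x. A (w' x) * dx \<Omega> D x \<partial>\<mu>) + (\<integral>x. h (w x) * D x \<partial>\<mu>) = (\<integral>x. (p x / \<tau> + M\<^sub>u * u x) * D x \<partial>\<mu>)"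
    using neumann_sol_weak[OF s[unfolded step_def] step_rhs_L2[OF p u] D(1)] by (simp add: L2_inner_def)
  have int: "integrable \<mu> (\<lambda>x. A (w' x) * dx \<Omega> D x)" "integrable \<mu> (\<lambda>x. k (w x) * D x)"
    "integrable \<mu> (\<lambda>x. h (w x) * D x)" "integrable \<mu> (\<lambda>x. g (w x) * D x)"
    "integrable \<mu> (\<lambda>x. (p x / \<tau> + M\<^sub>u * u x) * D x)" "integrable \<mu> (\<lambda>x. (w x - p x) * D x)"
    "integrable \<mu> (\<lambda>x. (g (w x) - M\<^sub>u * u x) * D x)"
    by (simp_all add: cL2 continuous step_rhs_L2 p u L2_diff L2_cmult dw)
  have "\<psi> w - \<psi> z = (\<integral>x. (f (dx \<Omega> w x) - f (dx \<Omega> z x)) + \<nu>\<^sup>2 / 2 * ((dx \<Omega> w x)\<^sup>2 - (dx \<Omega> z x)\<^sup>2)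
      + (kh (w x) - kh (z x)) \<partial>\<mu>)"
    using wi zi L2D(2)[OF dw(2)] L2D(2)[OF dz(2)] by (simp add: \<psi>_def algebra_simps)
  also have "\<dots> \<le> (\<integral>x. A (w' x) * dx \<Omega> D x + k (w x) * D x \<partial>\<mu>)"
  proof (rule integral_mono_AE)
    show "integrable \<mu> (\<lambda>x. (f (dx \<Omega> w x) - f (dx \<Omega> z x)) + \<nu>\<^sup>2 / 2 * ((dx \<Omega> w x)\<^sup>2 - (dx \<Omega> z x)\<^sup>2)
      + (kh (w x) - kh (z x)))"
      using wi zi L2D(2)[OF dw(2)] L2D(2)[OF dz(2)] by simp
    show "integrable \<mu> (\<lambda>x. A (w' x) * dx \<Omega> D x + k (w x) * D x)" using int by simp
    have kconv: "convex_on UNIV kh"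
      by (rule f''_ge0_imp_convex[OF _ kh(2) kh(3) kh(4)]) simp
    show "AE x in \<mu>. (f (dx \<Omega> w x) - f (dx \<Omega> z x)) + \<nu>\<^sup>2 / 2 * ((dx \<Omega> w x)\<^sup>2 - (dx \<Omega> z x)\<^sup>2)
      + (kh (w x) - kh (z x)) \<le> A (w' x) * dx \<Omega> D x + k (w x) * D x"
      using w(2) D(2)
    proof eventually_elim
      case (elim x)
      let ?q = "dx \<Omega> z x"
      have "f (w' x) - f ?q \<le> f' (w' x) * (w' x - ?q)" by (rule convex_above_tangent[OF f(1,4)])
      moreover have "kh (w x) - kh (z x) \<le> k (w x) * D x"
        unfolding D_def by (rule convex_above_tangent[OF kconv kh(2)])
      moreover have "\<nu>\<^sup>2 / 2 * ((w' x)\<^sup>2 - ?q\<^sup>2) \<le> \<nu>\<^sup>2 * w' x * (w' x - ?q)"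
      proof -
        have "0 \<le> \<nu>\<^sup>2 / 2 * (w' x - ?q)\<^sup>2" by simp
        then show ?thesis by (simp add: power2_eq_square algebra_simps)
      qed
      moreover have dD: "dx \<Omega> D x = w' x - ?q" using elim by simp
      ultimately show ?case unfolding elim(1) dD by (simp add: A_def algebra_simps)
    qed
  qed
  also have "\<dots> = (\<integral>x. A (w' x) * dx \<Omega> D x \<partial>\<mu>) + (\<integral>x. k (w x) * D x \<partial>\<mu>)" using int by simp
  also have "\<dots> = (\<integral>x. (p x / \<tau> + M\<^sub>u * u x) * D x \<partial>\<mu>) - (\<integral>x. h (w x) * D x \<partial>\<mu>) + (\<integral>x. k (w x) * D x \<partial>\<mu>)"
    using weak by simp
  also have "\<dots> = (\<integral>x. (p x / \<tau> + M\<^sub>u * u x) * D x - h (w x) * D x + k (w x) * D x \<partial>\<mu>)" using int by simp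
  also have "\<dots> = (\<integral>x. - (1 / \<tau> * ((w x - p x) * D x)) - (g (w x) - M\<^sub>u * u x) * D x \<partial>\<mu>)"
  proof (rule Bochner_Integration.integral_cong[OF refl])
    fix x
    have "(w x - p x) / \<tau> = w x / \<tau> - p x / \<tau>" by (rule diff_divide_distrib)
    then show "(p x / \<tau> + M\<^sub>u * u x) * D x - h (w x) * D x + k (w x) * D x
        = - (1 / \<tau> * ((w x - p x) * D x)) - (g (w x) - M\<^sub>u * u x) * D x"
      unfolding h_def times_divide_eq_left[symmetric] mult.assoc[symmetric] by (simp add: algebra_simps)
  qed
  also have "\<dots> = - (1 / \<tau> * (\<integral>x. (w x - p x) * D x \<partial>\<mu>)) - (\<integral>x. (g (w x) - M\<^sub>u * u x) * D x \<partial>\<mu>)"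
    using int by simp
  finally show "ereal (1 / \<tau> * L2_inner \<Omega> (\<lambda>x. w x - p x) (\<lambda>x. w x - z x)
       + L2_inner \<Omega> (\<lambda>x. g (w x) - M\<^sub>u * u x) (\<lambda>x. w x - z x)) + \<Psi> w - \<Psi> z \<le> 0"
    by (simp add: Psi_eq[OF w(1) wi] Psi_eq[OF z zi] L2_inner_def D_def zero_ereal_def)
qed

lemma comp_bounded:
  fixes \<phi> :: "real \<Rightarrow> real"
  assumes z: "z \<in> H1 \<Omega>" and \<phi>: "continuous_on UNIV \<phi>"
  shows "\<exists>B. AE x in \<mu>. \<bar>\<phi> (z x)\<bar> \<le> B" "(\<lambda>x. \<phi> (z x)) \<in> borel_measurable \<mu>" "(\<lambda>x. \<phi> (z x)) \<in> L2 \<Omega>"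
proof -
  obtain R where R: "AE x in \<mu>. \<bar>z x\<bar> \<le> R" using H1_bounded[OF z ab] by blast
  have "compact (\<phi> ` {-R..R})" by (intro compact_continuous_image continuous_on_subset[OF \<phi>]) auto
  then obtain B where B: "\<forall>r\<in>{-R..R}. \<bar>\<phi> r\<bar> \<le> B" by (auto dest!: compact_imp_bounded simp: bounded_iff)
  have AE: "AE x in \<mu>. \<bar>\<phi> (z x)\<bar> \<le> B" using R by eventually_elim (use B in \<open>auto simp: abs_le_iff\<close>)
  then show "\<exists>B. AE x in \<mu>. \<bar>\<phi> (z x)\<bar> \<le> B" by blast
  show m: "(\<lambda>x. \<phi> (z x)) \<in> borel_measurable \<mu>"
    by (rule borel_measurable_continuous_on[OF \<phi> L2D(1)[OF H1_dx(1)[OF z]]])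
  show "(\<lambda>x. \<phi> (z x)) \<in> L2 \<Omega>" by (rule L2_bounded[OF m AE])
qed

text \<open>Test the inequality of each solution with the other one and add: the functionals cancel, and the
  remaining terms dominate \<open>\<eta>\<close> times the squared distance.\<close>

lemma variational_unique:
  assumes y: "variational p\<^sub>1 u y" and w: "variational p\<^sub>2 u w" and p: "p\<^sub>1 \<in> L2 \<Omega>" "p\<^sub>2 \<in> L2 \<Omega>"
    and eq: "AE x in \<mu>. p\<^sub>1 x = p\<^sub>2 x" and u: "u \<in> L2 \<Omega>"
  shows "AE x in \<mu>. y x = w x"
proof -
  have yD: "y \<in> eff_dom \<Psi>" and wD: "w \<in> eff_dom \<Psi>" using y w by (auto simp: variational_def)
  then have y1: "y \<in> H1 \<Omega>" "\<Psi> y = ereal (\<psi> y)" and w1: "w \<in> H1 \<Omega>" "\<Psi> w = ereal (\<psi> w)"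
    by (auto simp: eff_dom_Psi Psi_eq)
  define D where "D x = y x - w x" for x
  have D: "D \<in> L2 \<Omega>" unfolding D_def[abs_def] by (intro L2_diff H1_dx y1 w1)
  note gy = comp_bounded(3)[OF y1(1) continuous(5)] and gw = comp_bounded(3)[OF w1(1) continuous(5)]
  note [simp] = L2_mult_integrable[OF _ D]
  note L2s = L2_diff L2_cmult gy gw H1_dx[OF y1(1)] H1_dx[OF w1(1)] p u
  have int: "integrable \<mu> (\<lambda>x. (y x - p\<^sub>1 x) * D x)" "integrable \<mu> (\<lambda>x. (w x - p\<^sub>2 x) * D x)"
    "integrable \<mu> (\<lambda>x. (g (y x) - M\<^sub>u * u x) * D x)" "integrable \<mu> (\<lambda>x. (g (w x) - M\<^sub>u * u x) * D x)"
    "integrable \<mu> (\<lambda>x. \<eta> * (D x)\<^sup>2)"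
    using L2D(2)[OF D] by (simp_all add: L2s)
  have flip: "(\<integral>x. \<phi> x * (w x - y x) \<partial>\<mu>) = - (\<integral>x. \<phi> x * D x \<partial>\<mu>)" for \<phi> :: "real \<Rightarrow> real"
    by (simp add: D_def algebra_simps flip: Bochner_Integration.integral_minus)
  have 1: "1 / \<tau> * (\<integral>x. (y x - p\<^sub>1 x) * D x \<partial>\<mu>) + (\<integral>x. (g (y x) - M\<^sub>u * u x) * D x \<partial>\<mu>) + \<psi> y - \<psi> w \<le> 0"
    using y wD by (auto simp: variational_def y1 w1 L2_inner_def D_def zero_ereal_def)
  have 2: "- (1 / \<tau> * (\<integral>x. (w x - p\<^sub>2 x) * D x \<partial>\<mu>)) - (\<integral>x. (g (w x) - M\<^sub>u * u x) * D x \<partial>\<mu>) + \<psi> w - \<psi> y \<le> 0"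
    using w[unfolded variational_def, THEN conjunct2, rule_format, OF yD]
    by (simp add: y1 w1 L2_inner_def zero_ereal_def flip)
  have "(\<integral>x. \<eta> * (D x)\<^sup>2 \<partial>\<mu>) \<le> (\<integral>x. 1 / \<tau> * ((y x - p\<^sub>1 x) * D x) + (g (y x) - M\<^sub>u * u x) * D x
      - 1 / \<tau> * ((w x - p\<^sub>2 x) * D x) - (g (w x) - M\<^sub>u * u x) * D x \<partial>\<mu>)"
  proof (rule integral_mono_AE)
    show "AE x in \<mu>. \<eta> * (D x)\<^sup>2 \<le> 1 / \<tau> * ((y x - p\<^sub>1 x) * D x) + (g (y x) - M\<^sub>u * u x) * D x
      - 1 / \<tau> * ((w x - p\<^sub>2 x) * D x) - (g (w x) - M\<^sub>u * u x) * D x"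
      using eq
    proof eventually_elim
      case (elim x)
      have "- C\<^sub>g * (D x)\<^sup>2 \<le> (g (y x) - g (w x)) * D x"
        using strongly_monoD(2)[OF derivative_ge_imp_strongly_mono[OF g(1,2)], of "y x" "w x"]
        by (simp add: D_def)
      then show ?case using elim by (simp add: \<eta>_def D_def power2_eq_square diff_divide_distrib algebra_simps)
    qed
  qed (use int in simp_all)
  also have "\<dots> \<le> 0" using 1 2 int by simp
  finally have "(\<integral>x. \<eta> * (D x)\<^sup>2 \<partial>\<mu>) \<le> 0" .
  moreover have "0 \<le> (\<integral>x. \<eta> * (D x)\<^sup>2 \<partial>\<mu>)" using \<eta>_pos by simp
  ultimately have "(\<integral>x. \<eta> * (D x)\<^sup>2 \<partial>\<mu>) = 0" by simp
  then have "AE x in \<mu>. \<eta> * (D x)\<^sup>2 = 0"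
    using integral_nonneg_eq_0_iff_AE[OF int(5)] \<eta>_pos by simp
  then show ?thesis using \<eta>_pos by (simp add: D_def)
qed

end

lemma L2_continuous_mult:
  assumes "continuous_on {a..b} c" "z \<in> L2 {a<..<b}"
  shows "(\<lambda>x. c x * z x) \<in> L2 {a<..<b}"
proof -
  obtain B where "\<forall>x\<in>{a..b}. \<bar>c x\<bar> \<le> B" using continuous_on_imp_lebesgue_on(2)[OF assms(1)] by blast
  then show ?thesis
    by (intro L2_bounded_mult[OF assms(2) continuous_on_imp_lebesgue_on(1)[OF assms(1)], of B] AE_I2)
       (auto simp: space_restrict_space)
qed

context allen_cahn
begin

section \<open>The time-discrete state and the cost\<close>

definition steps :: "nat \<Rightarrow> (real \<Rightarrow> real) \<Rightarrow> (nat \<Rightarrow> real \<Rightarrow> real) \<Rightarrow> (nat \<Rightarrow> real \<Rightarrow> real)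
    \<Rightarrow> (nat \<Rightarrow> real \<Rightarrow> real) \<Rightarrow> bool" where
  "steps n w\<^sub>0 u W W' \<longleftrightarrow> W 0 = w\<^sub>0 \<and> (\<forall>i\<in>{1..n}. step (W (i - 1)) (u i) (W i) (W' i))"

lemma steps_exists:
  assumes "w\<^sub>0 \<in> L2 \<Omega>" "u \<in> L2_tuples \<Omega> n"
  shows "\<exists>W W'. steps n w\<^sub>0 u W W'"
  using assms(2)
proof (induction n)
  case 0
  then show ?case by (auto simp: steps_def)
next
  case (Suc n)
  then obtain W W' where W: "steps n w\<^sub>0 u W W'" by (auto simp: L2_tuples_def)
  have "W n \<in> L2 \<Omega>"
  proof (cases "n = 0")
    case True then show ?thesis using W assms(1) by (simp add: steps_def)
  next
    case False
    then have "step (W (n - 1)) (u n) (W n) (W' n)" using W by (simp add: steps_def)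
    then show ?thesis by (intro H1_dx(1) step_H1(1))
  qed
  moreover have "u (Suc n) \<in> L2 \<Omega>" using Suc.prems by (simp add: L2_tuples_def)
  ultimately obtain z z' where z: "step (W n) (u (Suc n)) z z'" using step_exists by blast
  have "steps (Suc n) w\<^sub>0 u (W(Suc n := z)) (W'(Suc n := z'))"
    using W z by (auto simp: steps_def le_Suc_eq)
  then show ?case by blast
qed

lemma stepsD:
  assumes "steps n w\<^sub>0 u W W'" and "i \<in> {1..n}"
  shows "step (W (i - 1)) (u i) (W i) (W' i)" "W i \<in> H1 \<Omega>" "AE x in \<mu>. dx \<Omega> (W i) x = W' i x"
    "continuous_on {a..b} (W i)" "continuous_on {a..b} (W' i)"
    "x \<in> {a..b} \<Longrightarrow> (W i has_real_derivative W' i x) (at x within {a..b})"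
proof -
  show s: "step (W (i - 1)) (u i) (W i) (W' i)" using assms by (simp add: steps_def)
  show "W i \<in> H1 \<Omega>" "AE x in \<mu>. dx \<Omega> (W i) x = W' i x"
    "continuous_on {a..b} (W i)" "continuous_on {a..b} (W' i)"
    by (rule step_H1[OF s])+
  show "x \<in> {a..b} \<Longrightarrow> (W i has_real_derivative W' i x) (at x within {a..b})"
    using neumann_solD(3)[OF s[unfolded step_def]] .
qed

lemma steps_L2:
  assumes "steps n w\<^sub>0 u W W'" "w\<^sub>0 \<in> L2 \<Omega>" "i \<le> n" shows "W i \<in> L2 \<Omega>"
proof (cases "i = 0")
  case True then show ?thesis using assms by (simp add: steps_def)
next
  case False
  then show ?thesis using H1_dx(1)[OF stepsD(2)[OF assms(1)]] assms(3) by simp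
qed

abbreviation solution where
  "solution n w\<^sub>0 u w \<equiv> state_solution \<Omega> n \<tau> \<nu> M\<^sub>u f (\<lambda>r. ereal (kh r)) g w\<^sub>0 u w"

lemma solution_iff:
  "solution n w\<^sub>0 u w \<longleftrightarrow> (\<forall>i\<in>{1..n}. variational ((w(0 := w\<^sub>0)) (i - 1)) (u i) (w i))"
  by (simp only: state_solution_def variational_def)

lemma steps_solution:
  assumes "steps n w\<^sub>0 u W W'" "w\<^sub>0 \<in> L2 \<Omega>" "u \<in> L2_tuples \<Omega> n"
  shows "solution n w\<^sub>0 u W"
  unfolding solution_iff
proof
  fix i assume i: "i \<in> {1..n}"
  have "W(0 := w\<^sub>0) = W" using assms(1) by (auto simp: steps_def)
  moreover have "variational (W (i - 1)) (u i) (W i)"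
    by (rule step_variational[OF stepsD(1)[OF assms(1) i] steps_L2[OF assms(1,2)]])
       (use i assms(3) in \<open>auto simp: L2_tuples_def\<close>)
  ultimately show "variational ((W(0 := w\<^sub>0)) (i - 1)) (u i) (W i)" by simp
qed

text \<open>Not only the states but also their derivatives are identified, since the coefficients of the adjoint
  system contain both.\<close>

lemma solution_unique:
  assumes w: "solution n w\<^sub>0 u w" and W: "steps n w\<^sub>0 u W W'" and w\<^sub>0: "w\<^sub>0 \<in> L2 \<Omega>" and u: "u \<in> L2_tuples \<Omega> n"
  shows "i \<in> {1..n} \<Longrightarrow> w i \<in> H1 \<Omega> \<and> (AE x in \<mu>. w i x = W i x) \<and> (AE x in \<mu>. dx \<Omega> (w i) x = W' i x)"
proof -
  have wH1: "w i \<in> H1 \<Omega>" if "i \<in> {1..n}" for i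
    using w that by (auto simp: solution_iff variational_def eff_dom_Psi)
  let ?w = "w(0 := w\<^sub>0)"
  have wL2: "?w i \<in> L2 \<Omega>" if "i \<le> n" for i
    using wH1[of i] w\<^sub>0 that H1_dx(1) by auto
  have W0: "W(0 := w\<^sub>0) = W" using W by (auto simp: steps_def)
  have AE: "AE x in \<mu>. ?w i x = W i x" if "i \<le> n" for i
    using that
  proof (induction i)
    case 0
    then show ?case using W by (simp add: steps_def)
  next
    case (Suc i)
    then have i: "Suc i \<in> {1..n}" "i \<le> n" by auto
    have "variational (?w i) (u (Suc i)) (w (Suc i))" "variational (W i) (u (Suc i)) (W (Suc i))"
      using w steps_solution[OF W w\<^sub>0 u] i(1) W0 unfolding solution_iff by force+
    from variational_unique[OF this wL2 steps_L2[OF W w\<^sub>0]]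
    have "AE x in \<mu>. w (Suc i) x = W (Suc i) x" using i Suc u by (auto simp: L2_tuples_def)
    then show ?case by simp
  qed
  assume i: "i \<in> {1..n}"
  have eq: "AE x in \<mu>. w i x = W i x" using AE[of i] i by simp
  note d = H1_AE_cong[OF stepsD(2)[OF W i] L2D(1)[OF H1_dx(1)[OF wH1[OF i]]] ab eq]
  have "AE x in \<mu>. dx \<Omega> (w i) x = W' i x"
    using d(2) stepsD(3)[OF W i] by eventually_elim simp
  with eq wH1[OF i] show "w i \<in> H1 \<Omega> \<and> (AE x in \<mu>. w i x = W i x) \<and> (AE x in \<mu>. dx \<Omega> (w i) x = W' i x)"
    by blast
qed

text \<open>The cost is defined through an unspecified choice of the state. By uniqueness it can be computed from
  the classical solution.\<close>

lemma cost_eq: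
  assumes W: "steps n w\<^sub>0 u W W'" and w\<^sub>0: "w\<^sub>0 \<in> L2 \<Omega>" and u: "u \<in> L2_tuples \<Omega> n" and wad: "wad \<in> L2_tuples \<Omega> n"
  shows "cost \<Omega> n \<tau> \<nu> M\<^sub>u M\<^sub>w f (\<lambda>r. ereal (kh r)) g w\<^sub>0 wad u
    = M\<^sub>w / 2 * (\<Sum>i=1..n. \<integral>x. (W i x - wad i x)\<^sup>2 \<partial>\<mu>) + M\<^sub>u / 2 * (\<Sum>i=1..n. \<integral>x. (u i x)\<^sup>2 \<partial>\<mu>)"
proof -
  let ?w = "state \<Omega> n \<tau> \<nu> M\<^sub>u f (\<lambda>r. ereal (kh r)) g w\<^sub>0 u"
  have sol: "solution n w\<^sub>0 u ?w"
    unfolding state_def by (rule someI[of _ W]) (rule steps_solution[OF W w\<^sub>0 u])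
  have norm: "(L2_norm \<Omega> z)\<^sup>2 = (\<integral>x. (z x)\<^sup>2 \<partial>\<mu>)" for z
    by (simp add: L2_norm_def L2_inner_def flip: power2_eq_square)
  have "(\<integral>x. (?w i x - wad i x)\<^sup>2 \<partial>\<mu>) = (\<integral>x. (W i x - wad i x)\<^sup>2 \<partial>\<mu>)" if i: "i \<in> {1..n}" for i
  proof (rule integral_cong_AE)
    note s = solution_unique[OF sol W w\<^sub>0 u i]
    have [measurable]: "wad i \<in> borel_measurable \<mu>" "W i \<in> borel_measurable \<mu>" "?w i \<in> borel_measurable \<mu>"
      using L2D(1) wad i H1_dx(1)[OF stepsD(2)[OF W i]] H1_dx(1)[OF conjunct1[OF s]] by (auto simp: L2_tuples_def)
    show "(\<lambda>x. (?w i x - wad i x)\<^sup>2) \<in> borel_measurable \<mu>" "(\<lambda>x. (W i x - wad i x)\<^sup>2) \<in> borel_measurable \<mu>"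
      by measurable
    have "AE x in \<mu>. ?w i x = W i x" using s by blast
    then show "AE x in \<mu>. (?w i x - wad i x)\<^sup>2 = (W i x - wad i x)\<^sup>2" by eventually_elim simp
  qed
  then show ?thesis unfolding cost_def Let_def norm by simp
qed

text \<open>The stability estimate propagates through the time steps: the right-hand side of step \<open>i\<close> contains the
  previous state and the control, both of which change by \<open>O(s)\<close>. The constant is uniform in \<open>s\<close>.\<close>

lemma steps_stability:
  assumes W: "steps n w\<^sub>0 u W W'" and w\<^sub>0: "w\<^sub>0 \<in> L2 \<Omega>" and u: "u \<in> L2_tuples \<Omega> n" and v: "v \<in> L2_tuples \<Omega> n"
  shows "\<exists>C\<ge>0. \<forall>s Y Y'. steps n w\<^sub>0 (\<lambda>i x. u i x + s * v i x) Y Y' \<longrightarrow>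
    (\<forall>i\<in>{1..n}. \<forall>x\<in>{a..b}. \<bar>Y i x - W i x\<bar> \<le> C * \<bar>s\<bar> \<and> \<bar>Y' i x - W' i x\<bar> \<le> C * \<bar>s\<bar>)"
proof -
  have "\<exists>C\<ge>0. \<forall>s Y Y'. steps n w\<^sub>0 (\<lambda>i x. u i x + s * v i x) Y Y' \<longrightarrow>
    (\<forall>i\<le>m. \<forall>x\<in>{a..b}. \<bar>Y i x - W i x\<bar> \<le> C * \<bar>s\<bar> \<and> (1 \<le> i \<longrightarrow> \<bar>Y' i x - W' i x\<bar> \<le> C * \<bar>s\<bar>))"
    if "m \<le> n" for m
    using that
  proof (induction m)
    case 0
    then show ?case using W by (intro exI[of _ 0]) (auto simp: steps_def)
  next
    case (Suc m)
    then obtain C where C: "C \<ge> 0" "\<And>s Y Y' i x. steps n w\<^sub>0 (\<lambda>i x. u i x + s * v i x) Y Y' \<Longrightarrow> i \<le> m \<Longrightarrow> x \<in> {a..b} \<Longrightarrow>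
        \<bar>Y i x - W i x\<bar> \<le> C * \<bar>s\<bar> \<and> (1 \<le> i \<longrightarrow> \<bar>Y' i x - W' i x\<bar> \<le> C * \<bar>s\<bar>)"
      by auto
    have m: "Suc m \<in> {1..n}" using Suc.prems by simp
    have vL2: "v (Suc m) \<in> L2 \<Omega>" and uL2: "u (Suc m) \<in> L2 \<Omega>" using u v m by (auto simp: L2_tuples_def)
    define V where "V = (\<integral>x. \<bar>v (Suc m) x\<bar> \<partial>\<mu>)"
    define K where "K = C / \<tau> * (b - a) + \<bar>M\<^sub>u\<bar> * V"
    define S where "S = max (2 / \<nu>\<^sup>2) (1 / ((b - a) * \<eta>) + 2 / \<nu>\<^sup>2 * (b - a))"
    have "V \<ge> 0" by (simp add: V_def)
    then have K: "K \<ge> 0" using C(1) \<tau> ab by (simp add: K_def)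
    show ?case
    proof (intro exI[of _ "max C (S * K)"] conjI allI impI ballI)
      show "0 \<le> max C (S * K)" using C(1) by simp
      fix s Y Y' i x assume Y: "steps n w\<^sub>0 (\<lambda>i x. u i x + s * v i x) Y Y'" and i: "i \<le> Suc m" and x: "x \<in> {a..b}"
      have le: "\<bar>t\<bar> \<le> max C (S * K) * \<bar>s\<bar>" if "\<bar>t\<bar> \<le> C * \<bar>s\<bar> \<or> \<bar>t\<bar> \<le> S * K * \<bar>s\<bar>" for t :: real
        using that mult_right_mono[of C "max C (S * K)" "\<bar>s\<bar>"] mult_right_mono[of "S * K" "max C (S * K)" "\<bar>s\<bar>"]
        by fastforce
      have new: "\<bar>Y (Suc m) x - W (Suc m) x\<bar> \<le> S * K * \<bar>s\<bar> \<and> \<bar>Y' (Suc m) x - W' (Suc m) x\<bar> \<le> S * K * \<bar>s\<bar>"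
      proof -
        let ?F\<^sub>1 = "\<lambda>x. Y m x / \<tau> + M\<^sub>u * (u (Suc m) x + s * v (Suc m) x)"
        let ?F\<^sub>2 = "\<lambda>x. W m x / \<tau> + M\<^sub>u * u (Suc m) x"
        have F: "integrable \<mu> ?F\<^sub>1" "integrable \<mu> ?F\<^sub>2"
          using Suc.prems by (auto intro!: L2_integrable[OF step_rhs_L2] L2_add[OF uL2 L2_cmult[OF vL2]] uL2
              steps_L2[OF Y w\<^sub>0] steps_L2[OF W w\<^sub>0])
        have sol: "neumann_sol a b (\<lambda>_. A) (\<lambda>_. h) ?F\<^sub>1 (Y (Suc m)) (Y' (Suc m))"
          "neumann_sol a b (\<lambda>_. A) (\<lambda>_. h) ?F\<^sub>2 (W (Suc m)) (W' (Suc m))"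
          using stepsD(1)[OF Y m] stepsD(1)[OF W m] by (simp_all add: step_def)
        define d where "d = (\<integral>x. \<bar>?F\<^sub>1 x - ?F\<^sub>2 x\<bar> \<partial>\<mu>)"
        interpret M: finite_measure \<mu> by (rule lebesgue_on_interval_finite)
        have "d \<le> (\<integral>x. C * \<bar>s\<bar> / \<tau> + \<bar>M\<^sub>u\<bar> * \<bar>s\<bar> * \<bar>v (Suc m) x\<bar> \<partial>\<mu>)"
          unfolding d_def
        proof (rule integral_mono)
          show "integrable \<mu> (\<lambda>x. \<bar>?F\<^sub>1 x - ?F\<^sub>2 x\<bar>)" using F by (intro integrable_abs Bochner_Integration.integrable_diff)
          show "integrable \<mu> (\<lambda>x. C * \<bar>s\<bar> / \<tau> + \<bar>M\<^sub>u\<bar> * \<bar>s\<bar> * \<bar>v (Suc m) x\<bar>)"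
            using L2_integrable[OF vL2] by simp
          fix x assume "x \<in> space \<mu>"
          then have x: "x \<in> {a..b}" by (auto simp: space_restrict_space)
          have "?F\<^sub>1 x - ?F\<^sub>2 x = (Y m x - W m x) / \<tau> + M\<^sub>u * s * v (Suc m) x"
            by (simp add: diff_divide_distrib algebra_simps)
          also have "\<bar>\<dots>\<bar> \<le> \<bar>Y m x - W m x\<bar> / \<tau> + \<bar>M\<^sub>u\<bar> * \<bar>s\<bar> * \<bar>v (Suc m) x\<bar>"
            using \<tau> abs_triangle_ineq[of "(Y m x - W m x) / \<tau>" "M\<^sub>u * s * v (Suc m) x"] by (simp add: abs_mult)
          also have "\<dots> \<le> C * \<bar>s\<bar> / \<tau> + \<bar>M\<^sub>u\<bar> * \<bar>s\<bar> * \<bar>v (Suc m) x\<bar>"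
            using C(2)[OF Y order_refl x] \<tau> by (simp add: divide_right_mono)
          finally show "\<bar>?F\<^sub>1 x - ?F\<^sub>2 x\<bar> \<le> C * \<bar>s\<bar> / \<tau> + \<bar>M\<^sub>u\<bar> * \<bar>s\<bar> * \<bar>v (Suc m) x\<bar>" .
        qed
        also have "\<dots> = K * \<bar>s\<bar>"
          using L2_integrable[OF vL2] ab
          by (simp add: K_def V_def measure_restrict_space space_restrict_space algebra_simps)
        finally have d: "d \<le> K * \<bar>s\<bar>" .
        have "0 \<le> d" by (simp add: d_def)
        have "\<bar>Y' (Suc m) x - W' (Suc m) x\<bar> \<le> 2 / \<nu>\<^sup>2 * d"
          "\<bar>Y (Suc m) x - W (Suc m) x\<bar> \<le> (1 / ((b - a) * \<eta>) + 2 / \<nu>\<^sup>2 * (b - a)) * d"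
          using neumann_sol_stability[OF sol F x] by (simp_all add: d_def)
        moreover have "2 / \<nu>\<^sup>2 * d \<le> S * d" "(1 / ((b - a) * \<eta>) + 2 / \<nu>\<^sup>2 * (b - a)) * d \<le> S * d"
          unfolding S_def by (rule mult_right_mono[OF max.cobounded1 \<open>0 \<le> d\<close>],
              rule mult_right_mono[OF max.cobounded2 \<open>0 \<le> d\<close>])
        moreover have "S * d \<le> S * (K * \<bar>s\<bar>)"
        proof (rule mult_left_mono[OF d])
          show "0 \<le> S" by (simp add: S_def le_max_iff_disj)
        qed
        ultimately show ?thesis by (simp add: mult.assoc)
      qed
      show "\<bar>Y i x - W i x\<bar> \<le> max C (S * K) * \<bar>s\<bar>"
        using C(2)[OF Y _ x, of i] new i by (intro le) (auto simp: le_Suc_eq)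
      show "\<bar>Y' i x - W' i x\<bar> \<le> max C (S * K) * \<bar>s\<bar>" if "1 \<le> i"
        using C(2)[OF Y _ x, of i] new i that by (intro le) (auto simp: le_Suc_eq)
    qed
  qed
  from this[OF order_refl] obtain C where "C \<ge> 0" "\<And>s Y Y' i x. steps n w\<^sub>0 (\<lambda>i x. u i x + s * v i x) Y Y' \<Longrightarrow> i \<le> n \<Longrightarrow> x \<in> {a..b} \<Longrightarrow>
        \<bar>Y i x - W i x\<bar> \<le> C * \<bar>s\<bar> \<and> (1 \<le> i \<longrightarrow> \<bar>Y' i x - W' i x\<bar> \<le> C * \<bar>s\<bar>)"
    by auto
  then show ?thesis by (intro exI[of _ C]) auto
qed

section \<open>The adjoint equation\<close>

text \<open>The left-hand side of the equation for \<open>p\<close> in the adjoint system, where \<open>q\<close> is the adjoint state of the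
  next time level and \<open>w\<close> the state at the current one.\<close>

definition adjoint_form where
  "adjoint_form q w p \<phi> = 1 / \<tau> * L2_inner \<Omega> (\<lambda>x. p x - q x) \<phi>
     + L2_inner \<Omega> (\<lambda>x. f'' (dx \<Omega> w x) * dx \<Omega> p x) (dx \<Omega> \<phi>)
     + \<nu>\<^sup>2 * L2_inner \<Omega> (dx \<Omega> p) (dx \<Omega> \<phi>)
     + L2_inner \<Omega> (\<lambda>x. g' (w x) * p x) \<phi>
     + L2_inner \<Omega> (\<lambda>x. k' (w x) * p x) \<phi>"

text \<open>Collecting terms exhibits the coefficients \<open>A'\<close> and \<open>h'\<close> along the classical state, which are continuous.\<close>

lemma adjoint_form_eq:
  assumes w: "w \<in> H1 \<Omega>" "AE x in \<mu>. w x = W x" "AE x in \<mu>. dx \<Omega> w x = W' x"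
    and W: "continuous_on {a..b} W" "continuous_on {a..b} W'"
    and p: "p \<in> H1 \<Omega>" and q: "q \<in> L2 \<Omega>" and \<phi>: "\<phi> \<in> H1 \<Omega>"
  shows "adjoint_form q w p \<phi> = (\<integral>x. (f'' (W' x) + \<nu>\<^sup>2) * dx \<Omega> p x * dx \<Omega> \<phi> x \<partial>\<mu>)
    + (\<integral>x. h' (W x) * p x * \<phi> x \<partial>\<mu>) - (\<integral>x. q x / \<tau> * \<phi> x \<partial>\<mu>)"
proof -
  note dp = H1_dx[OF p] and d\<phi> = H1_dx[OF \<phi>]
  have cW: "continuous_on {a..b} (\<lambda>x. f'' (W' x))" "continuous_on {a..b} (\<lambda>x. g' (W x))" "continuous_on {a..b} (\<lambda>x. k' (W x))"
    by (rule continuous_on_compose2[OF f(6) W(2)] continuous_on_compose2[OF g(3) W(1)] continuous_on_compose2[OF kh(5) W(1)], simp)+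
  note L2c = L2_continuous_mult[OF cW(1) dp(2)] L2_continuous_mult[OF cW(2) dp(1)] L2_continuous_mult[OF cW(3) dp(1)]
  note int = L2_mult_integrable[OF L2c(1) d\<phi>(2)] L2_mult_integrable[OF L2c(2) d\<phi>(1)] L2_mult_integrable[OF L2c(3) d\<phi>(1)]
    L2_mult_integrable[OF dp(2) d\<phi>(2)] L2_mult_integrable[OF dp(1) d\<phi>(1)] L2_mult_integrable[OF q d\<phi>(1)]
  note m[measurable] = L2D(1)[OF dp(1)] L2D(1)[OF dp(2)] L2D(1)[OF d\<phi>(1)] L2D(1)[OF d\<phi>(2)]
    continuous_on_imp_lebesgue_on(1)[OF cW(1)] continuous_on_imp_lebesgue_on(1)[OF cW(2)] continuous_on_imp_lebesgue_on(1)[OF cW(3)]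
    borel_measurable_continuous_on[OF f(6) L2D(1)[OF H1_dx(2)[OF w(1)]]]
    borel_measurable_continuous_on[OF g(3) L2D(1)[OF H1_dx(1)[OF w(1)]]]
    borel_measurable_continuous_on[OF kh(5) L2D(1)[OF H1_dx(1)[OF w(1)]]]
  have 1: "L2_inner \<Omega> (\<lambda>x. f'' (dx \<Omega> w x) * dx \<Omega> p x) (dx \<Omega> \<phi>) = (\<integral>x. f'' (W' x) * dx \<Omega> p x * dx \<Omega> \<phi> x \<partial>\<mu>)"
    unfolding L2_inner_def by (rule integral_cong_AE) (use w(3) in auto)
  have 2: "L2_inner \<Omega> (\<lambda>x. g' (w x) * p x) \<phi> = (\<integral>x. g' (W x) * p x * \<phi> x \<partial>\<mu>)"
    unfolding L2_inner_def by (rule integral_cong_AE) (use w(2) in auto)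
  have 3: "L2_inner \<Omega> (\<lambda>x. k' (w x) * p x) \<phi> = (\<integral>x. k' (W x) * p x * \<phi> x \<partial>\<mu>)"
    unfolding L2_inner_def by (rule integral_cong_AE) (use w(2) in auto)
  have "(\<integral>x. (f'' (W' x) + \<nu>\<^sup>2) * dx \<Omega> p x * dx \<Omega> \<phi> x \<partial>\<mu>)
     = (\<integral>x. f'' (W' x) * dx \<Omega> p x * dx \<Omega> \<phi> x + \<nu>\<^sup>2 * (dx \<Omega> p x * dx \<Omega> \<phi> x) \<partial>\<mu>)"
    by (rule Bochner_Integration.integral_cong) (auto simp: algebra_simps)
  also have "\<dots> = (\<integral>x. f'' (W' x) * dx \<Omega> p x * dx \<Omega> \<phi> x \<partial>\<mu>) + \<nu>\<^sup>2 * (\<integral>x. dx \<Omega> p x * dx \<Omega> \<phi> x \<partial>\<mu>)"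
    using int by simp
  finally have 4: "(\<integral>x. (f'' (W' x) + \<nu>\<^sup>2) * dx \<Omega> p x * dx \<Omega> \<phi> x \<partial>\<mu>) = \<dots>" .
  have "(\<integral>x. h' (W x) * p x * \<phi> x \<partial>\<mu>)
     = (\<integral>x. 1 / \<tau> * (p x * \<phi> x) + k' (W x) * p x * \<phi> x + g' (W x) * p x * \<phi> x \<partial>\<mu>)"
    by (rule Bochner_Integration.integral_cong) (auto simp: h'_def algebra_simps)
  also have "\<dots> = 1 / \<tau> * (\<integral>x. p x * \<phi> x \<partial>\<mu>) + (\<integral>x. k' (W x) * p x * \<phi> x \<partial>\<mu>) + (\<integral>x. g' (W x) * p x * \<phi> x \<partial>\<mu>)"
    using int by simp
  finally have 5: "(\<integral>x. h' (W x) * p x * \<phi> x \<partial>\<mu>) = \<dots>" .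
  have 6: "1 / \<tau> * L2_inner \<Omega> (\<lambda>x. p x - q x) \<phi> = 1 / \<tau> * (\<integral>x. p x * \<phi> x \<partial>\<mu>) - (\<integral>x. q x / \<tau> * \<phi> x \<partial>\<mu>)"
    using int by (simp add: L2_inner_def left_diff_distrib diff_divide_distrib)
  show ?thesis unfolding adjoint_form_def 1 2 3 4 5 6 by (simp add: L2_inner_def)
qed

text \<open>Testing with the difference of the two solutions, the form is bounded below by \<open>\<eta>\<close> times its squared
  norm.\<close>

lemma adjoint_unique:
  assumes w: "w \<in> H1 \<Omega>" "AE x in \<mu>. w x = W x" "AE x in \<mu>. dx \<Omega> w x = W' x"
    and W: "continuous_on {a..b} W" "continuous_on {a..b} W'"
    and p: "p\<^sub>1 \<in> H1 \<Omega>" "p\<^sub>2 \<in> H1 \<Omega>" and q: "q\<^sub>1 \<in> L2 \<Omega>" "q\<^sub>2 \<in> L2 \<Omega>" "AE x in \<mu>. q\<^sub>1 x = q\<^sub>2 x"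
    and eq: "\<And>\<phi>. \<phi> \<in> H1 \<Omega> \<Longrightarrow> adjoint_form q\<^sub>1 w p\<^sub>1 \<phi> = adjoint_form q\<^sub>2 w p\<^sub>2 \<phi>"
  shows "AE x in \<mu>. p\<^sub>1 x = p\<^sub>2 x"
proof -
  define \<phi> where "\<phi> x = p\<^sub>1 x - p\<^sub>2 x" for x
  have \<phi>: "\<phi> \<in> H1 \<Omega>" "AE x in \<mu>. dx \<Omega> \<phi> x = dx \<Omega> p\<^sub>1 x - dx \<Omega> p\<^sub>2 x"
    unfolding \<phi>_def[abs_def] by (rule H1_diff[OF p ab])+
  note d1 = H1_dx[OF p(1)] and d2 = H1_dx[OF p(2)] and d\<phi> = H1_dx[OF \<phi>(1)]
  have cW: "continuous_on {a..b} (\<lambda>x. f'' (W' x) + \<nu>\<^sup>2)" "continuous_on {a..b} (\<lambda>x. h' (W x))"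
    by (intro continuous_intros continuous_on_compose2[OF f(6) W(2)], simp,
        rule continuous_on_compose2[OF h'_continuous[of UNIV] W(1)], simp)
  note i1 = L2_mult_integrable[OF L2_continuous_mult[OF cW(1) d1(2)] d\<phi>(2)]
    L2_mult_integrable[OF L2_continuous_mult[OF cW(2) d1(1)] d\<phi>(1)]
  note i2 = L2_mult_integrable[OF L2_continuous_mult[OF cW(1) d2(2)] d\<phi>(2)]
    L2_mult_integrable[OF L2_continuous_mult[OF cW(2) d2(1)] d\<phi>(1)]
  have [measurable]: "q\<^sub>1 \<in> borel_measurable \<mu>" "q\<^sub>2 \<in> borel_measurable \<mu>" "\<phi> \<in> borel_measurable \<mu>"
    using L2D(1) q d\<phi> by auto
  have "(\<integral>x. q\<^sub>1 x / \<tau> * \<phi> x \<partial>\<mu>) = (\<integral>x. q\<^sub>2 x / \<tau> * \<phi> x \<partial>\<mu>)"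
  proof (rule integral_cong_AE)
    show "AE x in \<mu>. q\<^sub>1 x / \<tau> * \<phi> x = q\<^sub>2 x / \<tau> * \<phi> x" using q(3) by eventually_elim simp
  qed simp_all
  with eq[OF \<phi>(1)] have "(\<integral>x. (f'' (W' x) + \<nu>\<^sup>2) * dx \<Omega> p\<^sub>1 x * dx \<Omega> \<phi> x \<partial>\<mu>) + (\<integral>x. h' (W x) * p\<^sub>1 x * \<phi> x \<partial>\<mu>)
      = (\<integral>x. (f'' (W' x) + \<nu>\<^sup>2) * dx \<Omega> p\<^sub>2 x * dx \<Omega> \<phi> x \<partial>\<mu>) + (\<integral>x. h' (W x) * p\<^sub>2 x * \<phi> x \<partial>\<mu>)"
    unfolding adjoint_form_eq[OF w W p(1) q(1) \<phi>(1)] adjoint_form_eq[OF w W p(2) q(2) \<phi>(1)] by linarith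
  then have zero: "(\<integral>x. ((f'' (W' x) + \<nu>\<^sup>2) * dx \<Omega> p\<^sub>1 x * dx \<Omega> \<phi> x - (f'' (W' x) + \<nu>\<^sup>2) * dx \<Omega> p\<^sub>2 x * dx \<Omega> \<phi> x)
      + (h' (W x) * p\<^sub>1 x * \<phi> x - h' (W x) * p\<^sub>2 x * \<phi> x) \<partial>\<mu>) = 0"
    using i1 i2 by simp
  have i3: "integrable \<mu> (\<lambda>x. \<eta> * (\<phi> x)\<^sup>2)" using L2D(2)[OF d\<phi>(1)] by simp
  have "(\<integral>x. \<eta> * (\<phi> x)\<^sup>2 \<partial>\<mu>) \<le> 0" unfolding zero[symmetric]
  proof (rule integral_mono_AE[OF i3])
    show "integrable \<mu> (\<lambda>x. ((f'' (W' x) + \<nu>\<^sup>2) * dx \<Omega> p\<^sub>1 x * dx \<Omega> \<phi> x - (f'' (W' x) + \<nu>\<^sup>2) * dx \<Omega> p\<^sub>2 x * dx \<Omega> \<phi> x)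
      + (h' (W x) * p\<^sub>1 x * \<phi> x - h' (W x) * p\<^sub>2 x * \<phi> x))" using i1 i2 by simp
    show "AE x in \<mu>. \<eta> * (\<phi> x)\<^sup>2 \<le> ((f'' (W' x) + \<nu>\<^sup>2) * dx \<Omega> p\<^sub>1 x * dx \<Omega> \<phi> x - (f'' (W' x) + \<nu>\<^sup>2) * dx \<Omega> p\<^sub>2 x * dx \<Omega> \<phi> x)
      + (h' (W x) * p\<^sub>1 x * \<phi> x - h' (W x) * p\<^sub>2 x * \<phi> x)"
      using \<phi>(2)
    proof eventually_elim
      case (elim x)
      have "0 \<le> (f'' (W' x) + \<nu>\<^sup>2) * (dx \<Omega> p\<^sub>1 x - dx \<Omega> p\<^sub>2 x)\<^sup>2" using f''_nonneg by simp
      moreover have "\<eta> * (\<phi> x)\<^sup>2 \<le> h' (W x) * (\<phi> x)\<^sup>2" by (rule mult_right_mono[OF h'_ge]) simp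
      ultimately show ?case unfolding elim
        by (simp add: \<phi>_def power2_eq_square algebra_simps)
    qed
  qed
  moreover have "0 \<le> (\<integral>x. \<eta> * (\<phi> x)\<^sup>2 \<partial>\<mu>)" using \<eta>_pos by simp
  ultimately have "(\<integral>x. \<eta> * (\<phi> x)\<^sup>2 \<partial>\<mu>) = 0" by simp
  then have "AE x in \<mu>. \<eta> * (\<phi> x)\<^sup>2 = 0"
    using integral_nonneg_eq_0_iff_AE[OF i3] \<eta>_pos by simp
  then show ?thesis using \<eta>_pos by (simp add: \<phi>_def)
qed

definition adjoint_step where
  "adjoint_step W W' F p p' \<longleftrightarrow>
     neumann_sol a b (\<lambda>x r. (f'' (W' x) + \<nu>\<^sup>2) * r) (\<lambda>x r. h' (W x) * r) F p p'"

lemma adjoint_problem: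
  assumes W: "continuous_on {a..b} W" "continuous_on {a..b} W'"
  shows "neumann_problem a b (\<nu>\<^sup>2) \<eta> (\<lambda>x r. (f'' (W' x) + \<nu>\<^sup>2) * r) (\<lambda>x s. s / (f'' (W' x) + \<nu>\<^sup>2)) (\<lambda>x r. h' (W x) * r)"
proof
  have pos: "f'' r + \<nu>\<^sup>2 > 0" for r using f''_nonneg[of r] \<nu> by (simp add: add_nonneg_pos)
  show "a < b" "0 < \<nu>\<^sup>2" "0 < \<eta>" using ab \<nu> \<eta>_pos by auto
  show "strongly_mono (\<nu>\<^sup>2) ((*) (f'' (W' x) + \<nu>\<^sup>2))" for x
    unfolding strongly_mono_def right_diff_distrib[symmetric] using f''_nonneg by (auto intro!: mult_right_mono)
  show "strongly_mono \<eta> ((*) (h' (W x)))" for x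
    unfolding strongly_mono_def right_diff_distrib[symmetric] using h'_ge by (auto intro!: mult_right_mono)
  show "(f'' (W' x) + \<nu>\<^sup>2) * (s / (f'' (W' x) + \<nu>\<^sup>2)) = s" for x s using pos[of "W' x"] by simp
  have c: "continuous_on ({a..b} \<times> UNIV) (\<lambda>x. f'' (W' (fst x)))" "continuous_on ({a..b} \<times> UNIV) (\<lambda>x. h' (W (fst x)))"
  proof -
    have *: "continuous_on ({a..b} \<times> UNIV) (\<lambda>x. W (fst x))" "continuous_on ({a..b} \<times> UNIV) (\<lambda>x. W' (fst x))"
      by (rule continuous_on_compose2[OF W(1)] continuous_on_compose2[OF W(2)]; auto intro: continuous_intros)+
    show "continuous_on ({a..b} \<times> UNIV) (\<lambda>x. f'' (W' (fst x)))" by (rule continuous_on_compose2[OF f(6) *(2)]) simp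
    show "continuous_on ({a..b} \<times> UNIV) (\<lambda>x. h' (W (fst x)))" by (rule continuous_on_compose2[OF h'_continuous[of UNIV] *(1)]) simp
  qed
  show "continuous_on ({a..b} \<times> UNIV) (\<lambda>(t, y). y / (f'' (W' t) + \<nu>\<^sup>2))"
    unfolding case_prod_beta using pos by (intro continuous_intros c) (auto simp: less_le)
  show "continuous_on ({a..b} \<times> UNIV) (\<lambda>(t, y). h' (W t) * y)"
    unfolding case_prod_beta by (intro continuous_intros c)
qed

lemma adjoint_step_exists:
  assumes W: "continuous_on {a..b} W" "continuous_on {a..b} W'" and F: "F \<in> L2 \<Omega>"
  shows "\<exists>p p'. adjoint_step W W' F p p'"
proof -
  interpret adj: neumann_problem a b "\<nu>\<^sup>2" \<eta> "\<lambda>x r. (f'' (W' x) + \<nu>\<^sup>2) * r" "\<lambda>x s. s / (f'' (W' x) + \<nu>\<^sup>2)" "\<lambda>x r. h' (W x) * r"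
    by (rule adjoint_problem[OF W])
  have "continuous_on {a..b} (\<lambda>x. h' (W x))" by (rule continuous_on_compose2[OF h'_continuous[of UNIV] W(1)]) simp
  then obtain C where C: "\<forall>x\<in>{a..b}. \<bar>h' (W x)\<bar> \<le> C" using continuous_on_imp_lebesgue_on(2) by blast
  show ?thesis unfolding adjoint_step_def
  proof (rule adj.neumann_sol_exists[OF L2_integrable[OF F]])
    show "\<bar>h' (W t) * y - h' (W t) * z\<bar> \<le> C * \<bar>y - z\<bar>" if "t \<in> {a..b}" for t y z
      unfolding right_diff_distrib[symmetric] abs_mult using C that by (intro mult_right_mono) auto
  qed
qed

lemma adjoint_step_weak:
  assumes W: "continuous_on {a..b} W" "continuous_on {a..b} W'" and F: "F \<in> L2 \<Omega>"
    and s: "adjoint_step W W' F p p'" and \<phi>: "\<phi> \<in> H1 \<Omega>"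
  shows "(\<integral>x. (f'' (W' x) + \<nu>\<^sup>2) * p' x * dx \<Omega> \<phi> x \<partial>\<mu>) + (\<integral>x. h' (W x) * p x * \<phi> x \<partial>\<mu>) = (\<integral>x. F x * \<phi> x \<partial>\<mu>)"
proof -
  interpret adj: neumann_problem a b "\<nu>\<^sup>2" \<eta> "\<lambda>x r. (f'' (W' x) + \<nu>\<^sup>2) * r" "\<lambda>x s. s / (f'' (W' x) + \<nu>\<^sup>2)" "\<lambda>x r. h' (W x) * r"
    by (rule adjoint_problem[OF W])
  show ?thesis using adj.neumann_sol_weak[OF s[unfolded adjoint_step_def] F \<phi>] by (simp add: L2_inner_def)
qed

lemma adjoint_step_H1:
  assumes "adjoint_step W W' F p p'"
  shows "p \<in> H1 \<Omega>" "AE x in \<mu>. dx \<Omega> p x = p' x" "continuous_on {a..b} p" "continuous_on {a..b} p'"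
proof -
  note s = neumann_solD[OF assms[unfolded adjoint_step_def]]
  show "p \<in> H1 \<Omega>" "AE x in \<mu>. dx \<Omega> p x = p' x" "continuous_on {a..b} p" "continuous_on {a..b} p'"
    using C1_H1[OF s(3) s(1) ab] s(1,2) by auto
qed

end

section \<open>The first-order optimality condition\<close>

lemma uniform_first_order:
  fixes \<phi> w :: "real \<Rightarrow> real"
  assumes \<phi>: "\<And>r. (\<phi> has_real_derivative \<phi>' r) (at r)" and \<phi>': "continuous_on UNIV \<phi>'"
    and w: "continuous_on {a..b} w" and e: "e > 0"
  shows "\<forall>\<^sub>F d in at_right 0. \<forall>x\<in>{a..b}. \<forall>t. \<bar>t - w x\<bar> \<le> d \<longrightarrow>
    \<bar>\<phi> t - \<phi> (w x) - \<phi>' (w x) * (t - w x)\<bar> \<le> e * d"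
proof -
  obtain R where R: "\<forall>x\<in>{a..b}. \<bar>w x\<bar> \<le> R" using continuous_on_imp_lebesgue_on(2)[OF w] by blast
  have "uniformly_continuous_on {-R-1..R+1} \<phi>'"
    by (intro compact_uniformly_continuous continuous_on_subset[OF \<phi>']) auto
  then obtain d\<^sub>0 where d0: "d\<^sub>0 > 0"
    "\<And>r s. r \<in> {-R-1..R+1} \<Longrightarrow> s \<in> {-R-1..R+1} \<Longrightarrow> dist s r < d\<^sub>0 \<Longrightarrow> dist (\<phi>' s) (\<phi>' r) < e"
    using e unfolding uniformly_continuous_on_def by meson
  have "\<forall>\<^sub>F d in at_right 0. d \<in> {0<..<min d\<^sub>0 1}"
    using d0(1) by (intro eventually_at_right_real) simp
  then show ?thesis
  proof (rule eventually_mono, intro ballI allI impI)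
    fix d x t assume d: "d \<in> {0<..<min d\<^sub>0 1}" and x: "x \<in> {a..b}" and t: "\<bar>t - w x\<bar> \<le> d"
    define S where "S = {w x - d..w x + d}"
    let ?\<psi> = "\<lambda>r. \<phi> r - \<phi>' (w x) * r"
    have "norm (?\<psi> t - ?\<psi> (w x)) \<le> e * norm (t - w x)"
    proof (rule field_differentiable_bound[of S ?\<psi> "\<lambda>r. \<phi>' r - \<phi>' (w x)"])
      show "convex S" by (simp add: S_def)
      show "t \<in> S" "w x \<in> S" using t d by (auto simp: S_def abs_le_iff)
      fix z assume z: "z \<in> S"
      show "(?\<psi> has_real_derivative \<phi>' z - \<phi>' (w x)) (at z within S)"
        using has_field_derivative_at_within[OF \<phi>[of z]] by (auto intro!: derivative_eq_intros)
      have "\<bar>w x\<bar> \<le> R" using R x by blast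
      then have "dist (\<phi>' z) (\<phi>' (w x)) < e"
        using z d by (intro d0(2)) (auto simp: S_def dist_real_def abs_le_iff)
      then show "norm (\<phi>' z - \<phi>' (w x)) \<le> e" by (simp add: dist_norm)
    qed
    also have "\<dots> \<le> e * d" using t e by simp
    also have "?\<psi> t - ?\<psi> (w x) = \<phi> t - \<phi> (w x) - \<phi>' (w x) * (t - w x)" by (simp add: algebra_simps)
    finally show "\<bar>\<phi> t - \<phi> (w x) - \<phi>' (w x) * (t - w x)\<bar> \<le> e * d" by simp
  qed
qed

lemma abs_integral_mult_le:
  fixes \<rho> P :: "real \<Rightarrow> real"
  assumes \<rho>: "continuous_on {a..b} \<rho>" "\<And>x. x \<in> {a..b} \<Longrightarrow> \<bar>\<rho> x\<bar> \<le> B" and P: "continuous_on {a..b} P"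
  shows "\<bar>\<integral>x. \<rho> x * P x \<partial>lebesgue_on {a<..<b}\<bar> \<le> B * (\<integral>x. \<bar>P x\<bar> \<partial>lebesgue_on {a<..<b})"
proof -
  let ?M = "lebesgue_on {a<..<b}"
  have "\<bar>\<integral>x. \<rho> x * P x \<partial>?M\<bar> \<le> (\<integral>x. \<bar>\<rho> x * P x\<bar> \<partial>?M)" by (rule integral_abs_bound)
  also have "\<dots> \<le> (\<integral>x. B * \<bar>P x\<bar> \<partial>?M)"
  proof (rule integral_mono)
    show "integrable ?M (\<lambda>x. \<bar>\<rho> x * P x\<bar>)" "integrable ?M (\<lambda>x. B * \<bar>P x\<bar>)"
      by (intro continuous_on_imp_lebesgue_on(3) continuous_intros \<rho> P)+
    show "\<bar>\<rho> x * P x\<bar> \<le> B * \<bar>P x\<bar>" if "x \<in> space ?M" for x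
      using \<rho>(2)[of x] that by (auto simp: abs_mult space_restrict_space intro!: mult_right_mono)
  qed
  finally show ?thesis by simp
qed

context allen_cahn
begin

definition adjoint_steps :: "nat \<Rightarrow> (nat \<Rightarrow> real \<Rightarrow> real) \<Rightarrow> (nat \<Rightarrow> real \<Rightarrow> real) \<Rightarrow> (nat \<Rightarrow> real \<Rightarrow> real)
    \<Rightarrow> (nat \<Rightarrow> real \<Rightarrow> real) \<Rightarrow> (nat \<Rightarrow> real \<Rightarrow> real) \<Rightarrow> bool" where
  "adjoint_steps n W W' R P P' \<longleftrightarrow> P (n + 1) = (\<lambda>_. 0) \<and>
     (\<forall>i\<in>{1..n}. adjoint_step (W i) (W' i) (\<lambda>x. P (i + 1) x / \<tau> + R i x) (P i) (P' i))"

text \<open>The recursion runs backwards in time, starting from the terminal condition at \<open>n + 1\<close>.\<close>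

lemma adjoint_steps_exists:
  assumes W: "\<And>i. i \<in> {1..n} \<Longrightarrow> continuous_on {a..b} (W i)" "\<And>i. i \<in> {1..n} \<Longrightarrow> continuous_on {a..b} (W' i)"
    and R: "\<And>i. i \<in> {1..n} \<Longrightarrow> R i \<in> L2 \<Omega>"
  shows "\<exists>P P'. adjoint_steps n W W' R P P'"
proof -
  have "\<exists>P P'. P (n + 1) = (\<lambda>_. 0) \<and>
     (\<forall>i\<in>{n + 1 - m..n}. adjoint_step (W i) (W' i) (\<lambda>x. P (i + 1) x / \<tau> + R i x) (P i) (P' i))"
    if "m \<le> n" for m
    using that
  proof (induction m)
    case 0
    then show ?case by auto
  next
    case (Suc m)
    obtain P P' where P: "P (n + 1) = (\<lambda>_. 0)"
      "\<And>i. i \<in> {n + 1 - m..n} \<Longrightarrow> adjoint_step (W i) (W' i) (\<lambda>x. P (i + 1) x / \<tau> + R i x) (P i) (P' i)"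
      using Suc.IH[OF Suc_leD[OF Suc.prems]] by blast
    define j where "j = n - m"
    have j: "j \<in> {1..n}" "n + 1 - m = j + 1" "n + 1 - Suc m = j" using Suc.prems by (auto simp: j_def)
    have "P (j + 1) \<in> L2 \<Omega>"
    proof (cases "j = n")
      case True then show ?thesis using P(1) L2_continuous[of a b "\<lambda>_. 0"] by simp
    next
      case False
      then show ?thesis using P(2)[of "j + 1"] j by (intro H1_dx(1) adjoint_step_H1(1)) auto
    qed
    then have "(\<lambda>x. P (j + 1) x / \<tau> + R j x) \<in> L2 \<Omega>"
      using L2_add[OF L2_cmult[of "P (j + 1)" \<Omega> "1 / \<tau>"] R[OF j(1)]] by simp
    from adjoint_step_exists[OF W(1)[OF j(1)] W(2)[OF j(1)] this]
    obtain p p' where p: "adjoint_step (W j) (W' j) (\<lambda>x. P (j + 1) x / \<tau> + R j x) p p'" by blast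
    show ?case
    proof (intro exI conjI ballI)
      show "(P(j := p)) (n + 1) = (\<lambda>_. 0)" using P(1) j by auto
      fix i assume "i \<in> {n + 1 - Suc m..n}"
      then have "i = j \<or> i \<in> {n + 1 - m..n} \<and> i \<noteq> j" using j by auto
      moreover have "i + 1 \<noteq> j" using \<open>i \<in> _\<close> j by auto
      ultimately show "adjoint_step (W i) (W' i) (\<lambda>x. (P(j := p)) (i + 1) x / \<tau> + R i x) ((P(j := p)) i) ((P'(j := p')) i)"
        using p P(2)[of i] by auto
    qed
  qed
  from this[OF order_refl] show ?thesis unfolding adjoint_steps_def by simp
qed

lemma adjoint_stepsD:
  assumes P: "adjoint_steps n W W' R P P'" and i: "i \<in> {1..n}"
  shows "adjoint_step (W i) (W' i) (\<lambda>x. P (i + 1) x / \<tau> + R i x) (P i) (P' i)"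
    "P i \<in> H1 \<Omega>" "AE x in \<mu>. dx \<Omega> (P i) x = P' i x" "continuous_on {a..b} (P i)" "continuous_on {a..b} (P' i)"
    "continuous_on {a..b} (P (i + 1))" "R i \<in> L2 \<Omega> \<Longrightarrow> (\<lambda>x. P (i + 1) x / \<tau> + R i x) \<in> L2 \<Omega>"
proof -
  have s: "adjoint_step (W i) (W' i) (\<lambda>x. P (i + 1) x / \<tau> + R i x) (P i) (P' i)" if "i \<in> {1..n}" for i
    using P that by (simp add: adjoint_steps_def)
  show "adjoint_step (W i) (W' i) (\<lambda>x. P (i + 1) x / \<tau> + R i x) (P i) (P' i)"
    "P i \<in> H1 \<Omega>" "AE x in \<mu>. dx \<Omega> (P i) x = P' i x" "continuous_on {a..b} (P i)" "continuous_on {a..b} (P' i)"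
    using s[OF i] adjoint_step_H1[OF s[OF i]] by auto
  show c: "continuous_on {a..b} (P (i + 1))"
  proof (cases "i = n")
    case True then show ?thesis using P by (simp add: adjoint_steps_def)
  next
    case False then show ?thesis using adjoint_step_H1(3)[OF s[of "i + 1"]] i by auto
  qed
  show "(\<lambda>x. P (i + 1) x / \<tau> + R i x) \<in> L2 \<Omega>" if "R i \<in> L2 \<Omega>"
    using L2_add[OF L2_cmult[OF L2_continuous[OF c], of "1 / \<tau>"] that] by simp
qed

lemma adjoint_steps_form:
  assumes P: "adjoint_steps n W W' R P P'" and i: "i \<in> {1..n}" and R: "R i \<in> L2 \<Omega>"
    and w: "w \<in> H1 \<Omega>" "AE x in \<mu>. w x = W i x" "AE x in \<mu>. dx \<Omega> w x = W' i x"
    and W: "continuous_on {a..b} (W i)" "continuous_on {a..b} (W' i)" and \<phi>: "\<phi> \<in> H1 \<Omega>"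
  shows "adjoint_form (P (i + 1)) w (P i) \<phi> = L2_inner \<Omega> (R i) \<phi>"
proof -
  note D = adjoint_stepsD[OF P i]
  note d\<phi> = H1_dx[OF \<phi>]
  have [measurable]: "dx \<Omega> (P i) \<in> borel_measurable \<mu>" "dx \<Omega> \<phi> \<in> borel_measurable \<mu>" "P' i \<in> borel_measurable \<mu>"
    "(\<lambda>x. f'' (W' i x)) \<in> borel_measurable \<mu>"
    by (rule L2D(1)[OF H1_dx(2)[OF D(2)]], rule L2D(1)[OF d\<phi>(2)], rule continuous_on_imp_lebesgue_on(1)[OF D(5)],
        rule borel_measurable_continuous_on[OF f(6) continuous_on_imp_lebesgue_on(1)[OF W(2)]])
  have "(\<integral>x. (f'' (W' i x) + \<nu>\<^sup>2) * dx \<Omega> (P i) x * dx \<Omega> \<phi> x \<partial>\<mu>)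
      = (\<integral>x. (f'' (W' i x) + \<nu>\<^sup>2) * P' i x * dx \<Omega> \<phi> x \<partial>\<mu>)"
  proof (rule integral_cong_AE)
    show "AE x in \<mu>. (f'' (W' i x) + \<nu>\<^sup>2) * dx \<Omega> (P i) x * dx \<Omega> \<phi> x = (f'' (W' i x) + \<nu>\<^sup>2) * P' i x * dx \<Omega> \<phi> x"
      using D(3) by eventually_elim simp
  qed simp_all
  moreover have "(\<integral>x. (P (i + 1) x / \<tau> + R i x) * \<phi> x \<partial>\<mu>) = (\<integral>x. P (i + 1) x / \<tau> * \<phi> x \<partial>\<mu>) + L2_inner \<Omega> (R i) \<phi>"
    using L2_mult_integrable[OF L2_cmult[OF L2_continuous[OF D(6)], of "1 / \<tau>"] d\<phi>(1)] L2_mult_integrable[OF R d\<phi>(1)]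
    by (simp add: L2_inner_def distrib_right)
  ultimately show ?thesis
    unfolding adjoint_form_eq[OF w W D(2) L2_continuous[OF D(6)] \<phi>]
    using adjoint_step_weak[OF W D(7)[OF R] D(1) \<phi>] by linarith
qed

text \<open>Subtract the difference of the state equations, tested with \<open>P i\<close>, from the adjoint equation, tested
  with \<open>y i\<close>. On the right, the first two integrals telescope when summed over \<open>i\<close>, and the last two
  are Taylor remainders.\<close>

lemma first_variation:
  assumes W: "steps n w\<^sub>0 u W W'" and Y: "steps n w\<^sub>0 (\<lambda>i x. u i x + s * v i x) Y Y'" and w\<^sub>0: "w\<^sub>0 \<in> L2 \<Omega>"
    and u: "u \<in> L2_tuples \<Omega> n" and v: "v \<in> L2_tuples \<Omega> n"
    and P: "adjoint_steps n W W' R P P'" and R: "\<And>i. i \<in> {1..n} \<Longrightarrow> R i \<in> L2 \<Omega>" and i: "i \<in> {1..n}"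
  defines "y \<equiv> \<lambda>j x. Y j x - W j x"
  shows "(\<integral>x. R i x * y i x \<partial>\<mu>) - s * M\<^sub>u * (\<integral>x. v i x * P i x \<partial>\<mu>)
    = (\<integral>x. y (i - 1) x / \<tau> * P i x \<partial>\<mu>) - (\<integral>x. y i x / \<tau> * P (i + 1) x \<partial>\<mu>)
      - ((\<integral>x. (A (Y' i x) - A (W' i x) - (f'' (W' i x) + \<nu>\<^sup>2) * (Y' i x - W' i x)) * P' i x \<partial>\<mu>)
       + (\<integral>x. (h (Y i x) - h (W i x) - h' (W i x) * (Y i x - W i x)) * P i x \<partial>\<mu>))"
proof -
  note Wi = stepsD[OF W i] and Yi = stepsD[OF Y i] and Pi = adjoint_stepsD[OF P i]
  have le: "i - 1 \<le> n" using i unfolding atLeastAtMost_iff by linarith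
  have uL2: "u i \<in> L2 \<Omega>" and vL2: "v i \<in> L2 \<Omega>" using u v i by (auto simp: L2_tuples_def)
  have uvL2: "(\<lambda>x. u i x + s * v i x) \<in> L2 \<Omega>" by (intro L2_add uL2 L2_cmult vL2)
  note pL2 = steps_L2[OF W w\<^sub>0 le] and qL2 = steps_L2[OF Y w\<^sub>0 le]
  have yH1: "y i \<in> H1 \<Omega>" "AE x in \<mu>. dx \<Omega> (y i) x = Y' i x - W' i x"
  proof -
    note d = H1_diff[OF Yi(2) Wi(2) ab]
    show "y i \<in> H1 \<Omega>" using d(1) by (simp add: y_def)
    show "AE x in \<mu>. dx \<Omega> (y i) x = Y' i x - W' i x"
      unfolding y_def using d(2) Wi(3) Yi(3) by eventually_elim simp
  qed
  have cy: "continuous_on {a..b} (y i)" unfolding y_def by (intro continuous_intros Yi(4) Wi(4))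
  have cA: "continuous_on {a..b} (\<lambda>x. A (Y' i x))" "continuous_on {a..b} (\<lambda>x. A (W' i x))"
    "continuous_on {a..b} (\<lambda>x. f'' (W' i x))"
    by (rule continuous_on_compose2[OF continuous(7)[of UNIV] Yi(5)] continuous_on_compose2[OF continuous(7)[of UNIV] Wi(5)]
        continuous_on_compose2[OF f(6) Wi(5)], simp)+
  have ch: "continuous_on {a..b} (\<lambda>x. h (Y i x))" "continuous_on {a..b} (\<lambda>x. h (W i x))"
    "continuous_on {a..b} (\<lambda>x. h' (W i x))"
    by (rule continuous_on_compose2[OF continuous(6)[of UNIV] Yi(4)] continuous_on_compose2[OF continuous(6)[of UNIV] Wi(4)]
        continuous_on_compose2[OF h'_continuous[of UNIV] Wi(4)], simp)+
  note C = continuous_on_imp_lebesgue_on(1) continuous_on_imp_lebesgue_on(3)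
  have dP: "(\<integral>x. c x * dx \<Omega> (P i) x \<partial>\<mu>) = (\<integral>x. c x * P' i x \<partial>\<mu>)" if "continuous_on {a..b} c" for c
    using Pi(3) C(1)[OF that] L2D(1)[OF H1_dx(2)[OF Pi(2)]] C(1)[OF Pi(5)]
    by (intro integral_cong_AE) (auto elim: eventually_mono)
  have dy: "(\<integral>x. (f'' (W' i x) + \<nu>\<^sup>2) * P' i x * dx \<Omega> (y i) x \<partial>\<mu>)
      = (\<integral>x. (f'' (W' i x) + \<nu>\<^sup>2) * (Y' i x - W' i x) * P' i x \<partial>\<mu>)"
  proof (rule integral_cong_AE)
    show "(\<lambda>x. (f'' (W' i x) + \<nu>\<^sup>2) * P' i x * dx \<Omega> (y i) x) \<in> borel_measurable \<mu>"
      using L2D(1)[OF H1_dx(2)[OF yH1(1)]] C(1)[OF cA(3)] C(1)[OF Pi(5)] by simp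
    show "(\<lambda>x. (f'' (W' i x) + \<nu>\<^sup>2) * (Y' i x - W' i x) * P' i x) \<in> borel_measurable \<mu>"
      by (intro C(1) continuous_intros cA Pi(5) Yi(5) Wi(5))
    show "AE x in \<mu>. (f'' (W' i x) + \<nu>\<^sup>2) * P' i x * dx \<Omega> (y i) x = (f'' (W' i x) + \<nu>\<^sup>2) * (Y' i x - W' i x) * P' i x"
      using yH1(2) by eventually_elim simp
  qed
  note PL2 = H1_dx(1)[OF Pi(2)] and yL2 = H1_dx(1)[OF yH1(1)]
  have "(\<integral>x. (f'' (W' i x) + \<nu>\<^sup>2) * (Y' i x - W' i x) * P' i x \<partial>\<mu>) + (\<integral>x. h' (W i x) * y i x * P i x \<partial>\<mu>)
      = (\<integral>x. (P (i + 1) x / \<tau> + R i x) * y i x \<partial>\<mu>)"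
  proof -
    have "(\<lambda>x. h' (W i x) * P i x * y i x) = (\<lambda>x. h' (W i x) * y i x * P i x)" by (simp add: fun_eq_iff)
    then show ?thesis
      using adjoint_step_weak[OF Wi(4,5) Pi(7)[OF R[OF i]] Pi(1) yH1(1)] unfolding dy by (simp only:)
  qed
  also have "\<dots> = (\<integral>x. y i x / \<tau> * P (i + 1) x \<partial>\<mu>) + (\<integral>x. R i x * y i x \<partial>\<mu>)"
  proof -
    have "integrable \<mu> (\<lambda>x. y i x / \<tau> * P (i + 1) x)" using \<tau> by (intro C(2) continuous_intros cy Pi(6)) simp
    moreover have "(\<lambda>x. (P (i + 1) x / \<tau> + R i x) * y i x) = (\<lambda>x. y i x / \<tau> * P (i + 1) x + R i x * y i x)"
      by (simp add: fun_eq_iff algebra_simps)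
    ultimately show ?thesis using L2_mult_integrable[OF R[OF i] yL2] by simp
  qed
  finally have 1: "(\<integral>x. (f'' (W' i x) + \<nu>\<^sup>2) * (Y' i x - W' i x) * P' i x \<partial>\<mu>) + (\<integral>x. h' (W i x) * y i x * P i x \<partial>\<mu>)
      = (\<integral>x. y i x / \<tau> * P (i + 1) x \<partial>\<mu>) + (\<integral>x. R i x * y i x \<partial>\<mu>)" .
  have 2: "(\<integral>x. A (Y' i x) * P' i x \<partial>\<mu>) + (\<integral>x. h (Y i x) * P i x \<partial>\<mu>)
      = (\<integral>x. (Y (i - 1) x / \<tau> + M\<^sub>u * (u i x + s * v i x)) * P i x \<partial>\<mu>)"
    using neumann_sol_weak[OF Yi(1)[unfolded step_def] step_rhs_L2[OF qL2 uvL2] Pi(2)]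
    by (simp add: L2_inner_def dP[OF cA(1)])
  have 3: "(\<integral>x. A (W' i x) * P' i x \<partial>\<mu>) + (\<integral>x. h (W i x) * P i x \<partial>\<mu>)
      = (\<integral>x. (W (i - 1) x / \<tau> + M\<^sub>u * u i x) * P i x \<partial>\<mu>)"
    using neumann_sol_weak[OF Wi(1)[unfolded step_def] step_rhs_L2[OF pL2 uL2] Pi(2)]
    by (simp add: L2_inner_def dP[OF cA(2)])
  have 4: "(\<integral>x. (Y (i - 1) x / \<tau> + M\<^sub>u * (u i x + s * v i x)) * P i x \<partial>\<mu>)
      = (\<integral>x. (W (i - 1) x / \<tau> + M\<^sub>u * u i x) * P i x \<partial>\<mu>) + (\<integral>x. y (i - 1) x / \<tau> * P i x \<partial>\<mu>)
        + s * M\<^sub>u * (\<integral>x. v i x * P i x \<partial>\<mu>)"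
  proof -
    have "(\<lambda>x. (Y (i - 1) x / \<tau> + M\<^sub>u * (u i x + s * v i x)) * P i x)
        = (\<lambda>x. (W (i - 1) x / \<tau> + M\<^sub>u * u i x) * P i x + y (i - 1) x / \<tau> * P i x + s * M\<^sub>u * (v i x * P i x))"
      by (simp add: fun_eq_iff y_def diff_divide_distrib algebra_simps)
    moreover have "integrable \<mu> (\<lambda>x. y (i - 1) x / \<tau> * P i x)"
      using L2_mult_integrable[OF L2_cmult[OF L2_diff[OF qL2 pL2], of "1 / \<tau>"] PL2] by (simp add: y_def)
    ultimately show ?thesis
      using L2_mult_integrable[OF step_rhs_L2[OF pL2 uL2] PL2] L2_mult_integrable[OF vL2 PL2] by simp
  qed
  have i1: "integrable \<mu> (\<lambda>x. A (Y' i x) * P' i x)" "integrable \<mu> (\<lambda>x. A (W' i x) * P' i x)"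
    "integrable \<mu> (\<lambda>x. (f'' (W' i x) + \<nu>\<^sup>2) * (Y' i x - W' i x) * P' i x)"
    "integrable \<mu> (\<lambda>x. h (Y i x) * P i x)" "integrable \<mu> (\<lambda>x. h (W i x) * P i x)"
    "integrable \<mu> (\<lambda>x. h' (W i x) * y i x * P i x)"
    by (intro C(2) continuous_intros cA ch cy Pi(4,5) Yi(5) Wi(5))+
  have 5: "(\<integral>x. (A (Y' i x) - A (W' i x) - (f'' (W' i x) + \<nu>\<^sup>2) * (Y' i x - W' i x)) * P' i x \<partial>\<mu>)
      = (\<integral>x. A (Y' i x) * P' i x \<partial>\<mu>) - (\<integral>x. A (W' i x) * P' i x \<partial>\<mu>)
       - (\<integral>x. (f'' (W' i x) + \<nu>\<^sup>2) * (Y' i x - W' i x) * P' i x \<partial>\<mu>)"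
    using i1 by (simp add: left_diff_distrib[of _ _ "P' i _"])
  have 6: "(\<integral>x. (h (Y i x) - h (W i x) - h' (W i x) * (Y i x - W i x)) * P i x \<partial>\<mu>)
      = (\<integral>x. h (Y i x) * P i x \<partial>\<mu>) - (\<integral>x. h (W i x) * P i x \<partial>\<mu>) - (\<integral>x. h' (W i x) * y i x * P i x \<partial>\<mu>)"
    using i1 by (simp add: left_diff_distrib[of _ _ "P i _"] y_def)
  show ?thesis unfolding 5 6 using 1 2 3 4 by linarith
qed

text \<open>The cost is compared along \<open>u - r * v\<close> for the direction \<open>v = P + u\<close> and small \<open>r > 0\<close>. Dividing by \<open>r\<close> leaves
  \<open>M\<^sub>u * Q \<le> e\<close> for every \<open>e > 0\<close>, where \<open>Q\<close> is the squared norm of \<open>v\<close>.\<close>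

lemma optimality:
  fixes M\<^sub>w :: real
  assumes M: "0 \<le> M\<^sub>u" "0 \<le> M\<^sub>w"
    and w\<^sub>0: "w\<^sub>0 \<in> L2 \<Omega>" and u: "u \<in> L2_tuples \<Omega> n" and wad: "wad \<in> L2_tuples \<Omega> n"
    and opt: "\<And>v. v \<in> L2_tuples \<Omega> n \<Longrightarrow> cost \<Omega> n \<tau> \<nu> M\<^sub>u M\<^sub>w f (\<lambda>r. ereal (kh r)) g w\<^sub>0 wad u
       \<le> cost \<Omega> n \<tau> \<nu> M\<^sub>u M\<^sub>w f (\<lambda>r. ereal (kh r)) g w\<^sub>0 wad v"
    and W: "steps n w\<^sub>0 u W W'" and P: "adjoint_steps n W W' (\<lambda>i x. M\<^sub>w * (W i x - wad i x)) P P'"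
    and i: "i \<in> {1..n}"
  shows "AE x in \<mu>. M\<^sub>u * (P i x + u i x) = 0"
proof -
  interpret \<mu>: finite_measure \<mu> by (rule lebesgue_on_interval_finite)
  define R where "R i x = M\<^sub>w * (W i x - wad i x)" for i x
  have P: "adjoint_steps n W W' R P P'" using P by (simp add: R_def[abs_def])
  have WL2: "W i \<in> L2 \<Omega>" and wadL2: "wad i \<in> L2 \<Omega>" and uL2: "u i \<in> L2 \<Omega>" and PL2: "P i \<in> L2 \<Omega>"
    and RL2: "R i \<in> L2 \<Omega>" if i: "i \<in> {1..n}" for i
  proof -
    show 1: "W i \<in> L2 \<Omega>" "wad i \<in> L2 \<Omega>" "u i \<in> L2 \<Omega>" "P i \<in> L2 \<Omega>"
      using H1_dx(1)[OF stepsD(2)[OF W i]] wad u H1_dx(1)[OF adjoint_stepsD(2)[OF P i]] i by (auto simp: L2_tuples_def)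
    show "R i \<in> L2 \<Omega>" unfolding R_def by (intro L2_cmult L2_diff 1)
  qed
  define v where "v i x = P i x + u i x" for i x
  have vL2: "v i \<in> L2 \<Omega>" if "i \<in> {1..n}" for i unfolding v_def using that by (intro L2_add PL2 uL2)
  then have v: "v \<in> L2_tuples \<Omega> n" by (simp add: L2_tuples_def)
  define Q where "Q = (\<Sum>i=1..n. \<integral>x. (v i x)\<^sup>2 \<partial>\<mu>)"
  have Q0: "0 \<le> Q" by (simp add: Q_def sum_nonneg)
  obtain C where C: "C \<ge> 0" "\<And>s Y Y' i x. steps n w\<^sub>0 (\<lambda>i x. u i x + s * v i x) Y Y' \<Longrightarrow> i \<in> {1..n} \<Longrightarrow> x \<in> {a..b}
      \<Longrightarrow> \<bar>Y i x - W i x\<bar> \<le> C * \<bar>s\<bar> \<and> \<bar>Y' i x - W' i x\<bar> \<le> C * \<bar>s\<bar>"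
    using steps_stability[OF W w\<^sub>0 u v] by blast
  define N where "N = (\<Sum>i=1..n. (\<integral>x. \<bar>P' i x\<bar> \<partial>\<mu>) + (\<integral>x. \<bar>P i x\<bar> \<partial>\<mu>))"
  have N: "0 \<le> N" by (simp add: N_def sum_nonneg)
  define Z where "Z = M\<^sub>w / 2 * (real n * (C\<^sup>2 * (b - a))) + M\<^sub>u / 2 * Q"
  have Z: "0 \<le> Z" using M Q0 ab by (simp add: Z_def)
  have "M\<^sub>u * Q \<le> 0 + e" if e: "e > 0" for e
  proof -
    \<comment> \<open>accuracy of the Taylor expansions for which the remainders add up to at most \<open>r * e / 2\<close>\<close>
    define e\<^sub>1 where "e\<^sub>1 = e / (2 * (C + 1) * (N + 1))"
    have e1: "e\<^sub>1 > 0" using e C(1) N by (simp add: e\<^sub>1_def)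
    have "\<forall>\<^sub>F d in at_right 0. \<forall>i\<in>{1..n}.
        (\<forall>x\<in>{a..b}. \<forall>t. \<bar>t - W' i x\<bar> \<le> d \<longrightarrow> \<bar>A t - A (W' i x) - (f'' (W' i x) + \<nu>\<^sup>2) * (t - W' i x)\<bar> \<le> e\<^sub>1 * d) \<and>
        (\<forall>x\<in>{a..b}. \<forall>t. \<bar>t - W i x\<bar> \<le> d \<longrightarrow> \<bar>h t - h (W i x) - h' (W i x) * (t - W i x)\<bar> \<le> e\<^sub>1 * d)"
      by (intro eventually_ball_finite ballI eventually_conj
          uniform_first_order[OF A_derivative _ stepsD(5)[OF W] e1]
          uniform_first_order[OF h_derivative h'_continuous stepsD(4)[OF W] e1] continuous_intros f(6)) auto
    moreover have "\<forall>\<^sub>F d in at_right 0. d \<in> {0<..<(C + 1) * (e / (2 * (Z + 1)))}"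
      using C(1) e Z by (intro eventually_at_right_real) simp
    ultimately have small: "\<forall>\<^sub>F d in at_right 0. d \<in> {0<..<(C + 1) * (e / (2 * (Z + 1)))} \<and> (\<forall>i\<in>{1..n}.
        (\<forall>x\<in>{a..b}. \<forall>t. \<bar>t - W' i x\<bar> \<le> d \<longrightarrow> \<bar>A t - A (W' i x) - (f'' (W' i x) + \<nu>\<^sup>2) * (t - W' i x)\<bar> \<le> e\<^sub>1 * d) \<and>
        (\<forall>x\<in>{a..b}. \<forall>t. \<bar>t - W i x\<bar> \<le> d \<longrightarrow> \<bar>h t - h (W i x) - h' (W i x) * (t - W i x)\<bar> \<le> e\<^sub>1 * d))"
      by eventually_elim blast
    obtain d where d: "0 < d" "d < (C + 1) * (e / (2 * (Z + 1)))"
      and TA: "\<And>i x t. i \<in> {1..n} \<Longrightarrow> x \<in> {a..b} \<Longrightarrow> \<bar>t - W' i x\<bar> \<le> d \<Longrightarrow>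
        \<bar>A t - A (W' i x) - (f'' (W' i x) + \<nu>\<^sup>2) * (t - W' i x)\<bar> \<le> e\<^sub>1 * d"
      and Th: "\<And>i x t. i \<in> {1..n} \<Longrightarrow> x \<in> {a..b} \<Longrightarrow> \<bar>t - W i x\<bar> \<le> d \<Longrightarrow>
        \<bar>h t - h (W i x) - h' (W i x) * (t - W i x)\<bar> \<le> e\<^sub>1 * d"
      using eventually_happens[OF small] trivial_limit_at_right_real by force
    \<comment> \<open>the step size for which the states differ by at most \<open>d\<close>; the upper bound on \<open>d\<close> makes the quadratic terms at most \<open>r * e / 2\<close>\<close>
    define r where "r = d / (C + 1)"
    have r: "r > 0" "r < e / (2 * (Z + 1))" "(C + 1) * r = d" using d C(1) by (auto simp: r_def field_simps)
    have uv: "(\<lambda>i x. u i x + - r * v i x) \<in> L2_tuples \<Omega> n"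
      unfolding L2_tuples_def using L2_add[OF uL2 L2_cmult[OF vL2, of _ "- r"]] by blast
    obtain Y Y' where Y: "steps n w\<^sub>0 (\<lambda>i x. u i x + - r * v i x) Y Y'"
      using steps_exists[OF w\<^sub>0 uv] by blast
    define y where "y j x = Y j x - W j x" for j x
    have yC: "\<bar>y i x\<bar> \<le> C * r" "\<bar>Y' i x - W' i x\<bar> \<le> C * r" if "i \<in> {1..n}" "x \<in> {a..b}" for i x
      using C(2)[OF Y that] r by (simp_all add: y_def)
    have Crd: "C * r \<le> d" using r by (simp add: algebra_simps)
    have cy: "continuous_on {a..b} (y i)" if "i \<in> {1..n}" for i
      unfolding y_def using stepsD(4)[OF Y that] stepsD(4)[OF W that] by (intro continuous_intros)
    note yL2 = L2_continuous[OF cy]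
    define rem where "rem i = (\<integral>x. (A (Y' i x) - A (W' i x) - (f'' (W' i x) + \<nu>\<^sup>2) * (Y' i x - W' i x)) * P' i x \<partial>\<mu>)
       + (\<integral>x. (h (Y i x) - h (W i x) - h' (W i x) * (Y i x - W i x)) * P i x \<partial>\<mu>)" for i
    have rem: "\<bar>rem i\<bar> \<le> e\<^sub>1 * d * ((\<integral>x. \<bar>P' i x\<bar> \<partial>\<mu>) + (\<integral>x. \<bar>P i x\<bar> \<partial>\<mu>))" if i: "i \<in> {1..n}" for i
    proof -
      note Wi = stepsD(4,5)[OF W i] and Yi = stepsD(4,5)[OF Y i] and Pi = adjoint_stepsD(4,5)[OF P i]
      have "\<bar>\<integral>x. (A (Y' i x) - A (W' i x) - (f'' (W' i x) + \<nu>\<^sup>2) * (Y' i x - W' i x)) * P' i x \<partial>\<mu>\<bar>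
          \<le> e\<^sub>1 * d * (\<integral>x. \<bar>P' i x\<bar> \<partial>\<mu>)"
      proof (rule abs_integral_mult_le[OF _ _ Pi(2)])
        show "continuous_on {a..b} (\<lambda>x. A (Y' i x) - A (W' i x) - (f'' (W' i x) + \<nu>\<^sup>2) * (Y' i x - W' i x))"
          by (intro continuous_intros Yi Wi continuous_on_compose2[OF continuous(7)[of UNIV] Yi(2)]
              continuous_on_compose2[OF continuous(7)[of UNIV] Wi(2)] continuous_on_compose2[OF f(6) Wi(2)]) auto
        fix x assume x: "x \<in> {a..b}"
        have "\<bar>Y' i x - W' i x\<bar> \<le> d" using yC(2)[OF i x] Crd by linarith
        then show "\<bar>A (Y' i x) - A (W' i x) - (f'' (W' i x) + \<nu>\<^sup>2) * (Y' i x - W' i x)\<bar> \<le> e\<^sub>1 * d"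
          by (rule TA[OF i x])
      qed
      moreover have "\<bar>\<integral>x. (h (Y i x) - h (W i x) - h' (W i x) * (Y i x - W i x)) * P i x \<partial>\<mu>\<bar>
          \<le> e\<^sub>1 * d * (\<integral>x. \<bar>P i x\<bar> \<partial>\<mu>)"
      proof (rule abs_integral_mult_le[OF _ _ Pi(1)])
        show "continuous_on {a..b} (\<lambda>x. h (Y i x) - h (W i x) - h' (W i x) * (Y i x - W i x))"
          by (intro continuous_intros Yi Wi continuous_on_compose2[OF continuous(6)[of UNIV] Yi(1)]
              continuous_on_compose2[OF continuous(6)[of UNIV] Wi(1)] continuous_on_compose2[OF h'_continuous[of UNIV] Wi(1)]) auto
        fix x assume x: "x \<in> {a..b}"
        have "\<bar>Y i x - W i x\<bar> \<le> d" using yC(1)[OF i x] Crd by (simp add: y_def)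
        then show "\<bar>h (Y i x) - h (W i x) - h' (W i x) * (Y i x - W i x)\<bar> \<le> e\<^sub>1 * d"
          by (rule Th[OF i x])
      qed
      ultimately show ?thesis unfolding rem_def by (simp add: distrib_left)
    qed
    \<comment> \<open>the telescoping quantity; it vanishes for \<open>j = 0\<close> by the common initial state and for \<open>j = n\<close> by the terminal condition\<close>
    define c where "c j = (\<integral>x. y j x / \<tau> * P (j + 1) x \<partial>\<mu>)" for j
    have tele: "(\<Sum>i=1..m. c (i - 1) - c i) = c 0 - c m" for m by (induction m) auto
    have "Y 0 = W 0" using W Y by (simp add: steps_def)
    then have c0: "c 0 = 0" by (simp add: c_def y_def)
    have cn: "c n = 0" using P by (simp add: c_def adjoint_steps_def)
    have fv: "(\<integral>x. R i x * y i x \<partial>\<mu>) + r * M\<^sub>u * (\<integral>x. v i x * P i x \<partial>\<mu>) = c (i - 1) - c i - rem i"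
      if i: "i \<in> {1..n}" for i
      using first_variation[OF W Y w\<^sub>0 u v P RL2 i] i by (simp add: c_def y_def rem_def)
    have "(\<Sum>i=1..n. \<integral>x. R i x * y i x \<partial>\<mu>) + r * M\<^sub>u * (\<Sum>i=1..n. \<integral>x. v i x * P i x \<partial>\<mu>)
        = (\<Sum>i=1..n. c (i - 1) - c i - rem i)"
      unfolding sum_distrib_left sum.distrib[symmetric] by (rule sum.cong[OF refl fv])
    also have "\<dots> = - (\<Sum>i=1..n. rem i)" using tele[of n] c0 cn by (simp add: sum_subtractf)
    also have "\<dots> \<le> (\<Sum>i=1..n. \<bar>rem i\<bar>)" using sum_abs[of rem "{1..n}"] by linarith
    also have "\<dots> \<le> (\<Sum>i=1..n. e\<^sub>1 * d * ((\<integral>x. \<bar>P' i x\<bar> \<partial>\<mu>) + (\<integral>x. \<bar>P i x\<bar> \<partial>\<mu>)))"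
      by (rule sum_mono[OF rem])
    also have "\<dots> = e\<^sub>1 * d * N" by (simp add: N_def sum_distrib_left)
    also have "\<dots> \<le> e\<^sub>1 * d * (N + 1)" using e1 d by simp
    also have "\<dots> = e\<^sub>1 * (2 * (C + 1) * (N + 1)) * r / 2"
      unfolding r(3)[symmetric] by (simp add: algebra_simps)
    also have "e\<^sub>1 * (2 * (C + 1) * (N + 1)) = e" using C(1) N by (simp add: e\<^sub>1_def)
    also have "e * r / 2 = r * e / 2" by simp
    finally have lin: "(\<Sum>i=1..n. \<integral>x. R i x * y i x \<partial>\<mu>) \<le> r * e / 2 - r * M\<^sub>u * (\<Sum>i=1..n. \<integral>x. v i x * P i x \<partial>\<mu>)" by simp
    have sq: "(\<integral>x. (y i x)\<^sup>2 \<partial>\<mu>) \<le> C\<^sup>2 * (b - a) * r\<^sup>2" if i: "i \<in> {1..n}" for i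
    proof -
      have "(\<integral>x. (y i x)\<^sup>2 \<partial>\<mu>) \<le> (\<integral>x. (C * r)\<^sup>2 \<partial>\<mu>)"
      proof (rule integral_mono[OF L2D(2)[OF yL2[OF i]]])
        show "(y i x)\<^sup>2 \<le> (C * r)\<^sup>2" if "x \<in> space \<mu>" for x
          using yC(1)[OF i, of x] that power_mono[of "\<bar>y i x\<bar>" "C * r" 2] by (auto simp: space_restrict_space)
      qed simp
      also have "\<dots> = C\<^sup>2 * (b - a) * r\<^sup>2"
        using ab by (simp add: measure_restrict_space space_restrict_space power_mult_distrib)
      finally show ?thesis .
    qed
    have J1: "M\<^sub>w / 2 * (\<integral>x. (Y i x - wad i x)\<^sup>2 \<partial>\<mu>) = M\<^sub>w / 2 * (\<integral>x. (W i x - wad i x)\<^sup>2 \<partial>\<mu>)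
        + (\<integral>x. R i x * y i x \<partial>\<mu>) + M\<^sub>w / 2 * (\<integral>x. (y i x)\<^sup>2 \<partial>\<mu>)" if i: "i \<in> {1..n}" for i
    proof -
      have "M\<^sub>w / 2 * (\<integral>x. (Y i x - wad i x)\<^sup>2 \<partial>\<mu>)
          = (\<integral>x. M\<^sub>w / 2 * (W i x - wad i x)\<^sup>2 + R i x * y i x + M\<^sub>w / 2 * (y i x)\<^sup>2 \<partial>\<mu>)"
        unfolding integral_mult_right_zero[symmetric]
        by (rule Bochner_Integration.integral_cong) (auto simp: R_def y_def power2_eq_square field_simps)
      then show ?thesis
        using L2D(2)[OF L2_diff[OF WL2[OF i] wadL2[OF i]]] L2_mult_integrable[OF RL2[OF i] yL2[OF i]] L2D(2)[OF yL2[OF i]]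
        by simp
    qed
    have J2: "M\<^sub>u / 2 * (\<integral>x. (u i x + - r * v i x)\<^sup>2 \<partial>\<mu>) = M\<^sub>u / 2 * (\<integral>x. (u i x)\<^sup>2 \<partial>\<mu>)
        - r * M\<^sub>u * (\<integral>x. u i x * v i x \<partial>\<mu>) + r\<^sup>2 * (M\<^sub>u / 2 * (\<integral>x. (v i x)\<^sup>2 \<partial>\<mu>))" if i: "i \<in> {1..n}" for i
    proof -
      have "M\<^sub>u / 2 * (\<integral>x. (u i x + - r * v i x)\<^sup>2 \<partial>\<mu>)
          = (\<integral>x. M\<^sub>u / 2 * (u i x)\<^sup>2 - r * M\<^sub>u * (u i x * v i x) + r\<^sup>2 * (M\<^sub>u / 2) * (v i x)\<^sup>2 \<partial>\<mu>)"
        unfolding integral_mult_right_zero[symmetric]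
        by (rule Bochner_Integration.integral_cong) (auto simp: power2_eq_square field_simps)
      then show ?thesis
        using L2D(2)[OF uL2[OF i]] L2_mult_integrable[OF uL2[OF i] vL2[OF i]] L2D(2)[OF vL2[OF i]]
        by simp
    qed
    have Qeq: "(\<integral>x. (v i x)\<^sup>2 \<partial>\<mu>) = (\<integral>x. v i x * P i x \<partial>\<mu>) + (\<integral>x. u i x * v i x \<partial>\<mu>)" if i: "i \<in> {1..n}" for i
    proof -
      have "(\<integral>x. (v i x)\<^sup>2 \<partial>\<mu>) = (\<integral>x. v i x * P i x + u i x * v i x \<partial>\<mu>)"
        by (rule Bochner_Integration.integral_cong) (auto simp: v_def power2_eq_square algebra_simps)
      then show ?thesis using L2_mult_integrable[OF vL2[OF i] PL2[OF i]] L2_mult_integrable[OF uL2[OF i] vL2[OF i]] by simp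
    qed
    have "0 \<le> (\<Sum>i=1..n. \<integral>x. R i x * y i x \<partial>\<mu>) + M\<^sub>w / 2 * (\<Sum>i=1..n. \<integral>x. (y i x)\<^sup>2 \<partial>\<mu>)
        - r * M\<^sub>u * (\<Sum>i=1..n. \<integral>x. u i x * v i x \<partial>\<mu>) + r\<^sup>2 * (M\<^sub>u / 2 * Q)"
    proof -
      have "M\<^sub>w / 2 * (\<Sum>i=1..n. \<integral>x. (Y i x - wad i x)\<^sup>2 \<partial>\<mu>) = M\<^sub>w / 2 * (\<Sum>i=1..n. \<integral>x. (W i x - wad i x)\<^sup>2 \<partial>\<mu>)
          + (\<Sum>i=1..n. \<integral>x. R i x * y i x \<partial>\<mu>) + M\<^sub>w / 2 * (\<Sum>i=1..n. \<integral>x. (y i x)\<^sup>2 \<partial>\<mu>)"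
        unfolding sum_distrib_left sum.distrib[symmetric] by (rule sum.cong[OF refl J1])
      moreover have "M\<^sub>u / 2 * (\<Sum>i=1..n. \<integral>x. (u i x + - r * v i x)\<^sup>2 \<partial>\<mu>) = M\<^sub>u / 2 * (\<Sum>i=1..n. \<integral>x. (u i x)\<^sup>2 \<partial>\<mu>)
          - r * M\<^sub>u * (\<Sum>i=1..n. \<integral>x. u i x * v i x \<partial>\<mu>) + r\<^sup>2 * (M\<^sub>u / 2 * Q)"
        unfolding Q_def sum_distrib_left sum_subtractf[symmetric] sum.distrib[symmetric]
        by (rule sum.cong[OF refl J2])
      ultimately show ?thesis
        using opt[OF uv] unfolding cost_eq[OF W w\<^sub>0 u wad] cost_eq[OF Y w\<^sub>0 uv wad] by linarith
    qed
    also have "(\<Sum>i=1..n. \<integral>x. (y i x)\<^sup>2 \<partial>\<mu>) \<le> (\<Sum>i=1..n. C\<^sup>2 * (b - a) * r\<^sup>2)" by (rule sum_mono[OF sq])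
    finally have "0 \<le> r * e / 2 - r * M\<^sub>u * (\<Sum>i=1..n. \<integral>x. v i x * P i x \<partial>\<mu>) + M\<^sub>w / 2 * (real n * (C\<^sup>2 * (b - a) * r\<^sup>2))
        - r * M\<^sub>u * (\<Sum>i=1..n. \<integral>x. u i x * v i x \<partial>\<mu>) + r\<^sup>2 * (M\<^sub>u / 2 * Q)"
      using lin M by (simp add: mult_left_mono)
    also have "\<dots> = r * (e / 2 - M\<^sub>u * Q + Z * r)"
    proof -
      have "Q = (\<Sum>i=1..n. \<integral>x. v i x * P i x \<partial>\<mu>) + (\<Sum>i=1..n. \<integral>x. u i x * v i x \<partial>\<mu>)"
        unfolding Q_def sum.distrib[symmetric] by (rule sum.cong[OF refl Qeq])
      then have uv: "(\<Sum>i=1..n. \<integral>x. u i x * v i x \<partial>\<mu>) = Q - (\<Sum>i=1..n. \<integral>x. v i x * P i x \<partial>\<mu>)" by simp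
      show ?thesis unfolding uv Z_def by (simp add: power2_eq_square algebra_simps)
    qed
    finally have pos: "0 \<le> e / 2 - M\<^sub>u * Q + Z * r" using r(1) by (simp add: zero_le_mult_iff)
    have "Z * r \<le> (Z + 1) * (e / (2 * (Z + 1)))" using Z r by (intro mult_mono) auto
    moreover have "(Z + 1) * (e / (2 * (Z + 1))) = e / 2"
    proof -
      have "Z + 1 \<noteq> 0" using Z by simp
      then show ?thesis by (simp only: divide_divide_eq_left[symmetric] nonzero_mult_div_cancel_left
            times_divide_eq_right mult.commute[of 2]) simp
    qed
    ultimately have "Z * r \<le> e / 2" by (rule ord_le_eq_trans)
    with pos show ?thesis by simp
  qed
  then have "M\<^sub>u * Q \<le> 0" by (rule field_le_epsilon)
  then have "M\<^sub>u = 0 \<or> Q = 0" using M(1) Q0 by (smt (verit) mult_pos_pos)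
  then show ?thesis
  proof
    assume "Q = 0"
    then have "(\<integral>x. (v i x)\<^sup>2 \<partial>\<mu>) = 0" using i by (simp add: Q_def sum_nonneg_eq_0_iff)
    then have "AE x in \<mu>. (v i x)\<^sup>2 = 0"
      using integral_nonneg_eq_0_iff_AE[OF L2D(2)[OF vL2[OF i]]] by simp
    then show ?thesis by eventually_elim (simp add: v_def)
  qed simp
qed

abbreviation terminal where "terminal n p \<equiv> p(n + 1 := (\<lambda>_. 0 :: real))"

lemma adjoint_steps_unique:
  fixes p q :: "nat \<Rightarrow> real \<Rightarrow> real"
  assumes W: "steps n w\<^sub>0 u W W'"
    and w: "\<And>i. i \<in> {1..n} \<Longrightarrow> w i \<in> H1 \<Omega> \<and> (AE x in \<mu>. w i x = W i x) \<and> (AE x in \<mu>. dx \<Omega> (w i) x = W' i x)"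
    and p: "\<And>i. i \<in> {1..n} \<Longrightarrow> p i \<in> H1 \<Omega>" and q: "\<And>i. i \<in> {1..n} \<Longrightarrow> q i \<in> H1 \<Omega>"
    and eq: "\<And>i \<phi>. i \<in> {1..n} \<Longrightarrow> \<phi> \<in> H1 \<Omega> \<Longrightarrow>
      adjoint_form (terminal n p (i + 1)) (w i) (p i) \<phi> = adjoint_form (terminal n q (i + 1)) (w i) (q i) \<phi>"
    and i: "i \<in> {1..n}"
  shows "AE x in \<mu>. p i x = q i x"
proof -
  have L2: "terminal n p j \<in> L2 \<Omega>" "terminal n q j \<in> L2 \<Omega>" if "1 \<le> j" "j \<le> n + 1" for j
    using H1_dx(1)[OF p[of j]] H1_dx(1)[OF q[of j]] that L2_continuous[of a b "\<lambda>_. 0"] by auto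
  have "AE x in \<mu>. terminal n p (n + 1 - m) x = terminal n q (n + 1 - m) x" if "m \<le> n" for m
    using that
  proof (induction m)
    case 0
    then show ?case by simp
  next
    case (Suc m)
    define j where "j = n - m"
    have j: "j \<in> {1..n}" "n + 1 - m = j + 1" "n + 1 - Suc m = j" using Suc.prems by (auto simp: j_def)
    have "AE x in \<mu>. terminal n p (j + 1) x = terminal n q (j + 1) x"
      using Suc.IH[OF Suc_leD[OF Suc.prems]] unfolding j(2) .
    from adjoint_unique[OF _ _ _ stepsD(4,5)[OF W j(1)] p[OF j(1)] q[OF j(1)] L2[of "j + 1"] this eq[OF j(1)]]
    have "AE x in \<mu>. p j x = q j x" using w[OF j(1)] j by simp
    then show ?case using j by simp
  qed
  moreover have "n + 1 - i \<le> n" "n + 1 - (n + 1 - i) = i" "i \<noteq> n + 1"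
    using i unfolding atLeastAtMost_iff by linarith+
  ultimately have "AE x in \<mu>. terminal n p i x = terminal n q i x" by metis
  then show ?thesis using \<open>i \<noteq> n + 1\<close> by simp
qed

end

lemma Ck_derivatives:
  "Ck 1 f \<Longrightarrow> (f has_real_derivative deriv f r) (at r)"
  "Ck 1 f \<Longrightarrow> continuous_on UNIV (deriv f)"
  "Ck 2 f \<Longrightarrow> (f has_real_derivative deriv f r) (at r)"
  "Ck 2 f \<Longrightarrow> (deriv f has_real_derivative deriv (deriv f) r) (at r)"
  "Ck 2 f \<Longrightarrow> continuous_on UNIV (deriv (deriv f))"
proof -
  show "Ck 1 f \<Longrightarrow> (f has_real_derivative deriv f r) (at r)" "Ck 1 f \<Longrightarrow> continuous_on UNIV (deriv f)"
    by (auto simp: Ck_def intro: field_differentiable_derivI)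
  assume f: "Ck 2 f"
  then have "(deriv ^^ j) f field_differentiable (at r)" if "j < 2" for j
    using that by (simp add: Ck_def)
  from this[of 0] this[of 1] have "f field_differentiable (at r)" "deriv f field_differentiable (at r)"
    by simp_all
  then show "(f has_real_derivative deriv f r) (at r)"
    "(deriv f has_real_derivative deriv (deriv f) r) (at r)"
    by (auto intro: field_differentiable_derivI)
  show "continuous_on UNIV (deriv (deriv f))" using f by (simp add: Ck_def numeral_2_eq_2)
qed

theorem theorem4:
  fixes L T \<tau> \<nu> M\<^sub>u M\<^sub>w C\<^sub>g \<epsilon> \<delta> :: real
    and n :: nat
    and \<Omega> :: "real set"
    and f Kh K :: "real \<Rightarrow> real \<Rightarrow> real"
    and g w\<^sub>0 :: "real \<Rightarrow> real"
    and wad u w :: "nat \<Rightarrow> real \<Rightarrow> real"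
  assumes "0 < L" and "0 < T" and "\<Omega> = {-L<..<L}"
    and "1 \<le> n" and "\<tau> = T / real n" and "0 < \<tau>" and "\<tau> < 1 / (8 * (C\<^sub>g + 1))"
    and "0 < \<nu>" and "0 \<le> M\<^sub>u" and "0 \<le> M\<^sub>w"
    and "wad \<in> L2_tuples \<Omega> n"
    and "assumption_f f" and "assumption_g g C\<^sub>g" and "assumption_K Kh K"
    and "\<epsilon> \<in> {0<..1}" and "\<delta> \<in> {0<..1}"
    and "w\<^sub>0 \<in> H1 \<Omega>" and "integrable (lebesgue_on \<Omega>) (\<lambda>x. Kh \<delta> (w\<^sub>0 x))"
    and "optimal_control \<Omega> n \<tau> \<nu> M\<^sub>u M\<^sub>w (f \<epsilon>) (Kpot Kh \<delta>) g w\<^sub>0 wad u"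
    and "state_solution \<Omega> n \<tau> \<nu> M\<^sub>u (f \<epsilon>) (Kpot Kh \<delta>) g w\<^sub>0 u w"
  shows "\<exists>p. adjoint_solution \<Omega> n \<tau> \<nu> M\<^sub>w (f \<epsilon>) (K \<delta>) g wad w p
      \<and> (\<forall>q. adjoint_solution \<Omega> n \<tau> \<nu> M\<^sub>w (f \<epsilon>) (K \<delta>) g wad w q
             \<longrightarrow> (\<forall>i\<in>{1..n}. L2_eq \<Omega> (q i) (p i)))
      \<and> (\<forall>i\<in>{1..n}. L2_eq \<Omega> (\<lambda>x. M\<^sub>u * (p i x + u i x)) (\<lambda>_. 0))"
proof -
  have \<Omega>: "\<Omega> = {-L<..<L}" by fact
  have Cf: "Ck 2 (f \<epsilon>)" and f: "convex_on UNIV (f \<epsilon>)" "f \<epsilon> 0 = 0" "\<And>r. 0 \<le> f \<epsilon> r"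
    using \<open>assumption_f f\<close> \<open>\<epsilon> \<in> {0<..1}\<close> by (auto simp: assumption_f_def)
  have CK: "Ck 1 (K \<delta>)" and K: "\<And>r. (Kh \<delta> has_real_derivative K \<delta> r) (at r)"
    "\<And>r. r \<in> {-1..1} \<Longrightarrow> Kh \<delta> r = 0" "\<And>r. 0 \<le> deriv (K \<delta>) r"
    using \<open>assumption_K Kh K\<close> \<open>\<delta> \<in> {0<..1}\<close> unfolding assumption_K_def by blast+
  have Cg: "Ck 1 g" "0 < C\<^sub>g" "mono (\<lambda>r. g r + C\<^sub>g * r)"
    using \<open>assumption_g g C\<^sub>g\<close> by (auto simp: assumption_g_def)
  have Kpot: "Kpot Kh \<delta> = (\<lambda>r. ereal (Kh \<delta> r))"
    using \<open>\<delta> \<in> {0<..1}\<close> by (auto simp: Kpot_def fun_eq_iff)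
  \<comment> \<open>the potential is convex and vanishes on \<open>{-1..1}\<close>, so its tangent at \<open>0\<close> is zero\<close>
  have Kh_nonneg: "0 \<le> Kh \<delta> r" for r
  proof -
    have conv: "convex_on UNIV (Kh \<delta>)"
      by (rule f''_ge0_imp_convex[OF _ K(1) Ck_derivatives(1)[OF CK] K(3)]) simp
    have "((\<lambda>_. 0) has_real_derivative K \<delta> 0) (at 0)"
    proof (rule has_field_derivative_transform_within_open[OF K(1)])
      show "open {-1<..<1 :: real}" "0 \<in> {-1<..<1 :: real}" by auto
    qed (use K(2) in auto)
    then have "K \<delta> 0 = 0" using DERIV_unique DERIV_const by blast
    then show ?thesis using convex_above_tangent[OF conv K(1), of 0 r] K(2)[of 0] by simp
  qed
  have g': "- C\<^sub>g \<le> deriv g r" for r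
  proof -
    have "((\<lambda>r. g r + C\<^sub>g * r) has_real_derivative deriv g r + C\<^sub>g) (at r)"
      using Ck_derivatives(1)[OF Cg(1)] by (auto intro!: derivative_eq_intros)
    then show ?thesis using mono_imp_derivative_nonneg[OF Cg(3)] by fastforce
  qed
  \<comment> \<open>the smallness of the time step, from which strong monotonicity of \<open>h\<close> follows\<close>
  have "C\<^sub>g * \<tau> < 1"
  proof -
    have "\<tau> * (8 * (C\<^sub>g + 1)) < 1" using \<open>\<tau> < 1 / (8 * (C\<^sub>g + 1))\<close> Cg(2) by (simp add: pos_less_divide_eq)
    moreover have "0 < \<tau> * C\<^sub>g" using \<open>0 < \<tau>\<close> Cg(2) by simp
    ultimately show ?thesis using \<open>0 < \<tau>\<close> by (simp add: algebra_simps)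
  qed
  then have C\<tau>: "C\<^sub>g < 1 / \<tau>" using \<open>0 < \<tau>\<close> by (simp add: pos_less_divide_eq)
  interpret allen_cahn "-L" L \<tau> \<nu> C\<^sub>g M\<^sub>u "f \<epsilon>" "deriv (f \<epsilon>)" "deriv (deriv (f \<epsilon>))" "Kh \<delta>" "K \<delta>" "deriv (K \<delta>)" g "deriv g"
    using \<open>0 < L\<close> \<open>0 < \<tau>\<close> \<open>0 < \<nu>\<close> C\<tau> f Kh_nonneg K(1,3) g'
      Ck_derivatives(3-5)[OF Cf] Ck_derivatives(1,2)[OF CK] Ck_derivatives(1,2)[OF Cg(1)]
    by unfold_locales auto
  have w\<^sub>0: "w\<^sub>0 \<in> L2 {-L<..<L}" using H1_dx(1) \<open>w\<^sub>0 \<in> H1 \<Omega>\<close> \<Omega> by simp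
  have u: "u \<in> L2_tuples {-L<..<L} n" and wad: "wad \<in> L2_tuples {-L<..<L} n"
    using \<open>optimal_control _ _ _ _ _ _ _ _ _ _ _ _\<close> \<open>wad \<in> _\<close> \<Omega> by (auto simp: optimal_control_def)
  have opt: "cost {-L<..<L} n \<tau> \<nu> M\<^sub>u M\<^sub>w (f \<epsilon>) (\<lambda>r. ereal (Kh \<delta> r)) g w\<^sub>0 wad u
      \<le> cost {-L<..<L} n \<tau> \<nu> M\<^sub>u M\<^sub>w (f \<epsilon>) (\<lambda>r. ereal (Kh \<delta> r)) g w\<^sub>0 wad v" if "v \<in> L2_tuples {-L<..<L} n" for v
    using \<open>optimal_control _ _ _ _ _ _ _ _ _ _ _ _\<close> \<Omega> that by (simp add: optimal_control_def Kpot)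
  have sol: "solution n w\<^sub>0 u w"
    using \<open>state_solution _ _ _ _ _ _ _ _ _ _ _\<close> \<Omega> by (simp add: Kpot)
  obtain W W' where W: "steps n w\<^sub>0 u W W'" using steps_exists[OF w\<^sub>0 u] by blast
  note w = solution_unique[OF sol W w\<^sub>0 u]
  define R where "R i x = M\<^sub>w * (W i x - wad i x)" for i x
  have R: "R i \<in> L2 {-L<..<L}" if "i \<in> {1..n}" for i
    unfolding R_def using that wad H1_dx(1)[OF stepsD(2)[OF W that]]
    by (intro L2_cmult L2_diff) (auto simp: L2_tuples_def)
  obtain P P' where P: "adjoint_steps n W W' R P P'"
    using adjoint_steps_exists[of n W W' R, OF stepsD(4)[OF W] stepsD(5)[OF W] R] by blast
  have "P (n + 1) = (\<lambda>_. 0)" using P by (simp add: adjoint_steps_def)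
  then have PT: "terminal n P = P" by (rule fun_upd_idem)
  have form: "adjoint_form (terminal n P (i + 1)) (w i) (P i) \<phi>
      = L2_inner {-L<..<L} (\<lambda>x. M\<^sub>w * (w i x - wad i x)) \<phi>" if i: "i \<in> {1..n}" and \<phi>: "\<phi> \<in> H1 {-L<..<L}" for i \<phi>
  proof -
    have wi: "w i \<in> H1 {-L<..<L}" "AE x in lebesgue_on {-L<..<L}. w i x = W i x"
      "AE x in lebesgue_on {-L<..<L}. dx {-L<..<L} (w i) x = W' i x" using w[OF i] by auto
    have "adjoint_form (P (i + 1)) (w i) (P i) \<phi> = L2_inner {-L<..<L} (R i) \<phi>"
      by (rule adjoint_steps_form[OF P i R[OF i] wi stepsD(4,5)[OF W i] \<phi>])
    also have "\<dots> = L2_inner {-L<..<L} (\<lambda>x. M\<^sub>w * (w i x - wad i x)) \<phi>"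
    proof (rule L2_inner_cong_AE)
      show "AE x in lebesgue_on {-L<..<L}. R i x = M\<^sub>w * (w i x - wad i x)"
        using wi(2) by eventually_elim (simp add: R_def)
      show "(\<lambda>x. M\<^sub>w * (w i x - wad i x)) \<in> borel_measurable (lebesgue_on {-L<..<L})"
        using H1_dx(1)[OF wi(1)] wad i by (intro L2D(1) L2_cmult L2_diff) (auto simp: L2_tuples_def)
    qed (use L2D(1)[OF R[OF i]] L2D(1)[OF H1_dx(1)[OF \<phi>]] in auto)
    finally show ?thesis by (simp only: PT)
  qed
  have adj_iff: "adjoint_solution \<Omega> n \<tau> \<nu> M\<^sub>w (f \<epsilon>) (K \<delta>) g wad w q \<longleftrightarrow>
      (\<forall>i\<in>{1..n}. q i \<in> H1 {-L<..<L} \<and> (\<forall>\<phi>\<in>H1 {-L<..<L}. adjoint_form (terminal n q (i + 1)) (w i) (q i) \<phi>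
        = L2_inner {-L<..<L} (\<lambda>x. M\<^sub>w * (w i x - wad i x)) \<phi>))" for q
    by (simp only: adjoint_solution_def adjoint_form_def \<Omega>)
  show ?thesis
  proof (intro exI[of _ P] conjI allI impI ballI)
    show "adjoint_solution \<Omega> n \<tau> \<nu> M\<^sub>w (f \<epsilon>) (K \<delta>) g wad w P"
      unfolding adj_iff using form adjoint_stepsD(2)[OF P] by blast
    show "L2_eq \<Omega> (q i) (P i)"
      if q: "adjoint_solution \<Omega> n \<tau> \<nu> M\<^sub>w (f \<epsilon>) (K \<delta>) g wad w q" and i: "i \<in> {1..n}" for q i
    proof -
      have "AE x in lebesgue_on {-L<..<L}. q i x = P i x"
        by (rule adjoint_steps_unique[OF W w _ adjoint_stepsD(2)[OF P] _ i])
           (use q form in \<open>auto simp only: adj_iff\<close>)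
      then show ?thesis by (simp add: L2_eq_def \<Omega>)
    qed
    show "L2_eq \<Omega> (\<lambda>x. M\<^sub>u * (P i x + u i x)) (\<lambda>_. 0)" if i: "i \<in> {1..n}" for i
      using optimality[OF \<open>0 \<le> M\<^sub>u\<close> \<open>0 \<le> M\<^sub>w\<close> w\<^sub>0 u wad opt W P[unfolded R_def[abs_def]] i]
      by (simp add: L2_eq_def \<Omega>)
  qed
qed

end
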